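(* Let $\alpha\in(0,2]$, $\alpha+\gamma\in[0,2]$, $\psi(s)=s^{\alpha/2}(1+s)^{\gamma/2}$, and $\beta\in(0,1]$. Let $\mathbf f_0(\xi,\mathbf x)$ be a centred random tangent field in $\mathbf L_2(\Omega\times\mathbb S^2)$ whose Fourier coefficients $\hat f_{\ell m}:=\langle\mathbf f_0,\mathbf y_{\ell,m}\rangle$, $\tilde f_{\ell m}:=\langle\mathbf f_0,\mathbf z_{\ell,m}\rangle$ satisfy, for all $\ell,\ell'\ge1$, $|m|\le\ell$, $|m'|\le\ell'$, $$\mathbb E\big[\hat f_{\ell m}\overline{\tilde f_{\ell'm'}}\big]=0,\qquad \mathbb E\big[\hat f_{\ell m}\overline{\hat f_{\ell'm'}}\big]=\delta_{\ell\ell'}\delta_{mm'}\hat\sigma_\ell^2,\qquad \mathbb E\big[\tilde f_{\ell m}\overline{\tilde f_{\ell'm'}}\big]=\delta_{\ell\ell'}\delta_{mm'}\tilde\sigma_\ell^2,$$ where $\sum_{\ell\ge1}(2\ell+1)\hat\sigma_\ell^2<\infty$ and $\sum_{\ell\ge1}(2\ell+1)\tilde\sigma_\ell^2<\infty$. Then for $t\ge0$ and $\mathbf x\in\mathbb S^2$ the solution of the fractional stochastic Cauchy problem $$\frac{\partial^\beta}{\partial t^\beta}\mathbf u(t,\mathbf x)=-\psi(-\Delta^* )\mathbf u(t,\mathbf x),\qquad \mathbf u(0,\mathbf x)=\mathbf f_0(\mathbf x),$$ is given by $$\mathbf u(t,\mathbf x)=\sum_{\ell=1}^\infty\sum_{m=-\ell}^{\ell}E_{\beta,1}\big(-t^\beta\psi(\lambda_\ell)\big)\big(\hat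 f_{\ell m}\,\mathbf y_{\ell,m}(\mathbf x)+\tilde f_{\ell m}\,\mathbf z_{\ell,m}(\mathbf x)\big),$$ which is convergent in $\mathbf L_2(\Omega\times\mathbb S^2)$.
   Context: Vector spherical harmonics. $\mathbb S^2\subset\mathbb R^3$ is the unit sphere with surface measure, $\Delta^*$ its Laplace–Beltrami operator, $\{Y_{\ell,m}\}$ an orthonormal basis of complex spherical harmonics, $\Delta^*Y_{\ell,m}=-\lambda_\ell Y_{\ell,m}$, $\lambda_\ell=\ell(\ell+1)$. For column vectors in $\mathbb C^3$, $\mathbf a\cdot\mathbf b=\mathbf a^T\overline{\mathbf b}$, $|\mathbf a|=\sqrt{\mathbf a\cdot\mathbf a}$. A field $\mathbf f:\mathbb S^2\to\mathbb C^3$ is tangent if $\mathbf f(\mathbf x)\cdot\mathbf x=0$; for square-integrable tangent fields $\langle\mathbf f,\mathbf g\rangle=\int_{\mathbb S^2}\mathbf f\cdot\mathbf g$. The surface gradient is $\nabla^*=(I-\mathbf x\mathbf x^T)\nabla$ and the surface curl is $\mathbf L=Q_{\mathbf x}\nabla$, $Q_{\mathbf x}=\begin{pmatrix}0&-x_3&x_2\\ x_3&0&-x_1\\ -x_2&x_1&0\end{pmatrix}$. For $\ell\ge1$, $|m|\le\ell$: $\mathbf y_{\ell,m}=\mathbf L Y_{\ell,m}/\sqrt{\lambda_\ell}$ and $\mathbf z_{\ell,m}=\nabla^*Y_{\ell,m}/\sqrt{\lambda_\ell}$; together they form an orthonormal basis of the space of square-integrable tangent fields. On a probability space $(\Omega,\mathcal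 F,\mathbf P)$, $\mathbf L_2(\Omega\times\mathbb S^2)$ is the space of random tangent fields with $\|\mathbf f\|^2_{\mathbf L_2(\Omega\times\mathbb S^2)}=\mathbb E\int_{\mathbb S^2}|\mathbf f(\cdot,\mathbf x)|^2<\infty$. Operators. $E_{a,b}(z)=\sum_{k\ge0}z^k/\Gamma(ak+b)$. The fractional diffusion operator is $\psi(-\Delta^* )\mathbf f=-\int_0^\infty(\mathrm P_t\mathbf f-\mathbf f)\,\nu(\mathrm dt)$, where $\psi(z)=\int_0^\infty(1-e^{-tz})\nu(\mathrm dt)$ and $\mathrm P_t$ multiplies the coefficients of $\mathbf f$ at $\mathbf y_{\ell,m},\mathbf z_{\ell,m}$ by $e^{-t\lambda_\ell}$; thus $\psi(-\Delta^* )\mathbf y_{\ell,m}=\psi(\lambda_\ell)\mathbf y_{\ell,m}$, $\psi(-\Delta^* )\mathbf z_{\ell,m}=\psi(\lambda_\ell)\mathbf z_{\ell,m}$; it is applied to random fields for each $\xi\in\Omega$. $\frac{\partial^\beta}{\partial t^\beta}$ is $\partial/\partial t$ if $\beta=1$, and for $\beta\in(0,1)$ it is the regularized (Caputo–Djrbashian) derivative $\frac1{\Gamma(1-\beta)}\big[\frac{\partial}{\partial t}\int_0^t(t-s)^{-\beta}u(s)\,\mathrm ds-u(0)t^{-\beta}\big]$. The equation is understood coefficientwise in the basis $\mathbf y_{\ell,m},\mathbf z_{\ell,m}$. *)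

theory Defs
  imports "HOL-Probability.Probability"
begin

section \<open>Surface measure on the unit sphere of $R^3$\<close>

text \<open>
  The surface measure of \<open>A\<close> is three times the volume of the cone
  \<open>{r x | 0 < r \<le> 1, x \<in> A}\<close>.  The underlying space of the measure is the sphere itself, so
  integrals and almost-everywhere statements only involve values on the sphere.
\<close>

definition S2 :: "(real^3) measure" where
  "S2 = scale_measure 3
     (distr (restrict_space lborel (cball 0 1 - {0})) (restrict_space borel (sphere 0 1))
       (\<lambda>x. x /\<^sub>R norm x))"

section \<open>Complex vectors and square-integrable tangent fields\<close>

definition cdot :: "complex^3 \<Rightarrow> complex^3 \<Rightarrow> complex" (infixl "\<bullet>\<^sub>C" 70) where
  "a \<bullet>\<^sub>C b = (\<Sum>i\<in>UNIV. a $ i * cnj (b $ i))"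

definition cvec :: "real^3 \<Rightarrow> complex^3" where
  "cvec x = (\<chi> i. complex_of_real (x $ i))"

text \<open>The norm of the type \<^typ>\<open>complex^3\<close> is the one induced by \<^const>\<open>cdot\<close>.\<close>

lemma cdot_self: "a \<bullet>\<^sub>C a = complex_of_real ((norm a)\<^sup>2)"
proof -
  have "(norm a)\<^sup>2 = (\<Sum>i\<in>UNIV. (cmod (a $ i))\<^sup>2)"
    by (simp add: norm_vec_def L2_set_def sum_nonneg)
  then show ?thesis
    by (simp only: cdot_def of_real_sum complex_norm_square)
qed

text \<open>
  As usual for spaces of square-integrable functions, tangency is required almost everywhere.
\<close>

definition L2_tangent :: "(real^3 \<Rightarrow> complex^3) \<Rightarrow> bool" where
  "L2_tangent f \<longleftrightarrow>
     f \<in> borel_measurable S2 \<and>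
     (\<integral>\<^sup>+x. ennreal ((norm (f x))\<^sup>2) \<partial>S2) < \<infinity> \<and>
     (AE x in S2. f x \<bullet>\<^sub>C cvec x = 0)"

definition field_inner :: "(real^3 \<Rightarrow> complex^3) \<Rightarrow> (real^3 \<Rightarrow> complex^3) \<Rightarrow> complex" where
  "field_inner f g = (\<integral>x. f x \<bullet>\<^sub>C g x \<partial>S2)"

definition L2_norm_sq :: "'o measure \<Rightarrow> ('o \<Rightarrow> real^3 \<Rightarrow> complex^3) \<Rightarrow> ennreal" where
  "L2_norm_sq M f = (\<integral>\<^sup>+\<omega>. (\<integral>\<^sup>+x. ennreal ((norm (f \<omega> x))\<^sup>2) \<partial>S2) \<partial>M)"

definition L2_random_tangent :: "'o measure \<Rightarrow> ('o \<Rightarrow> real^3 \<Rightarrow> complex^3) \<Rightarrow> bool" where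
  "L2_random_tangent M f \<longleftrightarrow>
     (\<lambda>(\<omega>, x). f \<omega> x) \<in> borel_measurable (M \<Otimes>\<^sub>M S2) \<and>
     L2_norm_sq M f < \<infinity> \<and>
     (AE \<omega> in M. AE x in S2. f \<omega> x \<bullet>\<^sub>C cvec x = 0)"

section \<open>Differential operators on the sphere\<close>

text \<open>
  Functions on the sphere are differentiated through their extension that is constant along rays.
  The surface gradient and the surface curl do not depend on the choice of the (differentiable)
  extension; the Laplace-Beltrami operator is the Euclidean Laplacian of this extension.
\<close>

definition radial_ext :: "(real^3 \<Rightarrow> complex) \<Rightarrow> real^3 \<Rightarrow> complex" where
  "radial_ext f x = f (x /\<^sub>R norm x)"

definition partial :: "3 \<Rightarrow> (real^3 \<Rightarrow> complex) \<Rightarrow> real^3 \<Rightarrow> complex" where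
  "partial j f x = frechet_derivative f (at x) (axis j 1)"

definition grad :: "(real^3 \<Rightarrow> complex) \<Rightarrow> real^3 \<Rightarrow> complex^3" where
  "grad f x = (\<chi> j. partial j f x)"

definition laplacian :: "(real^3 \<Rightarrow> complex) \<Rightarrow> real^3 \<Rightarrow> complex" where
  "laplacian f x = (\<Sum>j\<in>UNIV. partial j (partial j f) x)"

definition laplace_beltrami :: "(real^3 \<Rightarrow> complex) \<Rightarrow> real^3 \<Rightarrow> complex" where
  "laplace_beltrami f = laplacian (radial_ext f)"

definition outer :: "real^3 \<Rightarrow> complex^3^3" where
  "outer x = (\<chi> i j. complex_of_real (x $ i * x $ j))"

definition Q_mat :: "real^3 \<Rightarrow> complex^3^3" where
  "Q_mat x = (let c = (\<lambda>i. complex_of_real (x $ i)) in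
     vector [vector [0, - c 3, c 2],
             vector [c 3, 0, - c 1],
             vector [- c 2, c 1, 0]])"

definition surf_grad :: "(real^3 \<Rightarrow> complex) \<Rightarrow> real^3 \<Rightarrow> complex^3" where
  "surf_grad f x = (mat 1 - outer x) *v grad (radial_ext f) x"

definition surf_curl :: "(real^3 \<Rightarrow> complex) \<Rightarrow> real^3 \<Rightarrow> complex^3" where
  "surf_curl f x = Q_mat x *v grad (radial_ext f) x"

section \<open>Scalar and vector spherical harmonics\<close>

text \<open>
  A spherical harmonic of degree \<open>l\<close> is the restriction to the sphere of a homogeneous harmonic
  polynomial of degree \<open>l\<close>.
\<close>

definition spherical_harmonic :: "nat \<Rightarrow> (real^3 \<Rightarrow> complex) \<Rightarrow> bool" where
  "spherical_harmonic l f \<longleftrightarrow>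
     (\<exists>H. polynomial_function H \<and>
          (\<forall>c x. H (c *\<^sub>R x) = c ^ l *\<^sub>R H x) \<and>
          (\<forall>x. laplacian H x = 0) \<and>
          (\<forall>x\<in>sphere 0 1. f x = H x))"

definition lam :: "nat \<Rightarrow> real" where
  "lam l = real l * (real l + 1)"

definition scalar_inner :: "(real^3 \<Rightarrow> complex) \<Rightarrow> (real^3 \<Rightarrow> complex) \<Rightarrow> complex" where
  "scalar_inner f g = (\<integral>x. f x * cnj (g x) \<partial>S2)"

text \<open>
  Orders \<open>m\<close> outside \<open>{-l..l}\<close> are irrelevant.  The last clause says that every
  square-integrable function is the mean-square limit of its Fourier series.
\<close>

definition spherical_harmonic_basis :: "(nat \<Rightarrow> int \<Rightarrow> real^3 \<Rightarrow> complex) \<Rightarrow> bool" where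
  "spherical_harmonic_basis Y \<longleftrightarrow>
     (\<forall>l. \<forall>m\<in>{-int l..int l}. spherical_harmonic l (Y l m)) \<and>
     (\<forall>l l'. \<forall>m\<in>{-int l..int l}. \<forall>m'\<in>{-int l'..int l'}.
        scalar_inner (Y l m) (Y l' m') = (if l = l' \<and> m = m' then 1 else 0)) \<and>
     (\<forall>f\<in>borel_measurable S2. (\<integral>\<^sup>+x. ennreal ((norm (f x))\<^sup>2) \<partial>S2) < \<infinity> \<longrightarrow>
        (\<lambda>N. \<integral>\<^sup>+x. ennreal ((norm (f x -
            (\<Sum>l\<le>N. \<Sum>m=-int l..int l. scalar_inner f (Y l m) * Y l m x)))\<^sup>2) \<partial>S2)
          \<longlonglongrightarrow> 0)"

definition vsh_y :: "(nat \<Rightarrow> int \<Rightarrow> real^3 \<Rightarrow> complex) \<Rightarrow> nat \<Rightarrow> int \<Rightarrow> real^3 \<Rightarrow> complex^3" where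
  "vsh_y Y l m x = surf_curl (Y l m) x /\<^sub>R sqrt (lam l)"

definition vsh_z :: "(nat \<Rightarrow> int \<Rightarrow> real^3 \<Rightarrow> complex) \<Rightarrow> nat \<Rightarrow> int \<Rightarrow> real^3 \<Rightarrow> complex^3" where
  "vsh_z Y l m x = surf_grad (Y l m) x /\<^sub>R sqrt (lam l)"

definition coeff_y ::
  "(nat \<Rightarrow> int \<Rightarrow> real^3 \<Rightarrow> complex) \<Rightarrow> nat \<Rightarrow> int \<Rightarrow> (real^3 \<Rightarrow> complex^3) \<Rightarrow> complex" where
  "coeff_y Y l m f = field_inner f (vsh_y Y l m)"

definition coeff_z ::
  "(nat \<Rightarrow> int \<Rightarrow> real^3 \<Rightarrow> complex) \<Rightarrow> nat \<Rightarrow> int \<Rightarrow> (real^3 \<Rightarrow> complex^3) \<Rightarrow> complex" where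
  "coeff_z Y l m f = field_inner f (vsh_z Y l m)"

section \<open>The fractional Cauchy problem\<close>

definition mittag_leffler :: "real \<Rightarrow> real \<Rightarrow> real \<Rightarrow> real" where
  "mittag_leffler a b z = (\<Sum>k. z ^ k / Gamma (a * real k + b))"

definition psi :: "real \<Rightarrow> real \<Rightarrow> real \<Rightarrow> real" where
  "psi \<alpha> \<gamma> s = s powr (\<alpha> / 2) * (1 + s) powr (\<gamma> / 2)"

text \<open>
  Coefficients of \<open>\<psi>(-\<Delta>\<^sup>*) f\<close>: the operator multiplies the Fourier coefficients of degree \<open>l\<close>,
  with respect to both families of vector spherical harmonics, by \<open>\<psi>(\<lambda>\<^sub>l)\<close>.  This covers
  \<open>\<alpha> + \<gamma> = 2\<close> too, where \<open>\<psi>(z) = \<integral> (1 - e\<^bsup>-tz\<^esup>) \<nu>(dt)\<close> fails because \<open>\<psi>\<close> has a linear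
  (drift) part.
\<close>

definition psi_laplace_coeff :: "(real \<Rightarrow> real) \<Rightarrow> nat \<Rightarrow> complex \<Rightarrow> complex" where
  "psi_laplace_coeff \<psi> l c = \<psi> (lam l) *\<^sub>R c"

text \<open>
  \<open>has_frac_deriv \<beta> u d t\<close>: the derivative of order \<open>\<beta>\<close> of \<open>u\<close> exists at time \<open>t > 0\<close> and
  equals \<open>d\<close>; for \<open>\<beta> < 1\<close> this is the regularized (Caputo-Djrbashian) derivative.
\<close>

definition has_frac_deriv ::
  "real \<Rightarrow> (real \<Rightarrow> complex) \<Rightarrow> complex \<Rightarrow> real \<Rightarrow> bool" where
  "has_frac_deriv \<beta> u d t \<longleftrightarrow>
     (if \<beta> = 1 then (u has_vector_derivative d) (at t)
      else \<exists>D. ((\<lambda>r. LINT s:{0..r}|lborel. (r - s) powr (-\<beta>) *\<^sub>R u s)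
                   has_vector_derivative D) (at t) \<and>
               d = (D - t powr (-\<beta>) *\<^sub>R u 0) /\<^sub>R Gamma (1 - \<beta>))"

text \<open>
  \<open>solves_coeff \<beta> \<psi> l c\<close>: the path \<open>c\<close> of a Fourier coefficient of degree \<open>l\<close> satisfies the
  equation.  Continuity on \<open>[0,\<infinity>)\<close> links the equation, posed for \<open>t > 0\<close>, to the initial value and
  makes the convolution integral meaningful.
\<close>

definition solves_coeff :: "real \<Rightarrow> (real \<Rightarrow> real) \<Rightarrow> nat \<Rightarrow> (real \<Rightarrow> complex) \<Rightarrow> bool" where
  "solves_coeff \<beta> \<psi> l c \<longleftrightarrow>
     continuous_on {0..} c \<and>
     (\<forall>t>0. has_frac_deriv \<beta> c (- psi_laplace_coeff \<psi> l (c t)) t)"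

text \<open>
  Solutions are pathwise: outside one null set of \<open>\<omega>\<close>, independent of \<open>t\<close>, all coefficient paths
  satisfy the equation.  The initial value is attained as an element of the space of
  square-integrable random fields.
\<close>

definition cauchy_solution ::
  "'o measure \<Rightarrow> (nat \<Rightarrow> int \<Rightarrow> real^3 \<Rightarrow> complex) \<Rightarrow> real \<Rightarrow> (real \<Rightarrow> real) \<Rightarrow>
   ('o \<Rightarrow> real^3 \<Rightarrow> complex^3) \<Rightarrow> (real \<Rightarrow> 'o \<Rightarrow> real^3 \<Rightarrow> complex^3) \<Rightarrow> bool" where
  "cauchy_solution M Y \<beta> \<psi> f0 u \<longleftrightarrow>
     (\<forall>t\<ge>0. L2_random_tangent M (u t)) \<and>
     (AE \<omega> in M. AE x in S2. u 0 \<omega> x = f0 \<omega> x) \<and>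
     (AE \<omega> in M.
        (\<forall>t\<ge>0. L2_tangent (u t \<omega>)) \<and>
        (\<forall>l\<ge>1. \<forall>m\<in>{-int l..int l}.
           solves_coeff \<beta> \<psi> l (\<lambda>t. coeff_y Y l m (u t \<omega>)) \<and>
           solves_coeff \<beta> \<psi> l (\<lambda>t. coeff_z Y l m (u t \<omega>))))"

text \<open>Partial sums, over degrees \<open>1 \<le> l \<le> N\<close>, of the series for \<open>u(t, \<cdot>)\<close>.\<close>

definition series_part ::
  "(nat \<Rightarrow> int \<Rightarrow> real^3 \<Rightarrow> complex) \<Rightarrow> real \<Rightarrow> (real \<Rightarrow> real) \<Rightarrow>
   ('o \<Rightarrow> real^3 \<Rightarrow> complex^3) \<Rightarrow> real \<Rightarrow> nat \<Rightarrow> 'o \<Rightarrow> real^3 \<Rightarrow> complex^3" where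
  "series_part Y \<beta> \<psi> f0 t N \<omega> x =
     (\<Sum>l=1..N. \<Sum>m=-int l..int l.
        mittag_leffler \<beta> 1 (- (t powr \<beta>) * \<psi> (lam l)) *\<^sub>R
          (coeff_y Y l m (f0 \<omega>) *s vsh_y Y l m x + coeff_z Y l m (f0 \<omega>) *s vsh_z Y l m x))"

section \<open>Consistency of the conventions\<close>

lemma S2_meas_map:
  "(\<lambda>x::real^3. x /\<^sub>R norm x) \<in>
     measurable (restrict_space lborel (cball 0 1 - {0})) (restrict_space borel (sphere 0 1))"
proof (rule measurable_restrict_space2)
  show "(\<lambda>x::real^3. x /\<^sub>R norm x) \<in> space (restrict_space lborel (cball 0 1 - {0})) \<rightarrow> sphere 0 1"
    by (auto simp: space_restrict_space)
  show "(\<lambda>x::real^3. x /\<^sub>R norm x) \<in> borel_measurable (restrict_space lborel (cball 0 1 - {0}))"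
    by (intro measurable_restrict_space1) simp
qed

lemma space_S2: "space S2 = sphere 0 1"
  by (simp add: S2_def space_scale_measure space_restrict_space)

lemma sets_S2: "sets S2 = sets (restrict_space borel (sphere 0 1))"
  by (simp add: S2_def)

lemma emeasure_S2_space: "emeasure S2 (space S2) = ennreal (4 * pi)"
proof -
  let ?C = "cball 0 1 - {0} :: (real^3) set"
  have "emeasure S2 (space S2) = 3 * emeasure (restrict_space lborel ?C)
          ((\<lambda>x. x /\<^sub>R norm x) -` sphere 0 1 \<inter> space (restrict_space lborel ?C))"
    using S2_meas_map
    by (simp add: S2_def space_scale_measure space_restrict_space emeasure_distr sets_restrict_space_iff)
  also have "(\<lambda>x. x /\<^sub>R norm x) -` sphere 0 1 \<inter> space (restrict_space lborel ?C) = ?C"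
    by (auto simp: space_restrict_space)
  also have "emeasure (restrict_space lborel ?C) ?C = emeasure lborel ?C"
    by (subst emeasure_restrict_space) auto
  also have "\<dots> = emeasure lborel (cball 0 1 :: (real^3) set)"
    by (rule emeasure_Diff_null_set) auto
  also have "\<dots> = ennreal (4 / 3 * pi)"
    by (simp add: emeasure_cball unit_ball_vol_3)
  also have "3 * \<dots> = ennreal (4 * pi)"
    by (subst ennreal_numeral[symmetric], subst ennreal_mult[symmetric]) (auto simp: field_simps)
  finally show ?thesis .
qed

lemma partial_eqI: "(f has_derivative D) (at x) \<Longrightarrow> partial j f x = D (axis j 1)"
  by (metis frechet_derivative_at partial_def)

lemma real_poly_derivative:
  "real_polynomial_function f \<Longrightarrow>
     \<exists>g. real_polynomial_function g \<and> (\<forall>x. \<exists>D. (f has_derivative D) (at x) \<and> D v = g x)"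
proof (induction rule: real_polynomial_function.induct)
  case (linear f)
  then show ?case
    by (intro exI[of _ "\<lambda>x. f v"]) (auto intro: bounded_linear_imp_has_derivative)
next
  case (const c)
  show ?case
    by (intro exI[of _ "\<lambda>x. 0"]) (auto intro!: exI[of _ "\<lambda>x. 0"])
next
  case (add f g)
  then obtain f' g' where f': "real_polynomial_function f'" "real_polynomial_function g'"
    "\<forall>x. \<exists>D. (f has_derivative D) (at x) \<and> D v = f' x"
    "\<forall>x. \<exists>D. (g has_derivative D) (at x) \<and> D v = g' x" by blast
  have "\<exists>D. ((\<lambda>x. f x + g x) has_derivative D) (at x) \<and> D v = f' x + g' x" for x
  proof -
    obtain D E where "(f has_derivative D) (at x)" "D v = f' x"
      "(g has_derivative E) (at x)" "E v = g' x" using f' by blast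
    then show ?thesis
      by (intro exI[of _ "\<lambda>h. D h + E h"]) (auto intro: has_derivative_add)
  qed
  with f' show ?case
    by (intro exI[of _ "\<lambda>x. f' x + g' x"]) auto
next
  case (mult f g)
  then obtain f' g' where f': "real_polynomial_function f'" "real_polynomial_function g'"
    "\<forall>x. \<exists>D. (f has_derivative D) (at x) \<and> D v = f' x"
    "\<forall>x. \<exists>D. (g has_derivative D) (at x) \<and> D v = g' x" by blast
  have "\<exists>D. ((\<lambda>x. f x * g x) has_derivative D) (at x) \<and> D v = f x * g' x + f' x * g x" for x
  proof -
    obtain D E where "(f has_derivative D) (at x)" "D v = f' x"
      "(g has_derivative E) (at x)" "E v = g' x" using f' by blast
    then show ?thesis
      by (intro exI[of _ "\<lambda>h. f x * E h + D h * g x"]) (auto intro: has_derivative_mult)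
  qed
  with f' mult.hyps show ?case
    by (intro exI[of _ "\<lambda>x. f x * g' x + f' x * g x"]) auto
qed

lemma poly_partial:
  fixes H :: "real^3 \<Rightarrow> complex"
  assumes "polynomial_function H"
  shows "polynomial_function (partial j H)" "\<exists>D. (H has_derivative D) (at x)"
proof -
  have re: "real_polynomial_function (\<lambda>x. Re (H x))"
    using assms bounded_linear_Re by (auto simp: polynomial_function_def o_def)
  have im: "real_polynomial_function (\<lambda>x. Im (H x))"
    using assms bounded_linear_Im by (auto simp: polynomial_function_def o_def)
  obtain g1 where g1: "real_polynomial_function g1"
    "\<forall>x. \<exists>D. ((\<lambda>x. Re (H x)) has_derivative D) (at x) \<and> D (axis j 1) = g1 x"
    using real_poly_derivative[OF re] by blast
  obtain g2 where g2: "real_polynomial_function g2"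
    "\<forall>x. \<exists>D. ((\<lambda>x. Im (H x)) has_derivative D) (at x) \<and> D (axis j 1) = g2 x"
    using real_poly_derivative[OF im] by blast
  have H_eq: "H = (\<lambda>x. Re (H x) *\<^sub>R 1 + Im (H x) *\<^sub>R \<i>)"
    by (auto simp: complex_eq_iff)
  have der: "\<exists>D. (H has_derivative D) (at x) \<and> D (axis j 1) = g1 x *\<^sub>R 1 + g2 x *\<^sub>R \<i>" for x
  proof -
    obtain D E where D: "((\<lambda>x. Re (H x)) has_derivative D) (at x)" "D (axis j 1) = g1 x"
      "((\<lambda>x. Im (H x)) has_derivative E) (at x)" "E (axis j 1) = g2 x" using g1 g2 by blast
    have "((\<lambda>x. Re (H x) *\<^sub>R 1 + Im (H x) *\<^sub>R \<i>) has_derivative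
             (\<lambda>h. D h *\<^sub>R 1 + E h *\<^sub>R \<i>)) (at x)"
      by (intro has_derivative_add has_derivative_scaleR_left D)
    then have "(H has_derivative (\<lambda>h. D h *\<^sub>R 1 + E h *\<^sub>R \<i>)) (at x)"
      unfolding H_eq[symmetric] .
    moreover have "D (axis j 1) *\<^sub>R 1 + E (axis j 1) *\<^sub>R \<i> = g1 x *\<^sub>R 1 + g2 x *\<^sub>R \<i>"
      by (simp only: D)
    ultimately show ?thesis by (intro exI conjI)
  qed
  then show "\<exists>D. (H has_derivative D) (at x)" by blast
  have "partial j H = (\<lambda>x. g1 x *\<^sub>R 1 + g2 x *\<^sub>R \<i>)"
  proof
    fix x
    obtain D where "(H has_derivative D) (at x)" "D (axis j 1) = g1 x *\<^sub>R 1 + g2 x *\<^sub>R \<i>"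
      using der by metis
    then show "partial j H x = g1 x *\<^sub>R 1 + g2 x *\<^sub>R \<i>"
      using partial_eqI by simp
  qed
  then show "polynomial_function (partial j H)"
    using g1 g2 by (auto simp: real_polynomial_function_eq)
qed

lemma euler_homogeneous:
  fixes H :: "real^3 \<Rightarrow> complex"
  assumes "polynomial_function H" and hom: "\<And>c x. H (c *\<^sub>R x) = c ^ l *\<^sub>R H x"
  shows "(\<Sum>j\<in>UNIV. (x $ j) *\<^sub>R partial j H x) = real l *\<^sub>R H x"
proof -
  obtain D where D: "(H has_derivative D) (at x)" using poly_partial(2)[OF assms(1)] by blast
  have lin: "linear D" using D has_derivative_linear by blast
  have "D x = D (\<Sum>j\<in>UNIV. (x $ j) *\<^sub>R axis j 1)"
    using basis_expansion[of x] by (simp add: scalar_mult_eq_scaleR)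
  also have "\<dots> = (\<Sum>j\<in>UNIV. (x $ j) *\<^sub>R partial j H x)"
    by (simp add: linear_sum[OF lin] linear_cmul[OF lin] partial_eqI[OF D])
  finally have Dx: "D x = \<dots>" .
  have 1: "((\<lambda>c. H (c *\<^sub>R x)) has_derivative (\<lambda>h. D (h *\<^sub>R x))) (at 1)"
    by (rule has_derivative_compose[where f="\<lambda>c. c *\<^sub>R x" and g=H])
       (use D in \<open>auto intro!: derivative_eq_intros\<close>)
  have 2: "((\<lambda>c. c ^ l *\<^sub>R H x) has_derivative (\<lambda>h. (real l * h) *\<^sub>R H x)) (at 1)"
    by (auto intro!: derivative_eq_intros)
  have "(\<lambda>h. D (h *\<^sub>R x)) = (\<lambda>h. (real l * h) *\<^sub>R H x)"
    using has_derivative_unique[OF 1[unfolded hom] 2] .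
  from fun_cong[OF this, of 1] Dx show ?thesis by simp
qed

lemma partial_powr_mult:
  fixes F :: "real^3 \<Rightarrow> complex"
  assumes "(F has_derivative D) (at y)" "y \<noteq> 0"
  shows "((\<lambda>y. (y \<bullet> y) powr k *\<^sub>R F y) has_derivative
     (\<lambda>h. (y \<bullet> y) powr k *\<^sub>R D h + (2 * k * (y \<bullet> y) powr (k - 1) * (y \<bullet> h)) *\<^sub>R F y)) (at y)"
proof -
  have "((\<lambda>y. (y \<bullet> y) powr k) has_derivative (\<lambda>h. 2 * k * (y \<bullet> y) powr (k - 1) * (y \<bullet> h))) (at y)"
  proof -
    have "((\<lambda>z. z powr k) has_derivative (\<lambda>h. (k * (y \<bullet> y) powr (k - 1)) * h)) (at (y \<bullet> y))"
      using has_real_derivative_powr[of "y \<bullet> y" k] assms(2)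
      by (simp add: has_field_derivative_def)
    from has_derivative_compose[OF has_derivative_inner[OF has_derivative_ident has_derivative_ident] this]
    show ?thesis by (simp add: inner_commute mult_ac)
  qed
  from has_derivative_scaleR[OF this assms(1)] show ?thesis by simp
qed

lemma laplace_beltrami_spherical_harmonic:
  assumes "spherical_harmonic l f" "x \<in> sphere 0 1"
  shows "laplace_beltrami f x = - lam l *\<^sub>R f x"
proof -
  obtain H where H: "polynomial_function H" "\<And>c x. H (c *\<^sub>R x) = c ^ l *\<^sub>R H x"
    "\<And>x. laplacian H x = 0" "\<And>x. x \<in> sphere 0 1 \<Longrightarrow> f x = H x"
    using assms(1) unfolding spherical_harmonic_def by blast
  define k where "k = - (real l) / 2"
  let ?F = "radial_ext f"
  have F_eq: "?F y = (y \<bullet> y) powr k *\<^sub>R H y" if "y \<noteq> 0" for y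
  proof -
    have "?F y = inverse (norm y) ^ l *\<^sub>R H y"
      using that H(4)[of "y /\<^sub>R norm y"] H(2) by (simp add: radial_ext_def)
    also have "inverse (norm y) ^ l = (y \<bullet> y) powr k"
    proof -
      have "(y \<bullet> y) powr k = norm y powr (2 * k)"
        using that powr_powr[of "norm y" 2 k] by (simp add: power2_norm_eq_inner powr_numeral)
      also have "\<dots> = inverse (norm y) ^ l"
        using that by (simp add: k_def powr_minus powr_realpow power_inverse)
      finally show ?thesis ..
    qed
    finally show ?thesis .
  qed
  have x: "x \<noteq> 0" "x \<bullet> x = 1" using assms(2) by (auto simp: norm_eq_1)
  have ev: "eventually (\<lambda>y. y \<noteq> 0) (nhds y)" if "y \<noteq> 0" for y :: "real^3"
    using that by (rule t1_space_nhds)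
  have first: "partial j ?F y =
      (y \<bullet> y) powr k *\<^sub>R partial j H y + (y \<bullet> y) powr (k - 1) *\<^sub>R ((2 * k * y $ j) *\<^sub>R H y)"
    if "y \<noteq> 0" for j y
  proof -
    obtain D where D: "(H has_derivative D) (at y)" using poly_partial(2)[OF H(1)] by blast
    have "(?F has_derivative (\<lambda>h. (y \<bullet> y) powr k *\<^sub>R D h +
            (2 * k * (y \<bullet> y) powr (k - 1) * (y \<bullet> h)) *\<^sub>R H y)) (at y)"
      by (rule has_derivative_transform_eventually[OF partial_powr_mult[OF D that, of k]])
         (use ev[OF that] F_eq that in \<open>auto simp: eventually_at_filter elim: eventually_mono\<close>)
    from partial_eqI[OF this, of j] show ?thesis
      by (simp add: partial_eqI[OF D] inner_axis mult_ac)
  qed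
  have second: "partial j (partial j ?F) x = partial j (partial j H) x +
      (4 * k) *\<^sub>R ((x $ j) *\<^sub>R partial j H x) +
      (2 * k + 4 * k * (k - 1) * (x $ j)\<^sup>2) *\<^sub>R H x" for j
  proof -
    obtain D where D: "(H has_derivative D) (at x)" using poly_partial(2)[OF H(1)] by blast
    obtain E where E: "(partial j H has_derivative E) (at x)"
      using poly_partial(2)[OF poly_partial(1)[OF H(1)]] by blast
    have G: "((\<lambda>y. (2 * k * y $ j) *\<^sub>R H y) has_derivative
              (\<lambda>h. (2 * k * x $ j) *\<^sub>R D h + (2 * k * h $ j) *\<^sub>R H x)) (at x)"
      by (auto intro!: derivative_eq_intros D bounded_linear.has_derivative[OF bounded_linear_vec_nth])
    have "(partial j ?F has_derivative
        (\<lambda>h. ((x \<bullet> x) powr k *\<^sub>R E h + (2 * k * (x \<bullet> x) powr (k - 1) * (x \<bullet> h)) *\<^sub>R partial j H x)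
           + ((x \<bullet> x) powr (k - 1) *\<^sub>R ((2 * k * x $ j) *\<^sub>R D h + (2 * k * h $ j) *\<^sub>R H x) +
              (2 * (k - 1) * (x \<bullet> x) powr (k - 1 - 1) * (x \<bullet> h)) *\<^sub>R ((2 * k * x $ j) *\<^sub>R H x)))) (at x)"
      by (rule has_derivative_transform_eventually[OF has_derivative_add[OF
              partial_powr_mult[OF E x(1), of k] partial_powr_mult[OF G x(1), of "k - 1"]]])
         (use ev[OF x(1)] first x(1) in \<open>auto simp: eventually_at_filter elim: eventually_mono\<close>)
    from partial_eqI[OF this, of j] show ?thesis
      by (simp add: partial_eqI[OF D] partial_eqI[OF E] inner_axis x(2) scaleR_conv_of_real
          algebra_simps power2_eq_square)
  qed
  have sq: "(\<Sum>j\<in>UNIV. (x $ j)\<^sup>2) = 1"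
    using x(2) by (simp add: inner_vec_def power2_eq_square)
  have "laplace_beltrami f x = laplacian H x +
      (4 * k) *\<^sub>R (\<Sum>j\<in>UNIV. (x $ j) *\<^sub>R partial j H x) +
      (\<Sum>j\<in>(UNIV::3 set). 2 * k + 4 * k * (k - 1) * (x $ j)\<^sup>2) *\<^sub>R H x"
    unfolding laplace_beltrami_def laplacian_def second scaleR_sum_left
    by (simp only: sum.distrib scaleR_sum_right)
  also have "(\<Sum>j\<in>(UNIV::3 set). 2 * k + 4 * k * (k - 1) * (x $ j)\<^sup>2) = 6 * k + 4 * k * (k - 1)"
    using sq by (simp add: sum.distrib flip: sum_distrib_left)
  also have "laplacian H x + (4 * k) *\<^sub>R (\<Sum>j\<in>UNIV. (x $ j) *\<^sub>R partial j H x) +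
      (6 * k + 4 * k * (k - 1)) *\<^sub>R H x = (4 * k * real l + (6 * k + 4 * k * (k - 1))) *\<^sub>R H x"
    using euler_homogeneous[OF H(1,2), of x] H(3)[of x] by (simp add: scaleR_add_left)
  also have "4 * k * real l + (6 * k + 4 * k * (k - 1)) = - lam l"
    by (simp add: k_def lam_def field_simps)
  finally show ?thesis using H(4)[OF assms(2)] by simp
qed

end

theory Submission
  imports Defs
begin

text \<open>
  Each Fourier coefficient satisfies a scalar fractional relaxation equation, solved by the
  Mittag-Leffler path \<open>E(- t\<^sup>\<beta> \<psi>(\<lambda>\<^sub>l))\<close> (differentiate the series; its Abel convolution is a termwise Beta
  integral). A maximum principle for the Caputo derivative gives both \<open>0 \<le> E \<le> 1\<close> and uniqueness.

  On the sphere everything follows from rotation invariance, that is from \<open>\<integral> (x \<times> \<nabla>)\<^sub>i h = 0\<close> for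
  polynomials \<open>h\<close>: integration by parts gives the orthonormality of the vector spherical harmonics.
  A tangent field orthogonal to all of them is orthogonal to every \<open>p (x \<times> e\<^sub>i)\<close> with \<open>p\<close> a spherical
  harmonic, by an explicit Helmholtz decomposition of that field, and hence vanishes by the
  completeness of the scalar harmonics.

  The solution is the pointwise limit of the partial sums of the series along degrees \<open>N\<^sub>k\<close> whose
  expected tails are at most \<open>4\<^sup>-\<^sup>k\<close>. As the weights are bounded by \<open>1\<close>, the exceptional null set of
  \<open>\<omega>\<close> and the tail bound do not depend on \<open>t\<close>.
\<close>

section \<open>The Mittag-Leffler function\<close>

text \<open>Limits in mean square taken separately for each \<open>t\<close> are determined only up
  to null sets depending on \<open>t\<close>, and uncountably many null sets cannot be united; hence
  the pointwise limit along degrees selected from the data alone. Tails of size \<open>4^-k\<close>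
  stay summable after multiplication by \<open>2^k\<close>, and this weight converts mean-square
  smallness of the increments into pointwise convergence.

  The bridge from scalar to vector completeness is that the coefficient of the function F . (x
  \<times> e_i) at a scalar harmonic p is the inner product of F with the field p (x \<times> e_i).
  At each point x the vectors x \<times> e_i span the tangent plane, so a tangent field orthogonal
  to them vanishes.

  The functions \<open>Y l m\<close> are prescribed only on the sphere. All differentiation
  therefore takes place on harmonic polynomials extending them, where Euler's identity for
  homogeneous functions expresses normal derivatives by values.\<close>

lemma Gamma_shift_ge:
  fixes x a :: real
  assumes "1 < x" "0 < a"
  shows "(x - 1) powr a * Gamma x \<le> Gamma (x + a)"
proof -
  define L where "L = (\<lambda>y::real. ln (Gamma y))"
  \<comment> \<open>\<open>x\<close> is the mean of \<open>x - 1\<close> and \<open>x + a\<close>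
    with weights \<open>a / (1 + a)\<close> and \<open>1 / (1 + a)\<close>, so log-convexity
    compares the three values of Gamma; the recurrence
    \<open>Gamma x = (x - 1) * Gamma (x - 1)\<close> then eliminates
    \<open>Gamma (x - 1)\<close>.\<close>
  have "L ((a / (1 + a)) *\<^sub>R (x - 1) + (1 / (1 + a)) *\<^sub>R (x + a))
      \<le> a / (1 + a) * L (x - 1) + 1 / (1 + a) * L (x + a)"
  proof -
    have "1 - 1 / (1 + a) = a / (1 + a)" using assms by (simp add: field_simps)
    then show ?thesis
      using convex_onD[OF log_convex_Gamma_real, of "1 / (1 + a)" "x - 1" "x + a"] assms
      unfolding L_def o_def by simp
  qed
  also have "(a / (1 + a)) *\<^sub>R (x - 1) + (1 / (1 + a)) *\<^sub>R (x + a) = ((1 + a) * x) / (1 + a)"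
    by (simp add: algebra_simps flip: add_divide_distrib)
  also have "\<dots> = x" using assms by simp
  also have "a / (1 + a) * L (x - 1) + 1 / (1 + a) * L (x + a) = (a * L (x - 1) + L (x + a)) / (1 + a)"
    by (simp add: add_divide_distrib)
  finally have "(1 + a) * L x \<le> a * L (x - 1) + L (x + a)"
    using assms by (simp add: pos_le_divide_eq mult.commute)
  moreover have "L x = ln (x - 1) + L (x - 1)"
  proof -
    have "x - 1 \<notin> \<int>\<^sub>\<le>\<^sub>0" using assms nonpos_Ints_nonpos[of "x - 1"] by auto
    then have "Gamma x = (x - 1) * Gamma (x - 1)" using Gamma_plus1[of "x - 1"] by simp
    moreover have "Gamma (x - 1) \<noteq> 0" using Gamma_real_pos[of "x - 1"] assms by linarith
    ultimately show ?thesis using assms by (simp add: L_def ln_mult)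
  qed
  ultimately have "a * ln (x - 1) + L x \<le> L (x + a)"
    by (simp add: algebra_simps)
  then have "exp (a * ln (x - 1) + L x) \<le> exp (L (x + a))"
    by simp
  then show ?thesis
    using assms by (simp add: L_def exp_add powr_def Gamma_real_pos)
qed

text \<open>Ratio test: by \<open>Gamma_shift_ge\<close> consecutive terms have ratio at most
  \<open>\<bar>z\<bar> / (a * k + b - 1) powr a\<close>, which is eventually at most 1/2.\<close>

lemma summable_mittag_leffler:
  assumes "0 < a" "0 < b"
  shows "summable (\<lambda>k. z ^ k / Gamma (a * real k + b))"
proof -
  have "filterlim (\<lambda>k. (a * real k + b - 1) powr a) at_top sequentially"
    using assms by real_asymp
  then have "eventually (\<lambda>k. 2 * \<bar>z\<bar> \<le> (a * real k + b - 1) powr a) sequentially"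
    by (simp add: filterlim_at_top)
  moreover have "eventually (\<lambda>k. 1 < a * real k + b) sequentially"
    using assms by real_asymp
  ultimately have "eventually (\<lambda>k. norm (z ^ Suc k / Gamma (a * real (Suc k) + b))
      \<le> 1 / 2 * norm (z ^ k / Gamma (a * real k + b))) sequentially"
  proof eventually_elim
    case (elim k)
    define x where "x = a * real k + b"
    have G: "0 < Gamma x" "0 < Gamma (x + a)" using elim assms by (auto simp: x_def)
    have "2 * \<bar>z\<bar> * Gamma x \<le> (x - 1) powr a * Gamma x"
      using elim G by (intro mult_right_mono) (auto simp: x_def)
    also have "\<dots> \<le> Gamma (x + a)"
      using Gamma_shift_ge[of x a] elim assms by (simp add: x_def)
    finally have "\<bar>z\<bar> ^ k * (2 * \<bar>z\<bar> * Gamma x) \<le> \<bar>z\<bar> ^ k * Gamma (x + a)"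
      by (rule mult_left_mono) simp
    then have "\<bar>z\<bar> ^ Suc k / Gamma (x + a) \<le> 1 / 2 * (\<bar>z\<bar> ^ k / Gamma x)"
      using G by (simp add: field_simps)
    moreover have "a * real (Suc k) + b = x + a" by (simp add: x_def algebra_simps)
    ultimately show ?case using G by (simp add: abs_mult power_abs x_def[symmetric])
  qed
  then obtain N where "\<And>k. N \<le> k \<Longrightarrow> norm (z ^ Suc k / Gamma (a * real (Suc k) + b))
      \<le> 1 / 2 * norm (z ^ k / Gamma (a * real k + b))"
    by (auto simp: eventually_sequentially)
  then show ?thesis by (intro summable_ratio_test[of "1/2" N]) auto
qed

text \<open>Used for \<open>b = 1\<close> to differentiate the path, and for
  \<open>b = 1 - \<beta>\<close>, where the split-off constant becomes the term
  \<open>t powr (-\<beta>)\<close> that the Caputo derivative subtracts.\<close>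

lemma mittag_leffler_rec:
  assumes "0 < a" "0 < b"
  shows "mittag_leffler a b z = 1 / Gamma b + z * mittag_leffler a (b + a) z"
proof -
  have "mittag_leffler a b z = 1 / Gamma b + (\<Sum>k. z ^ Suc k / Gamma (a * real (Suc k) + b))"
    unfolding mittag_leffler_def using suminf_split_head[OF summable_mittag_leffler[OF assms]]
    by simp
  also have "(\<lambda>k. z ^ Suc k / Gamma (a * real (Suc k) + b)) =
      (\<lambda>k. z * (z ^ k / Gamma (a * real k + (b + a))))"
    by (auto simp: algebra_simps)
  also have "(\<Sum>k. z * (z ^ k / Gamma (a * real k + (b + a)))) = z * mittag_leffler a (b + a) z"
    unfolding mittag_leffler_def using assms by (intro suminf_mult summable_mittag_leffler) auto
  finally show ?thesis .
qed

lemma mittag_leffler_0: "mittag_leffler a b 0 = 1 / Gamma b"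
  using powser_zero[of "\<lambda>k. 1 / Gamma (a * real k + b)"] by (simp add: mittag_leffler_def)

lemma mittag_leffler_1_1: "mittag_leffler 1 1 z = exp z"
  by (simp add: mittag_leffler_def exp_def add.commute[of _ 1] Gamma_fact field_simps)

text \<open>In the power series the factor \<open>b + a * k\<close> cancels against
  \<open>Gamma (a * k + b + 1)\<close>. The derivative \<open>D\<close> stays abstract, since the
  chain rule below produces exactly this combination of function and derivative.\<close>

lemma mittag_leffler_deriv:
  assumes "0 < a" "0 < b"
  obtains D where "\<And>z. (mittag_leffler a (b + 1) has_real_derivative D z) (at z)"
    and "\<And>z. b * mittag_leffler a (b + 1) z + a * z * D z = mittag_leffler a b z"
proof -
  define c where "c = (\<lambda>k. 1 / Gamma (a * real k + (b + 1)))"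
  define D where "D = (\<lambda>z. \<Sum>n. diffs c n * z ^ n)"
  have sm: "summable (\<lambda>n. c n * z ^ n)" for z
    using summable_mittag_leffler[of a "b + 1" z] assms by (simp add: c_def)
  have pow: "mittag_leffler a (b + 1) = (\<lambda>z. \<Sum>n. c n * z ^ n)"
    by (auto simp: mittag_leffler_def c_def)
  have 1: "(mittag_leffler a (b + 1) has_real_derivative D z) (at z)" for z
    unfolding pow D_def by (rule termdiffs_strong_converges_everywhere[OF sm])
  have 2: "b * mittag_leffler a (b + 1) z + a * z * D z = mittag_leffler a b z" for z
  proof -
    have "summable (\<lambda>n. diffs c n * z ^ n)"
      using termdiff_converges_all[OF sm] .
    then have "(\<lambda>n. real n * c n * z ^ (n - Suc 0)) sums D z"
      unfolding D_def using diffs_equiv by fastforce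
    then have "(\<lambda>n. a * z * (real n * c n * z ^ (n - Suc 0))) sums (a * z * D z)"
      by (rule sums_mult)
    also have "(\<lambda>n. a * z * (real n * c n * z ^ (n - Suc 0))) = (\<lambda>n. a * real n * c n * z ^ n)"
    proof
      fix n show "a * z * (real n * c n * z ^ (n - Suc 0)) = a * real n * c n * z ^ n"
        by (cases n) auto
    qed
    finally have "(\<lambda>n. b * (c n * z ^ n) + a * real n * c n * z ^ n) sums
        (b * mittag_leffler a (b + 1) z + a * z * D z)"
      using sm[of z] unfolding pow by (intro sums_add sums_mult summable_sums)
    also have "(\<lambda>n. b * (c n * z ^ n) + a * real n * c n * z ^ n) =
        (\<lambda>n. z ^ n / Gamma (a * real n + b))"
    proof
      fix n
      have p: "0 < a * real n + b" using assms by (simp add: add_nonneg_pos)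
      then have "Gamma (a * real n + (b + 1)) = (a * real n + b) * Gamma (a * real n + b)"
        using Gamma_plus1[of "a * real n + b"] nonpos_Ints_nonpos[of "a * real n + b"]
        by (auto simp: add.assoc)
      then show "b * (c n * z ^ n) + a * real n * c n * z ^ n = z ^ n / Gamma (a * real n + b)"
        using p Gamma_real_pos[OF p] unfolding c_def
        by (simp add: divide_simps) (simp add: algebra_simps)
    qed
    finally show ?thesis by (simp add: mittag_leffler_def sums_iff)
  qed
  from that[of D] 1 2 show thesis by blast
qed

lemma continuous_on_mittag_leffler:
  assumes "0 < a" "0 < b"
  shows "continuous_on A (mittag_leffler a b)"
proof -
  have "isCont (mittag_leffler a b) z" for z
  proof -
    have "isCont (\<lambda>z. \<Sum>n. (1 / Gamma (a * real n + b)) * z ^ n) z"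
      by (rule isCont_powser_converges_everywhere)
         (use summable_mittag_leffler[OF assms] in simp)
    then show ?thesis by (simp add: mittag_leffler_def[abs_def])
  qed
  then show ?thesis by (simp add: continuous_at_imp_continuous_on)
qed

abbreviation ml_path :: "real \<Rightarrow> real \<Rightarrow> real \<Rightarrow> real \<Rightarrow> real" where
  "ml_path a b K t \<equiv> mittag_leffler a b (- (t powr a) * K)"

text \<open>Up to powers of \<open>- K\<close>, the terms are
  \<open>t powr (a * k + b) / Gamma (a * k + b + 1)\<close>, and differentiating such a term lowers
  \<open>b\<close> by one. Going through \<open>mittag_leffler_deriv\<close> avoids differentiating
  a series of non-integer powers termwise.\<close>

lemma powr_mittag_leffler_deriv:
  assumes "0 < a" "0 < b" "0 < t"
  shows "((\<lambda>t. t powr b * ml_path a (b + 1) K t) has_real_derivative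
           t powr (b - 1) * ml_path a b K t) (at t)"
proof -
  obtain D where D: "\<And>z. (mittag_leffler a (b + 1) has_real_derivative D z) (at z)"
    "\<And>z. b * mittag_leffler a (b + 1) z + a * z * D z = mittag_leffler a b z"
    using mittag_leffler_deriv[OF assms(1,2)] by blast
  let ?z = "- (t powr a) * K"
  have z: "((\<lambda>t. - (t powr a) * K) has_real_derivative - (a * t powr (a - 1)) * K) (at t)"
    using assms by (auto intro!: derivative_eq_intros)
  have "((\<lambda>t. t powr b * ml_path a (b + 1) K t) has_real_derivative
     (b * t powr (b - 1)) * mittag_leffler a (b + 1) ?z
       + D ?z * (- (a * t powr (a - 1)) * K) * t powr b) (at t)"
    by (rule DERIV_mult[OF _ DERIV_chain2[OF D(1) z]])
       (use assms in \<open>auto intro!: derivative_eq_intros\<close>)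
  also have "t powr (a - 1) * t powr b = t powr a * t powr (b - 1)"
    by (simp add: algebra_simps flip: powr_add)
  then have "(b * t powr (b - 1)) * mittag_leffler a (b + 1) ?z
       + D ?z * (- (a * t powr (a - 1)) * K) * t powr b
     = t powr (b - 1) * (b * mittag_leffler a (b + 1) ?z + a * ?z * D ?z)"
    by (simp add: algebra_simps)
  also have "\<dots> = t powr (b - 1) * mittag_leffler a b ?z"
    by (simp only: D(2))
  finally show ?thesis .
qed

section \<open>The Caputo derivative at a maximum\<close>

text \<open>The substitution \<open>s = r * x\<close> reduces this to Euler's Beta integral over the
  unit interval.\<close>

lemma beta_convolution:
  fixes p q r :: real
  assumes "0 < p" "0 < q" "0 < r"
  shows "set_integrable lborel {0..r} (\<lambda>s. (r - s) powr (p - 1) * s powr (q - 1))"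
    and "(LINT s:{0..r}|lborel. (r - s) powr (p - 1) * s powr (q - 1)) =
           Gamma p * Gamma q / Gamma (p + q) * r powr (p + q - 1)"
proof -
  let ?f = "\<lambda>s. indicator {0..r} s *\<^sub>R ((r - s) powr (p - 1) * s powr (q - 1))"
  let ?g = "\<lambda>x::real. indicator {0..1} x *\<^sub>R (x powr (q - 1) * (1 - x) powr (p - 1))"
  have eq: "?f (0 + r * x) = r powr (p + q - 2) * ?g x" for x
  proof (cases "x \<in> {0..1}")
    case True
    have "(r - r * x) powr (p - 1) = r powr (p - 1) * (1 - x) powr (p - 1)"
      using True assms powr_mult[of r "1 - x" "p - 1"] by (simp add: algebra_simps)
    moreover have "(r * x) powr (q - 1) = r powr (q - 1) * x powr (q - 1)"
      using True assms by (simp add: powr_mult)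
    moreover have "r powr (p + q - 2) = r powr (p - 1) * r powr (q - 1)"
      by (simp flip: powr_add)
    ultimately show ?thesis using True assms by (simp add: mult_left_le)
  next
    case False
    then have "r * x \<notin> {0..r}" using assms by (simp add: zero_le_mult_iff)
    then show ?thesis using False by simp
  qed
  have int: "integrable lborel ?g"
    using integrable_Beta[OF assms(2,1)] by (simp add: set_integrable_def)
  then show "set_integrable lborel {0..r} (\<lambda>s. (r - s) powr (p - 1) * s powr (q - 1))"
    unfolding set_integrable_def using assms
    by (subst lborel_integrable_real_affine_iff[symmetric, of r _ 0]) (simp_all only: eq, simp_all)
  have "integral\<^sup>L lborel ?g = Beta q p"
    using set_borel_integral_eq_integral(2)[OF integrable_Beta[OF assms(2,1)]]
      integral_unique[OF has_integral_Beta_real[OF assms(2,1)]]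
    by (simp add: set_lebesgue_integral_def)
  then have "integral\<^sup>L lborel ?f = r * (r powr (p + q - 2) * Beta q p)"
    using assms by (subst lborel_integral_real_affine[of r _ 0]) (simp_all only: eq, simp_all)
  also have "r * (r powr (p + q - 2) * Beta q p) = Beta q p * r powr (p + q - 1)"
    using assms powr_add[of r 1 "p + q - 2"] by (simp add: algebra_simps)
  finally show "(LINT s:{0..r}|lborel. (r - s) powr (p - 1) * s powr (q - 1)) =
           Gamma p * Gamma q / Gamma (p + q) * r powr (p + q - 1)"
    by (simp add: set_lebesgue_integral_def Beta_def add.commute mult.commute)
qed

text \<open>Up to \<open>Gamma p\<close> this is the Riemann-Liouville integral of order
  \<open>p\<close>, which acts on each power by \<open>beta_convolution\<close>. Sum and integral
  may be interchanged because the integrals of the absolute values again form a Mittag-Leffler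
  series, at \<open>\<bar>K\<bar> * r powr a\<close>.\<close>

lemma mittag_leffler_convolution:
  fixes a b p r K :: real
  assumes "0 < a" "0 < b" "0 < p" "0 < r"
  shows "set_integrable lborel {0..r} (\<lambda>s. (r - s) powr (p - 1) *
            (s powr (b - 1) * ml_path a b K s))"
    and "(LINT s:{0..r}|lborel. (r - s) powr (p - 1) *
            (s powr (b - 1) * ml_path a b K s)) =
         Gamma p * (r powr (b + p - 1) * ml_path a (b + p) K r)"
proof -
  let ?g = "\<lambda>s. (r - s) powr (p - 1) * (s powr (b - 1) * ml_path a b K s)"
  define h where "h = (\<lambda>k s. indicator {0..r} s *\<^sub>R
      ((r - s) powr (p - 1) * s powr (a * real k + b - 1)))"
  define C where "C = (\<lambda>k. 1 / Gamma (a * real k + b))"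
  define f where "f = (\<lambda>k s. (- K) ^ k * C k * h k s)"
  have pos: "0 < a * real k + b" for k using assms by (simp add: add_nonneg_pos)
  have C: "0 < C k" for k using pos by (simp add: C_def)
  have h_int: "integrable lborel (h k)" for k
    using beta_convolution(1)[OF assms(3) pos assms(4)]
    by (simp add: h_def set_integrable_def algebra_simps)
  have h_eq: "C k * integral\<^sup>L lborel (h k) =
      Gamma p * r powr (b + p - 1) * (r powr a) ^ k / Gamma (a * real k + (b + p))" for k
  proof -
    have "integral\<^sup>L lborel (h k) = Gamma p * Gamma (a * real k + b) / Gamma (p + (a * real k + b))
        * r powr (p + (a * real k + b) - 1)"
      using beta_convolution(2)[OF assms(3) pos[of k] assms(4)]
      by (simp add: h_def set_lebesgue_integral_def algebra_simps)
    moreover have "r powr (p + (a * real k + b) - 1) = r powr (b + p - 1) * (r powr a) ^ k"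
      using assms by (simp add: powr_powr algebra_simps flip: powr_realpow powr_add)
    moreover have "Gamma (a * real k + b) \<noteq> 0" using Gamma_real_pos[OF pos[of k]] by simp
    ultimately show ?thesis by (simp add: C_def algebra_simps)
  qed
  have sums: "(\<lambda>k. f k s) sums (indicator {0..r} s *\<^sub>R ?g s)"
    and sums_abs: "summable (\<lambda>k. norm (f k s))" for s
  proof -
    have f_eq: "f k s = indicator {0..r} s * (r - s) powr (p - 1) * s powr (b - 1) *
        ((- (s powr a) * K) ^ k / Gamma (a * real k + b))" for k
    proof (cases "0 < s")
      case True
      have "s powr (a * real k + b - 1) = s powr (b - 1) * (s powr a) ^ k"
        using True by (simp add: powr_powr algebra_simps flip: powr_realpow powr_add)
      moreover have "(- (s powr a) * K) ^ k = (- K) ^ k * (s powr a) ^ k"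
        by (simp add: mult.commute flip: power_mult_distrib)
      ultimately show ?thesis by (simp add: f_def h_def C_def)
    next
      \<comment> \<open>For \<open>s = 0\<close> both sides vanish because
        \<open>0 powr _ = 0\<close> for every exponent; for \<open>s < 0\<close> the indicator
        vanishes.\<close>
      case False
      then show ?thesis by (cases "s = 0") (auto simp: f_def h_def)
    qed
    show "(\<lambda>k. f k s) sums (indicator {0..r} s *\<^sub>R ?g s)"
      using sums_mult[OF summable_sums[OF summable_mittag_leffler[OF assms(1,2)]],
          of "indicator {0..r} s * (r - s) powr (p - 1) * s powr (b - 1)" "- (s powr a) * K"]
      by (simp add: f_eq mittag_leffler_def mult.assoc)
    show "summable (\<lambda>k. norm (f k s))"
      using summable_mult[OF summable_mittag_leffler[OF assms(1,2)],
          of "\<bar>indicator {0..r} s * (r - s) powr (p - 1) * s powr (b - 1)\<bar>" "\<bar>(s powr a) * K\<bar>"]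
        Gamma_real_pos[OF pos]
      by (simp add: f_eq abs_mult power_abs less_imp_le)
  qed
  have f_int: "integrable lborel (f k)" for k
    unfolding f_def using h_int by simp
  have norm_eq: "(\<integral>s. norm (f k s) \<partial>lborel) = \<bar>K\<bar> ^ k * (C k * integral\<^sup>L lborel (h k))" for k
  proof -
    have "norm (f k s) = \<bar>K\<bar> ^ k * C k * h k s" for s
      using C[of k] by (simp add: f_def h_def abs_mult power_abs)
    then show ?thesis by simp
  qed
  have "summable (\<lambda>k. \<integral>s. norm (f k s) \<partial>lborel)"
  proof -
    have "(\<lambda>k. \<integral>s. norm (f k s) \<partial>lborel) = (\<lambda>k. Gamma p * r powr (b + p - 1) *
        ((\<bar>K\<bar> * r powr a) ^ k / Gamma (a * real k + (b + p))))"
      unfolding norm_eq h_eq by (simp add: power_mult_distrib mult_ac)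
    then show ?thesis
      using assms by (simp only:) (intro summable_mult summable_mittag_leffler; simp)
  qed
  note * = f_int AE_I2[OF sums_abs] this
  have suminf_eq: "(\<lambda>s. \<Sum>k. f k s) = (\<lambda>s. indicator {0..r} s *\<^sub>R ?g s)"
    using sums by (auto simp: sums_iff)
  show "set_integrable lborel {0..r} ?g"
    using integrable_suminf[OF *] by (simp add: suminf_eq set_integrable_def)
  have "(LINT s:{0..r}|lborel. ?g s) = (\<Sum>k. integral\<^sup>L lborel (f k))"
    using integral_suminf[OF *] by (simp add: suminf_eq set_lebesgue_integral_def)
  also have "\<dots> = (\<Sum>k. Gamma p * r powr (b + p - 1) *
      ((- (r powr a) * K) ^ k / Gamma (a * real k + (b + p))))"
  proof (rule suminf_cong)
    fix k
    have "integral\<^sup>L lborel (f k) = (- K) ^ k * (C k * integral\<^sup>L lborel (h k))"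
      by (simp add: f_def)
    also have "\<dots> = Gamma p * r powr (b + p - 1) *
        ((- K) ^ k * (r powr a) ^ k / Gamma (a * real k + (b + p)))"
      by (simp add: h_eq)
    also have "(- K) ^ k * (r powr a) ^ k = (- (r powr a) * K) ^ k"
      by (simp add: mult.commute flip: power_mult_distrib)
    finally show "integral\<^sup>L lborel (f k) = Gamma p * r powr (b + p - 1) *
        ((- (r powr a) * K) ^ k / Gamma (a * real k + (b + p)))" .
  qed
  also have "\<dots> = Gamma p * (r powr (b + p - 1) * ml_path a (b + p) K r)"
    unfolding mittag_leffler_def mult.assoc[symmetric] using assms
    by (intro suminf_mult summable_mittag_leffler) auto
  finally show "(LINT s:{0..r}|lborel. ?g s) =
         Gamma p * (r powr (b + p - 1) * ml_path a (b + p) K r)" .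
qed

text \<open>
  Integration by parts on \<open>[0, t - \<epsilon>]\<close>: the derivative of \<open>- (t - s) powr -\<beta> * (g t - g s)\<close> is
  at most \<open>(t - s) powr -\<beta> * w s\<close>, because \<open>g s \<le> g t\<close>.
\<close>

lemma caputo_at_maximum:
  fixes g w :: "real \<Rightarrow> real"
  assumes \<beta>: "0 < \<beta>" "\<beta> < 1" and t: "0 < t"
    and cont: "continuous_on {0..t} g"
    and der: "\<And>s. \<lbrakk>0 < s; s \<le> t\<rbrakk> \<Longrightarrow> (g has_real_derivative w s) (at s)"
    and max: "\<And>s. \<lbrakk>0 \<le> s; s \<le> t\<rbrakk> \<Longrightarrow> g s \<le> g t"
    and int: "set_integrable lborel {0..t} (\<lambda>s. (t - s) powr (-\<beta>) * w s)"
  shows "t powr (-\<beta>) * (g t - g 0) \<le> (LINT s:{0..t}|lborel. (t - s) powr (-\<beta>) * w s)"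
proof -
  let ?\<phi> = "\<lambda>s. (t - s) powr (-\<beta>) * w s"
  define F where "F = (\<lambda>s. - ((t - s) powr (-\<beta>) * (g t - g s)))"
  note HK = set_borel_integral_eq_integral[OF int]
  have ineq: "F x + t powr (-\<beta>) * (g t - g 0) \<le> integral {0..x} ?\<phi>" if x: "0 < x" "x < t" for x
  proof -
    define F' where "F' = (\<lambda>s. ?\<phi> s - \<beta> * (t - s) powr (-\<beta> - 1) * (g t - g s))"
    have "continuous_on {0..x} F"
      unfolding F_def using x by (intro continuous_intros continuous_on_subset[OF cont]) auto
    moreover have "(F has_vector_derivative F' s) (at s)" if "s \<in> {0<..<x}" for s
      unfolding has_real_derivative_iff_has_vector_derivative[symmetric] F_def F'_def using that x
      by (auto intro!: derivative_eq_intros der simp: algebra_simps)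
    ultimately have "(F' has_integral (F x - F 0)) {0..x}"
      using x by (intro fundamental_theorem_of_calculus_interior) auto
    moreover have "?\<phi> integrable_on {0..x}"
      using HK(1) by (rule integrable_on_subinterval) (use x in auto)
    then have "(?\<phi> has_integral integral {0..x} ?\<phi>) {0..x}"
      by (rule integrable_integral)
    moreover have "F' s \<le> ?\<phi> s" if "s \<in> {0..x}" for s
      using that x max[of s] \<beta> by (auto simp: F'_def)
    ultimately have "F x - F 0 \<le> integral {0..x} ?\<phi>" by (rule has_integral_le)
    then show ?thesis by (simp add: F_def)
  qed
  have "continuous_on {0..t} (\<lambda>x. integral {0..x} ?\<phi>)"
    by (rule indefinite_integral_continuous_1[OF HK(1)])
  then have lim: "((\<lambda>x. integral {0..x} ?\<phi>) \<longlongrightarrow> integral {0..t} ?\<phi>) (at_left t)"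
    unfolding continuous_on_def at_within_Icc_at_left[OF t, symmetric]
    by (rule bspec) (use t in simp)
  \<comment> \<open>The boundary term at \<open>t\<close> is
    \<open>(t - x) powr (1 - \<beta>)\<close> times a difference quotient of \<open>g\<close>: the
    first factor tends to 0 and the second to \<open>w t\<close>.\<close>
  have F0: "(F \<longlongrightarrow> 0) (at_left t)"
  proof -
    have "((\<lambda>x. (g x - g t) / (x - t)) \<longlongrightarrow> w t) (at_left t)"
      using has_field_derivative_at_within[OF der[OF t order_refl], of "{..<t}"]
      by (simp only: has_field_derivative_iff)
    moreover have "((\<lambda>x. (t - x) powr (1 - \<beta>)) \<longlongrightarrow> 0) (at_left t)"
      using \<beta> by (auto intro!: tendsto_eq_intros simp: eventually_at_left_field lt_ex)
    ultimately have "((\<lambda>x. - ((t - x) powr (1 - \<beta>) * ((g x - g t) / (x - t)))) \<longlongrightarrow> - (0 * w t)) (at_left t)"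
      by (intro tendsto_intros)
    then have "((\<lambda>x. - ((t - x) powr (1 - \<beta>) * ((g x - g t) / (x - t)))) \<longlongrightarrow> 0) (at_left t)"
      by simp
    then show ?thesis
    proof (rule Lim_transform_eventually)
      show "eventually (\<lambda>x. - ((t - x) powr (1 - \<beta>) * ((g x - g t) / (x - t))) = F x) (at_left t)"
      proof (unfold eventually_at_filter, intro always_eventually allI impI)
        fix x assume "x \<noteq> t" "x \<in> {..<t}"
        then have elim: "x < t" by simp
        then have "(t - x) powr (1 - \<beta>) = (t - x) * (t - x) powr (-\<beta>)"
          by (simp flip: powr_add add: powr_mult_base)
        moreover have "(t - x) * ((g x - g t) / (x - t)) = g t - g x"
          using elim by (simp add: divide_simps) (simp add: algebra_simps)
        then have "(t - x) * (t - x) powr (-\<beta>) * ((g x - g t) / (x - t)) = (t - x) powr (-\<beta>) * (g t - g x)"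
          by (metis mult.assoc mult.commute)
        ultimately show "- ((t - x) powr (1 - \<beta>) * ((g x - g t) / (x - t))) = F x"
          by (simp add: F_def)
      qed
    qed
  qed
  have "eventually (\<lambda>x. F x + t powr (-\<beta>) * (g t - g 0) \<le> integral {0..x} ?\<phi>) (at_left t)"
    using ineq t by (auto simp: eventually_at_left_field intro!: exI[of _ 0])
  then have "0 + t powr (-\<beta>) * (g t - g 0) \<le> integral {0..t} ?\<phi>"
    by (intro tendsto_le[OF _ lim tendsto_add[OF F0 tendsto_const]]) auto
  then show ?thesis using HK(2) by simp
qed

text \<open>Comparison with \<open>beta_convolution\<close> for \<open>q = 1\<close>. The explicit
  factor \<open>r powr (1 - \<beta>)\<close> makes the Abel integral of a bounded function tend to 0
  as \<open>r\<close> tends to 0.\<close>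

lemma set_integrable_singular_kernel:
  fixes w :: "real \<Rightarrow> 'b::{banach, second_countable_topology}"
  assumes "\<beta> < 1" "0 < r" and cont: "continuous_on {0..r} w"
    and B: "\<And>s. s \<in> {0..r} \<Longrightarrow> norm (w s) \<le> B"
  shows "set_integrable lborel {0..r} (\<lambda>s. (r - s) powr (-\<beta>) *\<^sub>R w s)"
    and "norm (LINT s:{0..r}|lborel. (r - s) powr (-\<beta>) *\<^sub>R w s) \<le>
           B * (Gamma (1 - \<beta>) / Gamma (2 - \<beta>) * r powr (1 - \<beta>))"
proof -
  let ?h = "\<lambda>s. indicator {0..r} s *\<^sub>R ((r - s) powr (-\<beta>) * s powr (1 - 1))"
  let ?f = "\<lambda>s. indicator {0..r} s *\<^sub>R ((r - s) powr (-\<beta>) *\<^sub>R w s)"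
  have h: "integrable lborel ?h" "integral\<^sup>L lborel ?h = Gamma (1 - \<beta>) / Gamma (2 - \<beta>) * r powr (1 - \<beta>)"
    using beta_convolution[of "1 - \<beta>" 1 r] assms by (simp_all add: set_integrable_def set_lebesgue_integral_def)
  have bound: "AE s in lborel. norm (?f s) \<le> B * ?h s"
  \<comment> \<open>The factor \<open>s powr (1 - 1)\<close> in \<open>?h\<close> is 1 except at
    \<open>s = 0\<close>, where it is 0; there the bound can fail.\<close>
  proof (rule AE_mp[OF AE_lborel_singleton[of 0]], intro AE_I2 impI)
    fix s :: real assume "s \<noteq> 0"
    show "norm (?f s) \<le> B * ?h s"
    proof (cases "s \<in> {0..r}")
      case True
      then show ?thesis
        using \<open>s \<noteq> 0\<close> mult_right_mono[OF B[OF True], of "(r - s) powr (-\<beta>)"] by (simp add: mult.commute)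
    qed simp
  qed
  have "(\<lambda>s. (r - s) powr (-\<beta>) *\<^sub>R (indicator {0..r} s *\<^sub>R w s)) \<in> borel_measurable borel"
    by (intro borel_measurable_scaleR borel_measurable_continuous_on_indicator cont) measurable
  then have meas: "?f \<in> borel_measurable lborel"
    by (simp add: mult.commute)
  have int: "integrable lborel ?f"
  proof (rule Bochner_Integration.integrable_bound[where f="\<lambda>s. B * ?h s"])
    show "AE s in lborel. norm (?f s) \<le> norm (B * ?h s)"
      by (rule AE_mp[OF bound]) (intro AE_I2 impI, unfold real_norm_def, rule order_trans[OF _ abs_ge_self])
  qed (intro integrable_mult_right h(1) meas)+
  then show "set_integrable lborel {0..r} (\<lambda>s. (r - s) powr (-\<beta>) *\<^sub>R w s)"
    by (simp add: set_integrable_def)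
  have "norm (integral\<^sup>L lborel ?f) \<le> (\<integral>s. norm (?f s) \<partial>lborel)"
    by (rule integral_norm_bound)
  also have "\<dots> \<le> (\<integral>s. B * ?h s \<partial>lborel)"
    by (intro integral_mono_AE integrable_norm int integrable_mult_right h(1) bound)
  also have "\<dots> = B * (Gamma (1 - \<beta>) / Gamma (2 - \<beta>) * r powr (1 - \<beta>))"
    using h(2) by simp
  finally show "norm (LINT s:{0..r}|lborel. (r - s) powr (-\<beta>) *\<^sub>R w s) \<le>
           B * (Gamma (1 - \<beta>) / Gamma (2 - \<beta>) * r powr (1 - \<beta>))"
    by (simp add: set_lebesgue_integral_def)
qed

text \<open>
  The maximum principle is applied to the integral \<open>W\<close> of the solution, which is differentiable
  up to \<open>0\<close> although \<open>w\<close> is merely continuous.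
\<close>

lemma fractional_relaxation_nonpos:
  fixes w :: "real \<Rightarrow> real"
  assumes \<beta>: "0 < \<beta>" "\<beta> < 1" and K: "0 \<le> K"
    and cont: "continuous_on {0..} w"
    and der: "\<And>t. 0 < t \<Longrightarrow> ((\<lambda>r. LINT s:{0..r}|lborel. (r - s) powr (-\<beta>) * w s)
                has_real_derivative - K * w t) (at t)"
    and t0: "0 \<le> t0"
  shows "integral {0..t0} w \<le> 0"
proof (rule ccontr)
  define W where "W = (\<lambda>t. integral {0..t} w)"
  define J where "J = (\<lambda>r. LINT s:{0..r}|lborel. (r - s) powr (-\<beta>) * w s)"
  have cont': "continuous_on {0..r} w" for r
    using cont by (rule continuous_on_subset) auto
  have W_cont: "continuous_on {0..r} W" for r
    unfolding W_def by (intro indefinite_integral_continuous_1 integrable_continuous_interval cont')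
  have W_der: "(W has_real_derivative w t) (at t)" if "0 < t" for t
  proof -
    have "(W has_real_derivative w t) (at t within {0..t + 1})"
      unfolding W_def by (rule integral_has_real_derivative[OF cont']) (use that in auto)
    then show ?thesis
      using that at_within_interior[of t "{0..t + 1}"] by simp
  qed
  \<comment> \<open>The equation integrated once: \<open>J + K * W\<close> has derivative 0 on the
    positive half-line and limit 0 at 0.\<close>
  have J_eq: "J r = - K * W r" if r: "0 < r" for r
  proof -
    obtain B where "\<forall>s\<in>{0..r}. norm (w s) \<le> B"
      using compact_imp_bounded[OF compact_continuous_image[OF cont'[of r]]]
      by (auto simp: bounded_iff)
    then have B: "norm (w s) \<le> B" if "s \<in> {0..r}" for s using that by blast
    let ?b = "\<lambda>x. B * (Gamma (1 - \<beta>) / Gamma (2 - \<beta>) * x powr (1 - \<beta>))"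
    have J0: "(J \<longlongrightarrow> 0) (at_right 0)"
    proof (rule Lim_null_comparison)
      show "eventually (\<lambda>x. norm (J x) \<le> ?b x) (at_right 0)"
        unfolding eventually_at_right_field
      proof (intro exI[of _ r] conjI allI impI r)
        fix x assume "0 < x" "x < r"
        then show "norm (J x) \<le> ?b x"
          using set_integrable_singular_kernel(2)[OF \<beta>(2) _ cont', of x B] B by (simp add: J_def)
      qed
      have "((\<lambda>x. ?b x) \<longlongrightarrow>
          B * (Gamma (1 - \<beta>) / Gamma (2 - \<beta>) * 0)) (at_right 0)"
        using \<beta> by (intro tendsto_intros) (auto intro!: tendsto_eq_intros simp: eventually_at_right_field gt_ex)
      then show "((\<lambda>x. ?b x) \<longlongrightarrow> 0) (at_right 0)"
        by simp
    qed
    have "(W \<longlongrightarrow> W 0) (at 0 within {0..r})"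
      using W_cont[of r] r by (auto simp: continuous_on_def)
    then have W0: "(W \<longlongrightarrow> 0) (at_right 0)"
      using r by (simp add: at_within_Icc_at_right) (simp add: W_def)
    have const: "J e + K * W e = J r + K * W r" if "0 < e" "e < r" for e
    proof -
      have d: "((\<lambda>r. J r + K * W r) has_real_derivative 0) (at x)" if "0 < x" for x
        using DERIV_add[OF der[OF that] DERIV_cmult[OF W_der[OF that], of K]] by (simp add: J_def)
      have "continuous_on {e..r} (\<lambda>r. J r + K * W r)"
        using that by (intro continuous_at_imp_continuous_on ballI DERIV_isCont[OF d]) auto
      then show ?thesis
        using that d by (intro DERIV_isconst_end[where f="\<lambda>r. J r + K * W r", symmetric]) auto
    qed
    have "((\<lambda>e. J e + K * W e) \<longlongrightarrow> 0 + K * 0) (at_right 0)"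
      by (intro tendsto_intros J0 W0)
    moreover have "((\<lambda>e. J e + K * W e) \<longlongrightarrow> J r + K * W r) (at_right 0)"
      by (rule tendsto_eventually)
         (use const r in \<open>auto simp: eventually_at_right_field intro!: exI[of _ r]\<close>)
    ultimately have "0 + K * 0 = J r + K * W r"
      by (rule tendsto_unique[rotated]) simp
    then show ?thesis by simp
  qed
  assume "\<not> integral {0..t0} w \<le> 0"
  then have pos: "0 < W t0" by (simp add: W_def)
  obtain t where t: "t \<in> {0..t0}" "\<And>s. s \<in> {0..t0} \<Longrightarrow> W s \<le> W t"
    using continuous_attains_sup[of "{0..t0}" W] W_cont t0 by auto
  have W0: "W 0 = 0" by (simp add: W_def)
  have Wt: "0 < W t" using t(2)[of t0] t0 pos by simp
  with W0 t have t': "0 < t" by (cases "t = 0") auto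
  obtain B where "\<forall>s\<in>{0..t}. norm (w s) \<le> B"
    using compact_imp_bounded[OF compact_continuous_image[OF cont'[of t]]]
    by (auto simp: bounded_iff)
  then have B: "norm (w s) \<le> B" if "s \<in> {0..t}" for s using that by blast
  \<comment> \<open>Since \<open>w\<close> is the derivative of \<open>W\<close>, the number
    \<open>J t\<close> is the Caputo integral of \<open>W\<close> at its maximum and hence positive,
    whereas the integrated equation gives \<open>J t = - K * W t\<close>, which is not.\<close>
  have "t powr (-\<beta>) * (W t - W 0) \<le> J t"
    unfolding J_def
    by (rule caputo_at_maximum[OF \<beta> t' W_cont])
       (use W_der t set_integrable_singular_kernel(1)[OF \<beta>(2) t' cont' B] in auto)
  moreover have "0 < t powr (-\<beta>) * (W t - W 0)" using Wt W0 t' by simp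
  moreover have "J t \<le> 0" using J_eq[OF t'] K Wt by (simp add: mult_nonneg_nonneg)
  ultimately show False by linarith
qed

text \<open>The equation is linear, so the sign result applies to \<open>w\<close> and to
  \<open>- w\<close>. All integrals of \<open>w\<close> from 0 therefore vanish, and differentiating
  them returns \<open>w\<close>.\<close>

lemma fractional_relaxation_unique:
  fixes w :: "real \<Rightarrow> real"
  assumes \<beta>: "0 < \<beta>" "\<beta> < 1" and K: "0 \<le> K"
    and cont: "continuous_on {0..} w"
    and der: "\<And>t. 0 < t \<Longrightarrow> ((\<lambda>r. LINT s:{0..r}|lborel. (r - s) powr (-\<beta>) * w s)
                has_real_derivative - K * w t) (at t)"
    and t: "0 < t"
  shows "w t = 0"
proof -
  have le: "integral {0..s} w \<le> 0" if "0 \<le> s" for s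
    using fractional_relaxation_nonpos[OF \<beta> K cont der that] .
  have ge: "integral {0..s} (\<lambda>x. - w x) \<le> 0" if "0 \<le> s" for s
  proof (rule fractional_relaxation_nonpos[OF \<beta> K _ _ that])
    show "continuous_on {0..} (\<lambda>x. - w x)" using cont by (intro continuous_intros)
    show "((\<lambda>r. LINT s:{0..r}|lborel. (r - s) powr (-\<beta>) * - w s) has_real_derivative - K * - w t) (at t)"
      if "0 < t" for t
      using DERIV_minus[OF der[OF that]] by (simp add: set_lebesgue_integral_def)
  qed
  have 0: "integral {0..s} w = 0" if "0 \<le> s" for s
    using le[OF that] ge[OF that] by simp
  have "((\<lambda>x. integral {0..x} w) has_real_derivative w t) (at t within {0..t + 1})"
    by (rule integral_has_real_derivative[OF continuous_on_subset[OF cont]]) (use t in auto)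
  then have "((\<lambda>x. integral {0..x} w) has_real_derivative w t) (at t)"
    using t at_within_interior[of t "{0..t + 1}"] by simp
  then have "((\<lambda>x. 0) has_real_derivative w t) (at t)"
    by (rule has_field_derivative_transform_within_open[where S="{0<..}"]) (use t 0 in auto)
  then show ?thesis using DERIV_unique[OF _ DERIV_const] by blast
qed

lemma continuous_on_mittag_leffler_path:
  assumes "0 < a" "0 < b"
  shows "continuous_on {0..} (\<lambda>t. ml_path a b K t)"
proof -
  have "continuous_on {0..} (\<lambda>t::real. - (t powr a) * K)"
    using assms by (intro continuous_intros continuous_on_powr') auto
  then show ?thesis
    by (rule continuous_on_compose2[OF continuous_on_mittag_leffler[OF assms, of UNIV]]) auto
qed

text \<open>
  The path \<open>t \<mapsto> E(- K t^\<beta>)\<close> has Caputo derivative \<open>-K\<close> times itself; so by the maximum principle it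
  has neither a maximum above \<open>1\<close> nor a negative minimum.
\<close>

lemma mittag_leffler_path_bounds:
  assumes \<beta>: "0 < \<beta>" "\<beta> < 1" and K: "0 \<le> K" and t0: "0 \<le> t0"
  shows "ml_path \<beta> 1 K t0 \<in> {0..1}"
proof -
  define c where "c = (\<lambda>t. ml_path \<beta> 1 K t)"
  \<comment> \<open>The derivative of \<open>c\<close> is \<open>- K * e\<close>, and convolving
    \<open>e\<close> with the kernel restores \<open>c\<close> up to
    \<open>Gamma (1 - \<beta>)\<close>, because the exponents \<beta> and \<open>1 - \<beta>\<close>
    add up to 1. The factor \<open>t powr (\<beta> - 1)\<close> is singular at 0; this is why
    \<open>caputo_at_maximum\<close> asks for integrability against the kernel and for a derivative
    at positive times only.\<close>
  define e where "e = (\<lambda>t. t powr (\<beta> - 1) * ml_path \<beta> \<beta> K t)"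
  have c0: "c 0 = 1" by (simp add: c_def mittag_leffler_0)
  have cont: "continuous_on {0..t} c" for t
    unfolding c_def by (rule continuous_on_subset[OF continuous_on_mittag_leffler_path]) (use \<beta> in auto)
  have der: "(c has_real_derivative - K * e t) (at t)" if "0 < t" for t
  proof -
    have "c = (\<lambda>t. 1 - K * (t powr \<beta> * ml_path \<beta> (\<beta> + 1) K t))"
    proof
      fix t show "c t = 1 - K * (t powr \<beta> * ml_path \<beta> (\<beta> + 1) K t)"
        unfolding c_def using \<beta> by (subst mittag_leffler_rec) (simp_all add: add.commute algebra_simps)
    qed
    then show ?thesis
      using DERIV_diff[OF DERIV_const DERIV_cmult[OF powr_mittag_leffler_deriv[OF \<beta>(1,1) that]], of 1 K K]
      by (simp add: e_def)
  qed
  have conv: "set_integrable lborel {0..t} (\<lambda>s. (t - s) powr (-\<beta>) * e s)"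
    "(LINT s:{0..t}|lborel. (t - s) powr (-\<beta>) * e s) = Gamma (1 - \<beta>) * c t" if "0 < t" for t
    using mittag_leffler_convolution[of \<beta> \<beta> "1 - \<beta>" t K] \<beta> that by (simp_all add: e_def c_def)
  have G: "0 < Gamma (1 - \<beta>)" using \<beta> by simp
  \<comment> \<open>The sign \<open>a\<close> treats both bounds at once: \<open>max a 0\<close> is
    1 for the upper bound and 0 for the lower one. As \<open>c 0 = 1\<close>, the value
    \<open>a * c 0\<close> does not exceed \<open>max a 0\<close>, so an offending maximum lies at a
    positive time and strictly above the initial value.\<close>
  have le: "a * c t0 \<le> max a 0" if a: "a = 1 \<or> a = -1" for a
  proof (rule ccontr)
    assume "\<not> a * c t0 \<le> max a 0"
    obtain t where t: "t \<in> {0..t0}" "\<And>s. s \<in> {0..t0} \<Longrightarrow> a * c s \<le> a * c t"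
      using continuous_attains_sup[of "{0..t0}" "\<lambda>s. a * c s"] continuous_on_mult_left[OF cont] t0 by auto
    have "max a 0 < a * c t0" using \<open>\<not> a * c t0 \<le> max a 0\<close> by (simp only: not_le)
    also have "\<dots> \<le> a * c t" using t(2)[of t0] t0 by simp
    finally have ct: "max a 0 < a * c t" .
    with c0 t have t': "0 < t" by (cases "t = 0") auto
    have eq: "(\<lambda>s. (t - s) powr (-\<beta>) * (- (a * K) * e s)) = (\<lambda>s. - (a * K) * ((t - s) powr (-\<beta>) * e s))"
      by (simp add: fun_eq_iff)
    have "t powr (-\<beta>) * (a * c t - a * c 0) \<le> (LINT s:{0..t}|lborel. (t - s) powr (-\<beta>) * (- (a * K) * e s))"
    proof (rule caputo_at_maximum[OF \<beta> t', where g="\<lambda>s. a * c s"])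
      show "set_integrable lborel {0..t} (\<lambda>s. (t - s) powr (-\<beta>) * (- (a * K) * e s))"
        unfolding eq by (rule set_integrable_mult_right[OF conv(1)[OF t']])
      show "continuous_on {0..t} (\<lambda>s. a * c s)" by (intro continuous_intros cont)
      show "((\<lambda>s. a * c s) has_real_derivative - (a * K) * e s) (at s)" if "0 < s" for s
        using DERIV_cmult[OF der[OF that], of a] by (simp add: mult.assoc)
    qed (use t in auto)
    also have "\<dots> = - (K * Gamma (1 - \<beta>)) * (a * c t)"
      unfolding eq set_integral_mult_right conv(2)[OF t'] by simp
    also have "\<dots> \<le> 0" using K G ct by (intro mult_nonpos_nonneg) auto
    finally show False using t' ct c0 by (simp add: mult_le_0_iff)
  qed
  show ?thesis using le[of 1] le[of "-1"] by (simp add: c_def)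
qed

section \<open>The scalar relaxation equation\<close>

lemma mittag_leffler_path_le_1:
  assumes "0 < \<beta>" "\<beta> \<le> 1" "0 \<le> K" "0 \<le> t"
  shows "\<bar>ml_path \<beta> 1 K t\<bar> \<le> 1"
proof (cases "\<beta> = 1")
  case True
  then show ?thesis using assms by (simp add: mittag_leffler_1_1)
next
  case False
  then show ?thesis using mittag_leffler_path_bounds[of \<beta> K t] assms by auto
qed

text \<open>For \<open>\<beta> < 1\<close> the Abel integral of the path is
  \<open>Gamma (1 - \<beta>) * r powr (1 - \<beta>)\<close> times the function with second parameter
  \<open>2 - \<beta>\<close>. Differentiation lowers this parameter to \<open>1 - \<beta>\<close>,
  and the recurrence splits the result into the initial-value term \<open>t powr (-\<beta>)\<close>
  and a multiple of the path itself.\<close>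

lemma solves_coeff_mittag_leffler:
  assumes \<beta>: "0 < \<beta>" "\<beta> \<le> 1"
  shows "solves_coeff \<beta> \<psi> l (\<lambda>t. ml_path \<beta> 1 (\<psi> (lam l)) t *\<^sub>R c0)"
    (is "solves_coeff \<beta> \<psi> l ?u")
  unfolding solves_coeff_def
proof (intro conjI allI impI)
  define K where "K = \<psi> (lam l)"
  define E where "E = (\<lambda>b t. ml_path \<beta> b K t)"
  have u: "?u = (\<lambda>t. E 1 t *\<^sub>R c0)" by (simp add: E_def K_def)
  show "continuous_on {0..} ?u"
    using \<beta> by (intro continuous_intros continuous_on_mittag_leffler_path) auto
  fix t :: real assume t: "0 < t"
  show "has_frac_deriv \<beta> ?u (- psi_laplace_coeff \<psi> l (?u t)) t"
  proof (cases "\<beta> = 1")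
    case True
    have "((\<lambda>t. exp (- t * K)) has_real_derivative exp (- t * K) * - K) (at t)"
      by (auto intro!: derivative_eq_intros)
    then have "(E 1 has_real_derivative exp (- t * K) * - K) (at t)"
      by (rule has_field_derivative_transform_within_open[where S="{0<..}"])
         (use t True in \<open>auto simp: E_def mittag_leffler_1_1\<close>)
    then have "((\<lambda>t. E 1 t *\<^sub>R c0) has_vector_derivative (exp (- t * K) * - K) *\<^sub>R c0) (at t)"
      by (auto intro!: derivative_eq_intros)
    then show ?thesis
      using True t unfolding u
      by (simp add: has_frac_deriv_def psi_laplace_coeff_def E_def mittag_leffler_1_1 K_def mult.commute)
  next
    case False
    with \<beta> have b1: "0 < 1 - \<beta>" by simp
    let ?G = "\<lambda>r. Gamma (1 - \<beta>) * (r powr (1 - \<beta>) * E (1 - \<beta> + 1) r)"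
    let ?h = "\<lambda>r s. indicator {0..r} s * ((r - s) powr (-\<beta>) * (s powr (1 - 1) * E 1 s))"
    let ?h1 = "\<lambda>r s. indicator {0..r} s * ((r - s) powr (-\<beta>) * E 1 s)"
    define J where "J = (\<lambda>r. LINT s:{0..r}|lborel. (r - s) powr (-\<beta>) *\<^sub>R (E 1 s *\<^sub>R c0))"
    define D where "D = Gamma (1 - \<beta>) * (t powr (-\<beta>) * E (1 - \<beta>) t)"
    have J_eq: "J r = (?G r) *\<^sub>R c0" if r: "0 < r" for r
    proof -
      have "set_integrable lborel {0..r} (\<lambda>s. (r - s) powr (-\<beta>) * (s powr (1 - 1) * E 1 s))"
        "(LINT s:{0..r}|lborel. (r - s) powr (-\<beta>) * (s powr (1 - 1) * E 1 s)) =
          ?G r"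
        using mittag_leffler_convolution[OF \<beta>(1) zero_less_one b1 r, of K]
        by (simp_all add: E_def add.commute)
      then have *: "integrable lborel (\<lambda>s. ?h r s)"
        "(\<integral>s. ?h r s \<partial>lborel) =
          ?G r"
        by (simp_all add: set_integrable_def set_lebesgue_integral_def)
      have "J r = (\<integral>s. (?h1 r s) *\<^sub>R c0 \<partial>lborel)"
        by (simp add: J_def set_lebesgue_integral_def mult.assoc)
      \<comment> \<open>\<open>?h\<close> and \<open>?h1\<close> can differ only at
        \<open>s = 0\<close>, where \<open>s powr (1 - 1)\<close> is 0 instead of 1.\<close>
      also have "\<dots> = (\<integral>s. (?h r s) *\<^sub>R c0 \<partial>lborel)"
      proof (rule integral_cong_AE)
        have [measurable]: "E 1 \<in> borel_measurable borel"
          unfolding E_def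
          using borel_measurable_continuous_onI[OF continuous_on_mittag_leffler[OF \<beta>(1) zero_less_one]]
          by measurable
        show "(\<lambda>s. (?h1 r s) *\<^sub>R c0) \<in> borel_measurable lborel"
          "(\<lambda>s. (?h r s) *\<^sub>R c0) \<in> borel_measurable lborel"
          by measurable
        show "AE s in lborel. (?h1 r s) *\<^sub>R c0 =
            (?h r s) *\<^sub>R c0"
          by (rule AE_mp[OF AE_lborel_singleton[of 0]]) (auto intro!: AE_I2)
      qed
      also have "\<dots> = (?G r) *\<^sub>R c0"
        using * by (subst integral_scaleR_left) auto
      finally show ?thesis .
    qed
    have "((\<lambda>r. ?G r) has_real_derivative D) (at t)"
      using DERIV_cmult[OF powr_mittag_leffler_deriv[OF \<beta>(1) b1 t, of K]] by (simp add: E_def D_def)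
    then have "((\<lambda>r. (?G r) *\<^sub>R c0)
        has_vector_derivative D *\<^sub>R c0) (at t)"
      using has_vector_derivative_scaleR[OF _ has_vector_derivative_const, of _ D t UNIV c0] by simp
    then have J: "(J has_vector_derivative D *\<^sub>R c0) (at t)"
      by (rule has_vector_derivative_transform_within_open[where S="{0<..}"]) (use t J_eq in auto)
    have E1: "E (1 - \<beta>) t = 1 / Gamma (1 - \<beta>) - t powr \<beta> * K * E 1 t"
      unfolding E_def using mittag_leffler_rec[OF \<beta>(1) b1] by simp
    have D_eq: "D = t powr (-\<beta>) - Gamma (1 - \<beta>) * K * E 1 t"
    proof -
      have "Gamma (1 - \<beta>) * (t powr (-\<beta>) * (1 / Gamma (1 - \<beta>))) = t powr (-\<beta>)"
        using Gamma_real_pos[OF b1] by simp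
      moreover have "t powr (-\<beta>) * (t powr \<beta> * K * E 1 t) = K * E 1 t"
        using t by (simp add: powr_minus)
      ultimately show ?thesis
        unfolding D_def E1 by (simp only: right_diff_distrib mult.assoc)
    qed
    have "(D *\<^sub>R c0 - t powr (-\<beta>) *\<^sub>R c0) /\<^sub>R Gamma (1 - \<beta>) = - (K * E 1 t) *\<^sub>R c0"
    proof -
      have "Gamma (1 - \<beta>) \<noteq> 0" using Gamma_real_pos[OF b1] by linarith
      then have "(D - t powr (-\<beta>)) / Gamma (1 - \<beta>) = - (K * E 1 t)"
        unfolding D_eq by simp
      moreover have "(D *\<^sub>R c0 - t powr (-\<beta>) *\<^sub>R c0) /\<^sub>R Gamma (1 - \<beta>) =
          ((D - t powr (-\<beta>)) / Gamma (1 - \<beta>)) *\<^sub>R c0"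
        by (simp add: divide_inverse mult.commute flip: scaleR_diff_left)
      ultimately show ?thesis by simp
    qed
    moreover have "mittag_leffler \<beta> 1 (- (t powr \<beta> * K)) = E 1 t" by (simp add: E_def)
    moreover have "E 1 0 = 1" by (simp add: E_def mittag_leffler_0)
    ultimately show ?thesis
      using False J unfolding u has_frac_deriv_def J_def
      by (simp only: if_False psi_laplace_coeff_def K_def[symmetric])
         (intro exI[of _ "D *\<^sub>R c0"], simp)
  qed
qed

text \<open>Subtracting the Mittag-Leffler path with the same initial value cancels the
  initial-value terms. Real and imaginary parts of the difference fall under
  \<open>fractional_relaxation_unique\<close>, with \<open>Gamma (1 - \<beta>)\<close> absorbed into
  the rate; for \<open>\<beta> = 1\<close> the integrating factor \<open>exp (K' * s)\<close> does
  the same job.\<close>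

lemma solves_coeff_unique:
  assumes \<beta>: "0 < \<beta>" "\<beta> \<le> 1" and K: "0 \<le> \<psi> (lam l)"
    and c: "solves_coeff \<beta> \<psi> l c" and t: "0 \<le> t"
  shows "c t = ml_path \<beta> 1 (\<psi> (lam l)) t *\<^sub>R c 0"
proof (cases "t = 0")
  case True
  then show ?thesis by (simp add: mittag_leffler_0)
next
  case False
  with t have t: "0 < t" by simp
  define K' where "K' = \<psi> (lam l)"
  define e where "e = (\<lambda>t. ml_path \<beta> 1 (\<psi> (lam l)) t *\<^sub>R c 0)"
  define u where "u = (\<lambda>t. c t - e t)"
  have e: "solves_coeff \<beta> \<psi> l e"
    unfolding e_def by (rule solves_coeff_mittag_leffler[OF \<beta>])
  have cont: "continuous_on {0..} c" "continuous_on {0..} e"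
    using c e by (simp_all add: solves_coeff_def)
  then have u_cont: "continuous_on {0..} u" unfolding u_def by (intro continuous_intros)
  have e0: "e 0 = c 0" by (simp add: e_def mittag_leffler_0)
  have "u t = 0"
  proof (cases "\<beta> = 1")
    case True
    have der: "(u has_vector_derivative - K' *\<^sub>R u s) (at s)" if "0 < s" for s
      using c e that True unfolding u_def
      by (auto simp: solves_coeff_def has_frac_deriv_def psi_laplace_coeff_def K'_def algebra_simps
          intro!: derivative_eq_intros)
    define g where "g = (\<lambda>s. exp (K' * s) *\<^sub>R u s)"
    have "(g has_vector_derivative 0) (at s)" if "0 < s" for s
      unfolding g_def using der[OF that]
      by (auto intro!: derivative_eq_intros simp: algebra_simps)
    moreover have "continuous_on {0..t} g"
      unfolding g_def by (intro continuous_intros continuous_on_subset[OF u_cont]) auto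
    ultimately have "g t = g 0"
      using t fundamental_theorem_of_calculus_interior[of 0 t g "\<lambda>_. 0"]
        has_integral_unique[OF _ has_integral_0] by fastforce
    then show ?thesis by (simp add: g_def u_def e0)
  next
    case False
    with \<beta> have b1: "\<beta> < 1" by simp
    define J where "J = (\<lambda>f r. LINT s:{0..r}|lborel. (r - s) powr (-\<beta>) *\<^sub>R (f s :: complex))"
    have J_der: "(J f has_vector_derivative s powr (-\<beta>) *\<^sub>R f 0 - (Gamma (1 - \<beta>) * K') *\<^sub>R f s) (at s)"
      if f: "solves_coeff \<beta> \<psi> l f" "0 < s" for f s
    proof -
      obtain D where D: "(J f has_vector_derivative D) (at s)"
        "- K' *\<^sub>R f s = (D - s powr (-\<beta>) *\<^sub>R f 0) /\<^sub>R Gamma (1 - \<beta>)"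
        using f False by (auto simp: solves_coeff_def has_frac_deriv_def psi_laplace_coeff_def J_def K'_def)
      have "Gamma (1 - \<beta>) *\<^sub>R (- K' *\<^sub>R f s) = D - s powr (-\<beta>) *\<^sub>R f 0"
      proof -
        have "Gamma (1 - \<beta>) \<noteq> 0" using Gamma_real_pos[of "1 - \<beta>"] b1 by linarith
        then show ?thesis unfolding D(2) by simp
      qed
      then have "D = s powr (-\<beta>) *\<^sub>R f 0 - (Gamma (1 - \<beta>) * K') *\<^sub>R f s"
        by (simp add: algebra_simps)
      with D(1) show ?thesis by simp
    qed
    have int: "set_integrable lborel {0..r} (\<lambda>s. (r - s) powr (-\<beta>) *\<^sub>R f s)"
      if "continuous_on {0..} f" "0 < r" for f :: "real \<Rightarrow> complex" and r
    proof -
      have cf: "continuous_on {0..r} f" using that(1) by (rule continuous_on_subset) auto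
      obtain B where "\<forall>s\<in>{0..r}. norm (f s) \<le> B"
        using compact_imp_bounded[OF compact_continuous_image[OF cf]] by (auto simp: bounded_iff)
      then show ?thesis
        using set_integrable_singular_kernel(1)[OF b1 that(2) cf] by blast
    qed
    have Ju: "(J u has_vector_derivative - (Gamma (1 - \<beta>) * K') *\<^sub>R u s) (at s)" if s: "0 < s" for s
    proof -
      have "((\<lambda>r. J c r - J e r) has_vector_derivative - (Gamma (1 - \<beta>) * K') *\<^sub>R u s) (at s)"
        using has_vector_derivative_diff[OF J_der[OF c s] J_der[OF e s]]
        by (simp add: u_def e0 algebra_simps)
      then show ?thesis
      proof (rule has_vector_derivative_transform_within_open[where S="{0<..}"])
        fix r :: real assume "r \<in> {0<..}"
        then show "J c r - J e r = J u r"
          using set_integral_diff(2)[OF int[OF cont(1)] int[OF cont(2)], of r]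
          by (simp add: J_def u_def scaleR_diff_right)
      qed (use s in auto)
    qed
    have part: "L (u t) = 0" if L: "bounded_linear L" for L :: "complex \<Rightarrow> real"
    proof (rule fractional_relaxation_unique[OF \<beta>(1) b1 _ _ _ t])
      show "0 \<le> Gamma (1 - \<beta>) * K'"
        using K Gamma_real_pos[of "1 - \<beta>"] b1 by (simp add: K'_def)
      show "continuous_on {0..} (\<lambda>t. L (u t))"
        by (rule bounded_linear.continuous_on[OF L u_cont])
      fix s :: real assume s: "0 < s"
      have "((\<lambda>r. L (J u r)) has_vector_derivative L (- (Gamma (1 - \<beta>) * K') *\<^sub>R u s)) (at s)"
        by (rule bounded_linear.has_vector_derivative[OF L Ju[OF s]])
      also have "L (- (Gamma (1 - \<beta>) * K') *\<^sub>R u s) = - (Gamma (1 - \<beta>) * K') * L (u s)"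
        using linear_cmul[OF bounded_linear.linear[OF L]] by (metis real_scaleR_def)
      finally have "((\<lambda>r. L (J u r)) has_real_derivative - (Gamma (1 - \<beta>) * K') * L (u s)) (at s)"
        by (simp add: has_real_derivative_iff_has_vector_derivative)
      then show "((\<lambda>r. LINT s:{0..r}|lborel. (r - s) powr (-\<beta>) * L (u s)) has_real_derivative
          - (Gamma (1 - \<beta>) * K') * L (u s)) (at s)"
      proof (rule has_field_derivative_transform_within_open[where S="{0<..}"])
        fix r :: real assume "r \<in> {0<..}"
        then have "integrable lborel (\<lambda>s. indicator {0..r} s *\<^sub>R ((r - s) powr (-\<beta>) *\<^sub>R u s))"
          using int[OF u_cont, of r] by (simp add: set_integrable_def)
        from integral_bounded_linear[OF L this]
        show "L (J u r) = (LINT s:{0..r}|lborel. (r - s) powr (-\<beta>) * L (u s))"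
          by (simp add: J_def set_lebesgue_integral_def mult.assoc linear_cmul[OF bounded_linear.linear[OF L]])
      qed (use s in auto)
    qed
    show ?thesis
      using part[OF bounded_linear_Re] part[OF bounded_linear_Im] by (simp add: complex_eq_iff)
  qed
  then show ?thesis by (simp add: u_def e_def)
qed

section \<open>Complex polynomials and infinitesimal rotations\<close>

abbreviation crd :: "real^3 \<Rightarrow> 3 \<Rightarrow> complex" where
  "crd x i \<equiv> complex_of_real (x $ i)"

text \<open>Complex multiplication is a constructor, so statements about products of complex
  polynomials and about their mixed derivatives are accessible to induction;
  \<open>cpoly_iff_polynomial\<close> links this to \<open>polynomial_function\<close>.\<close>

inductive cpoly :: "(real^3 \<Rightarrow> complex) \<Rightarrow> bool" where
  const: "cpoly (\<lambda>x. c)"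
| coord: "cpoly (\<lambda>x. crd x i)"
| add: "cpoly f \<Longrightarrow> cpoly g \<Longrightarrow> cpoly (\<lambda>x. f x + g x)"
| mult: "cpoly f \<Longrightarrow> cpoly g \<Longrightarrow> cpoly (\<lambda>x. f x * g x)"

lemma cpoly_sum: "(\<And>i. i \<in> I \<Longrightarrow> cpoly (f i)) \<Longrightarrow> cpoly (\<lambda>x. \<Sum>i\<in>I. f i x)"
  by (induction I rule: infinite_finite_induct) (auto intro: cpoly.intros)

lemma cpoly_minus: "cpoly f \<Longrightarrow> cpoly (\<lambda>x. - f x)"
  using cpoly.mult[OF cpoly.const[of "-1"]] by fastforce

lemma cpoly_diff: "cpoly f \<Longrightarrow> cpoly g \<Longrightarrow> cpoly (\<lambda>x. f x - g x)"
  using cpoly.add[OF _ cpoly_minus] by fastforce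

lemma cpoly_power: "cpoly f \<Longrightarrow> cpoly (\<lambda>x. f x ^ n)"
  by (induction n) (auto intro: cpoly.intros)

lemma cpoly_cnj: "cpoly f \<Longrightarrow> cpoly (\<lambda>x. cnj (f x))"
  by (induction rule: cpoly.induct) (auto intro: cpoly.intros)

lemmas cpoly_intros = cpoly.const cpoly.coord cpoly.add cpoly.mult
  cpoly_sum cpoly_minus cpoly_diff cpoly_power cpoly_cnj

lemma real_polynomial_imp_cpoly:
  "real_polynomial_function f \<Longrightarrow> cpoly (\<lambda>x. complex_of_real (f x))"
proof (induction rule: real_polynomial_function.induct)
  case (linear f)
  have eq: "f x = (\<Sum>i\<in>UNIV. x $ i * f (axis i 1))" for x
  proof -
    have "f x = f (\<Sum>i\<in>UNIV. (x $ i) *\<^sub>R axis i 1)"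
      using basis_expansion[of x] by (simp add: scalar_mult_eq_scaleR)
    also have "\<dots> = (\<Sum>i\<in>UNIV. x $ i * f (axis i 1))"
      by (simp only: linear_sum[OF bounded_linear.linear[OF linear]]
          linear_cmul[OF bounded_linear.linear[OF linear]] real_scaleR_def)
    finally show ?thesis .
  qed
  have "(\<lambda>x. complex_of_real (f x)) =
      (\<lambda>x. \<Sum>i\<in>UNIV. crd x i * complex_of_real (f (axis i 1)))"
    by (rule ext, subst eq) simp
  then show ?case by (rule ssubst[where P=cpoly]) (intro cpoly_intros)
next
  case (add f g)
  then show ?case using cpoly.add by fastforce
next
  case (mult f g)
  then show ?case using cpoly.mult by fastforce
qed (rule cpoly.const)

lemma cpoly_iff_polynomial: "cpoly f \<longleftrightarrow> polynomial_function f"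
proof
  assume "polynomial_function f"
  then have "real_polynomial_function (\<lambda>x. Re (f x))" "real_polynomial_function (\<lambda>x. Im (f x))"
    using bounded_linear_Re bounded_linear_Im by (auto simp: polynomial_function_def o_def)
  then have "cpoly (\<lambda>x. complex_of_real (Re (f x)) + \<i> * complex_of_real (Im (f x)))"
    by (intro cpoly_intros real_polynomial_imp_cpoly)
  then show "cpoly f" by (simp flip: complex_eq)
next
  have part: "real_polynomial_function (\<lambda>x. Re (f x)) \<Longrightarrow> real_polynomial_function (\<lambda>x. Im (f x))
      \<Longrightarrow> polynomial_function f" for f :: "real^3 \<Rightarrow> complex"
  proof -
    assume "real_polynomial_function (\<lambda>x. Re (f x))" "real_polynomial_function (\<lambda>x. Im (f x))"
    then have "polynomial_function (\<lambda>x. Re (f x) *\<^sub>R 1 + Im (f x) *\<^sub>R \<i>)"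
      by (intro polynomial_function_add) (auto simp: real_polynomial_function_eq)
    moreover have "(\<lambda>x. Re (f x) *\<^sub>R 1 + Im (f x) *\<^sub>R \<i>) = f"
      by (auto simp: complex_eq_iff)
    ultimately show ?thesis by simp
  qed
  assume "cpoly f"
  then have "real_polynomial_function (\<lambda>x. Re (f x)) \<and> real_polynomial_function (\<lambda>x. Im (f x))"
  proof (induction rule: cpoly.induct)
    case (coord i)
    have "bounded_linear (\<lambda>x::real^3. x $ i)" by (rule bounded_linear_vec_nth)
    then show ?case by (auto intro: real_polynomial_function.intros)
  qed (auto intro: real_polynomial_function.intros real_polynomial_function_diff)
  then show "polynomial_function f" using part by blast
qed

lemma cpoly_differentiable: "cpoly f \<Longrightarrow> f differentiable (at x)"
  using poly_partial(2)[of f x] by (auto simp: cpoly_iff_polynomial differentiable_def)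

lemma cpoly_continuous: "cpoly f \<Longrightarrow> continuous_on S f"
  by (meson cpoly_differentiable continuous_at_imp_continuous_on differentiable_imp_continuous_within)

lemma cpoly_partial: "cpoly f \<Longrightarrow> cpoly (partial j f)"
  using poly_partial(1) by (simp add: cpoly_iff_polynomial)

lemma partial_const: "partial j (\<lambda>x. c) x = 0"
  by (simp add: partial_def)

lemma partial_coord: "partial j (\<lambda>x. crd x i) x = (if i = j then 1 else 0)"
proof -
  have "((\<lambda>x::real^3. crd x i) has_derivative (\<lambda>h. complex_of_real (h $ i))) (at x)"
    by (intro has_derivative_of_real bounded_linear_imp_has_derivative bounded_linear_vec_nth)
  from partial_eqI[OF this, of j] show ?thesis by (simp add: axis_def)
qed

lemma partial_add:
  assumes "cpoly f" "cpoly g"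
  shows "partial j (\<lambda>x. f x + g x) x = partial j f x + partial j g x"
proof -
  obtain D E where D: "(f has_derivative D) (at x)" and E: "(g has_derivative E) (at x)"
    using assms cpoly_differentiable unfolding differentiable_def by blast
  show ?thesis
    by (simp only: partial_eqI[OF D] partial_eqI[OF E] partial_eqI[OF has_derivative_add[OF D E]])
qed

lemma partial_mult:
  assumes "cpoly f" "cpoly g"
  shows "partial j (\<lambda>x. f x * g x) x = f x * partial j g x + partial j f x * g x"
proof -
  obtain D E where D: "(f has_derivative D) (at x)" and E: "(g has_derivative E) (at x)"
    using assms cpoly_differentiable unfolding differentiable_def by blast
  show ?thesis
    by (simp only: partial_eqI[OF D] partial_eqI[OF E] partial_eqI[OF has_derivative_mult[OF D E]])
qed

lemma partial_cmult: "cpoly f \<Longrightarrow> partial j (\<lambda>x. c * f x) x = c * partial j f x"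
  by (simp add: partial_mult cpoly_intros partial_const)

lemma partial_minus: "cpoly f \<Longrightarrow> partial j (\<lambda>x. - f x) x = - partial j f x"
  using partial_cmult[of f j "-1"] by simp

lemma partial_diff:
  "cpoly f \<Longrightarrow> cpoly g \<Longrightarrow> partial j (\<lambda>x. f x - g x) x = partial j f x - partial j g x"
  using partial_add[of f "\<lambda>x. - g x"] by (simp add: cpoly_intros partial_minus)

lemma partial_sum:
  "(\<And>i. i \<in> I \<Longrightarrow> cpoly (f i)) \<Longrightarrow>
     partial j (\<lambda>x. \<Sum>i\<in>I. f i x) x = (\<Sum>i\<in>I. partial j (f i) x)"
  by (induction I rule: infinite_finite_induct) (auto simp: partial_const partial_add cpoly_intros)

lemma partial_cnj:
  assumes "cpoly f"
  shows "partial j (\<lambda>x. cnj (f x)) x = cnj (partial j f x)"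
proof -
  obtain D where D: "(f has_derivative D) (at x)"
    using assms cpoly_differentiable unfolding differentiable_def by blast
  show ?thesis by (simp only: partial_eqI[OF D] partial_eqI[OF has_derivative_cnj[OF D]])
qed

lemma partial_const_fun: "partial j (\<lambda>x. c) = (\<lambda>x. 0)"
  and partial_coord_fun: "partial j (\<lambda>x. crd x i) = (\<lambda>x. if i = j then 1 else 0)"
  and partial_add_fun: "cpoly f \<Longrightarrow> cpoly g \<Longrightarrow> partial j (\<lambda>x. f x + g x) = (\<lambda>x. partial j f x + partial j g x)"
  and partial_mult_fun: "cpoly f \<Longrightarrow> cpoly g \<Longrightarrow>
    partial j (\<lambda>x. f x * g x) = (\<lambda>x. f x * partial j g x + partial j f x * g x)"
  and partial_diff_fun: "cpoly f \<Longrightarrow> cpoly g \<Longrightarrow> partial j (\<lambda>x. f x - g x) = (\<lambda>x. partial j f x - partial j g x)"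
  by (rule ext, rule partial_const partial_coord partial_add partial_mult partial_diff; assumption)+

lemma partial_commute:
  assumes "cpoly f"
  shows "partial i (partial j f) x = partial j (partial i f) x"
  using assms
proof (induction arbitrary: x rule: cpoly.induct)
  case (const c)
  then show ?case by (simp add: partial_const_fun)
next
  case (coord k)
  then show ?case by (simp add: partial_coord_fun partial_const)
next
  case (add f g)
  then show ?case by (simp add: partial_add_fun cpoly_partial)
next
  case (mult f g)
  then show ?case
    by (simp add: partial_mult_fun partial_add partial_mult cpoly_partial cpoly_intros algebra_simps)
qed

text \<open>The components of x \<times> \<nabla>, that is, the angular momentum operators up to a
  scalar factor. They differentiate along rotations, hence obey the product rule and, on the sphere,
  integration by parts without boundary terms.\<close>

definition Lop :: "3 \<Rightarrow> (real^3 \<Rightarrow> complex) \<Rightarrow> real^3 \<Rightarrow> complex" where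
  "Lop i f x = (Q_mat x *v grad f x) $ i"

lemma Lop_1: "Lop 1 f x = crd x 2 * partial 3 f x - crd x 3 * partial 2 f x"
  and Lop_2: "Lop 2 f x = crd x 3 * partial 1 f x - crd x 1 * partial 3 f x"
  and Lop_3: "Lop 3 f x = crd x 1 * partial 2 f x - crd x 2 * partial 1 f x"
  by (simp_all add: Lop_def Q_mat_def grad_def matrix_vector_mult_def sum_3 Let_def)

lemmas Lop_simps = Lop_1 Lop_2 Lop_3

lemma Lop_fun:
  "Lop 1 = (\<lambda>f x. crd x 2 * partial 3 f x - crd x 3 * partial 2 f x)"
  "Lop 2 = (\<lambda>f x. crd x 3 * partial 1 f x - crd x 1 * partial 3 f x)"
  "Lop 3 = (\<lambda>f x. crd x 1 * partial 2 f x - crd x 2 * partial 1 f x)"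
  by (auto simp: Lop_simps fun_eq_iff)

lemma Lop_cases:
  obtains "i = (1::3)" "Lop i = (\<lambda>f x. crd x 2 * partial 3 f x - crd x 3 * partial 2 f x)"
  | "i = 2" "Lop i = (\<lambda>f x. crd x 3 * partial 1 f x - crd x 1 * partial 3 f x)"
  | "i = 3" "Lop i = (\<lambda>f x. crd x 1 * partial 2 f x - crd x 2 * partial 1 f x)"
  using exhaust_3[of i] by (auto simp: Lop_fun)

lemma cpoly_Lop: "cpoly f \<Longrightarrow> cpoly (Lop i f)"
  by (cases i rule: Lop_cases) (auto intro!: cpoly_intros cpoly_partial)

lemma Lop_mult: "cpoly f \<Longrightarrow> cpoly g \<Longrightarrow> Lop i (\<lambda>x. f x * g x) x = f x * Lop i g x + Lop i f x * g x"
  by (cases i rule: Lop_cases) (simp_all add: partial_mult algebra_simps)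

lemma Lop_cnj: "cpoly f \<Longrightarrow> Lop i (\<lambda>x. cnj (f x)) x = cnj (Lop i f x)"
  by (cases i rule: Lop_cases) (simp_all add: partial_cnj)

section \<open>Rotation invariance of the surface measure\<close>

lemma finite_measure_S2: "finite_measure S2"
  by (rule finite_measureI) (simp add: emeasure_S2_space)

lemma sigma_finite_S2: "sigma_finite_measure S2"
  using finite_measure_S2 by (simp add: finite_measure.axioms)

lemma measurable_S2_iff: "f \<in> measurable S2 N \<longleftrightarrow> f \<in> measurable (restrict_space borel (sphere 0 1)) N"
  using measurable_cong_sets[OF sets_S2 refl] by blast

lemma measurable_S2_I: "f \<in> measurable borel N \<Longrightarrow> f \<in> measurable S2 N"
  by (simp add: measurable_S2_iff measurable_restrict_space1)

lemma borel_measurable_orthogonal: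
  fixes R :: "'a::euclidean_space \<Rightarrow> 'a"
  assumes "orthogonal_transformation R"
  shows "R \<in> borel_measurable borel"
  using linear_continuous_on[OF linear_conv_bounded_linear[THEN iffD1,
      OF orthogonal_transformation_linear[OF assms]]]
  by (rule borel_measurable_continuous_onI)

text \<open>Orthogonal images preserve Lebesgue measure. Preimages of boxes are images under the
  inverse, and boxes determine \<open>lborel\<close>.\<close>

lemma lborel_distr_orthogonal:
  fixes R :: "real^'n::{finite,wellorder} \<Rightarrow> real^'n::_"
  assumes R: "orthogonal_transformation R"
  shows "distr lborel borel R = lborel"
proof (rule lborel_eqI[symmetric])
  have R_meas: "R \<in> borel_measurable borel" by (rule borel_measurable_orthogonal[OF R])
  fix l u :: "real^'n::_"
  assume le: "\<And>b. b \<in> Basis \<Longrightarrow> l \<bullet> b \<le> u \<bullet> b"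
  have pre: "R -` box l u = inv R ` box l u"
    using orthogonal_transformation_bij[OF R] by (simp add: bij_vimage_eq_inv_image)
  have B: "box l u \<in> lmeasurable" by simp
  have inv: "inv R ` box l u \<in> lmeasurable"
    "measure lebesgue (inv R ` box l u) = measure lebesgue (box l u)"
    using measurable_orthogonal_image[OF orthogonal_transformation_inv[OF R] B]
      measure_orthogonal_image[OF orthogonal_transformation_inv[OF R] B] by auto
  have meas: "R -` box l u \<in> sets borel" using measurable_sets[OF R_meas, of "box l u"] by simp
  have "emeasure (distr lborel borel R) (box l u) = emeasure lborel (R -` box l u)"
    using R_meas by (simp add: emeasure_distr)
  also have "\<dots> = emeasure lebesgue (inv R ` box l u)"
    using meas by (simp add: pre emeasure_completion main_part_sets)
  also have "\<dots> = emeasure lebesgue (box l u)"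
    using inv B by (simp add: emeasure_eq_measure2)
  also have "\<dots> = emeasure lborel (box l u)" by simp
  also have "\<dots> = (\<Prod>b\<in>Basis. (u - l) \<bullet> b)" using le by (simp add: emeasure_lborel_box)
  finally show "emeasure (distr lborel borel R) (box l u) = (\<Prod>b\<in>Basis. (u - l) \<bullet> b)" .
qed simp

lemma measurable_S2_orthogonal:
  assumes R: "orthogonal_transformation R"
  shows "R \<in> measurable S2 S2"
proof -
  have "R \<in> borel_measurable borel" by (rule borel_measurable_orthogonal[OF R])
  then have "R \<in> measurable (restrict_space borel (sphere 0 1)) (restrict_space borel (sphere 0 1))"
    by (intro measurable_restrict_space2 measurable_restrict_space1)
       (auto simp: space_restrict_space orthogonal_transformation_norm[OF R])
  then show ?thesis using measurable_cong_sets[OF sets_S2 sets_S2] by blast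
qed

text \<open>The surface measure is a cone volume, and the cone over the preimage of \<open>A\<close>
  is the preimage of the cone over \<open>A\<close>, because \<open>R\<close> is linear and
  preserves norms.\<close>

lemma S2_distr_orthogonal:
  assumes R: "orthogonal_transformation R"
  shows "distr S2 S2 R = S2"
proof (rule measure_eqI)
  let ?C = "cball 0 1 - {0} :: (real^3) set"
  let ?p = "\<lambda>x::real^3. x /\<^sub>R norm x"
  have R_meas: "R \<in> borel_measurable borel" by (rule borel_measurable_orthogonal[OF R])
  have em: "emeasure S2 A = 3 * emeasure lborel {x\<in>?C. ?p x \<in> A}"
    and cone: "{x\<in>?C. ?p x \<in> A} \<in> sets borel" if A: "A \<in> sets S2" for A
  proof -
    have A': "A \<in> sets (restrict_space borel (sphere 0 1))" using A by (simp add: sets_S2)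
    have eq: "?p -` A \<inter> space (restrict_space lborel ?C) = {x\<in>?C. ?p x \<in> A}"
      by (auto simp: space_restrict_space)
    have "?p -` A \<inter> space (restrict_space lborel ?C) \<in> sets (restrict_space lborel ?C)"
      by (rule measurable_sets[OF S2_meas_map A'])
    then show cone: "{x\<in>?C. ?p x \<in> A} \<in> sets borel"
      unfolding eq by (subst (asm) sets_restrict_space_iff) auto
    have "emeasure S2 A = 3 * emeasure (restrict_space lborel ?C) {x\<in>?C. ?p x \<in> A}"
      unfolding S2_def emeasure_scale_measure emeasure_distr[OF S2_meas_map A'] eq ..
    also have "emeasure (restrict_space lborel ?C) {x\<in>?C. ?p x \<in> A} = emeasure lborel {x\<in>?C. ?p x \<in> A}"
      by (rule emeasure_restrict_space) auto
    finally show "emeasure S2 A = 3 * emeasure lborel {x\<in>?C. ?p x \<in> A}" .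
  qed
  fix A assume "A \<in> sets (distr S2 S2 R)"
  then have A: "A \<in> sets S2" by simp
  note m = measurable_S2_orthogonal[OF R]
  have A': "R -` A \<inter> space S2 \<in> sets S2" using measurable_sets[OF m A] .
  have "emeasure (distr S2 S2 R) A = emeasure S2 (R -` A \<inter> space S2)"
    by (rule emeasure_distr[OF m A])
  also have "\<dots> = 3 * emeasure lborel {x\<in>?C. ?p x \<in> R -` A \<inter> space S2}"
    by (rule em[OF A'])
  also have "{x\<in>?C. ?p x \<in> R -` A \<inter> space S2} = R -` {x\<in>?C. ?p x \<in> A}"
  proof -
    have lin: "R (c *\<^sub>R x) = c *\<^sub>R R x" for c x
      using linear_cmul[OF orthogonal_transformation_linear[OF R]] .
    have n: "norm (R x) = norm x" for x using orthogonal_transformation_norm[OF R] .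
    have z: "R x = 0 \<longleftrightarrow> x = 0" for x
      using norm_eq_zero[of "R x"] by (simp add: n)
    show ?thesis
    proof (rule set_eqI)
      fix x
      have "R (x /\<^sub>R norm x) = R x /\<^sub>R norm (R x)" by (simp only: lin n)
      then show "x \<in> {x\<in>?C. ?p x \<in> R -` A \<inter> space S2} \<longleftrightarrow> x \<in> R -` {x\<in>?C. ?p x \<in> A}"
        by (auto simp: space_S2 n z)
    qed
  qed
  also have "emeasure lborel (R -` {x\<in>?C. ?p x \<in> A}) = emeasure (distr lborel borel R) {x\<in>?C. ?p x \<in> A}"
    using R_meas cone[OF A] by (simp add: emeasure_distr)
  also have "3 * \<dots> = emeasure S2 A"
    by (simp add: lborel_distr_orthogonal[OF R] em[OF A])
  finally show "emeasure (distr S2 S2 R) A = emeasure S2 A" .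
qed simp

lemma integral_S2_orthogonal:
  fixes f :: "real^3 \<Rightarrow> 'b::{banach, second_countable_topology}"
  assumes "orthogonal_transformation R" "f \<in> borel_measurable S2"
  shows "(\<integral>x. f (R x) \<partial>S2) = (\<integral>x. f x \<partial>S2)"
  using integral_distr[OF measurable_S2_orthogonal[OF assms(1)] assms(2)]
  by (simp add: S2_distr_orthogonal[OF assms(1)])

lemma cpoly_measurable_S2: "cpoly f \<Longrightarrow> f \<in> borel_measurable S2"
  by (intro measurable_S2_I borel_measurable_continuous_onI cpoly_continuous)

lemma cpoly_bounded_sphere:
  assumes "cpoly f"
  obtains B where "0 \<le> B" "\<And>x. x \<in> sphere 0 1 \<Longrightarrow> norm (f x) \<le> B"
proof -
  have "bounded (f ` sphere 0 1)"
    using assms by (intro compact_imp_bounded compact_continuous_image cpoly_continuous) auto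
  then obtain B where B: "\<forall>x\<in>sphere 0 1. norm (f x) \<le> B"
    unfolding bounded_iff by auto
  show thesis by (rule that[of "max 0 B"]) (use B in \<open>auto intro: max.coboundedI2\<close>)
qed

lemma integrable_S2_bounded:
  fixes f :: "real^3 \<Rightarrow> 'b::{banach, second_countable_topology}"
  assumes "f \<in> borel_measurable S2" "\<And>x. x \<in> sphere 0 1 \<Longrightarrow> norm (f x) \<le> B"
  shows "integrable S2 f"
  using assms by (intro finite_measure.integrable_const_bound[OF finite_measure_S2, of _ B] AE_I2)
    (auto simp: space_S2)

lemma cpoly_integrable: "cpoly f \<Longrightarrow> integrable S2 f"
  by (metis cpoly_bounded_sphere cpoly_measurable_S2 integrable_S2_bounded)

section \<open>Integration by parts on the sphere\<close>

text \<open>The vector product \<open>e\<^sub>i \<times> x\<close>, the velocity of the rotation about the axis \<open>i\<close>.\<close>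

definition rot_gen :: "3 \<Rightarrow> real^3 \<Rightarrow> real^3" where
  "rot_gen i x = (if i = 1 then vector [0, - x $ 3, x $ 2]
     else if i = 2 then vector [x $ 3, 0, - x $ 1] else vector [- x $ 2, x $ 1, 0])"

text \<open>Rodrigues' formula for the rotation by the angle \<open>t\<close> about the axis
  \<open>i\<close>: the axial component is fixed and the orthogonal one is turned in its
  plane.\<close>

definition rot :: "3 \<Rightarrow> real \<Rightarrow> real^3 \<Rightarrow> real^3" where
  "rot i t x = cos t *\<^sub>R (x - (x $ i) *\<^sub>R axis i 1) + sin t *\<^sub>R rot_gen i x + (x $ i) *\<^sub>R axis i 1"

lemma rot_orthogonal: "orthogonal_transformation (rot i t)"
proof -
  have "linear (rot i t)"
    unfolding linear_iff rot_def rot_gen_def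
    by (auto simp: vec_eq_iff forall_3 axis_def algebra_simps)
  moreover have "norm (rot i t x) = norm x" for x
  proof -
    define s c where "s = sin t" and "c = cos t"
    have sc: "s * s = 1 - c * c"
      using sin_squared_eq[of t] by (simp add: s_def c_def power2_eq_square)
    have "rot i t x \<bullet> rot i t x = x \<bullet> x"
    proof -
      have "(c * a - s * b) * (c * a - s * b) + (c * b + s * a) * (c * b + s * a)
          = (s * s + c * c) * (a * a + b * b)" for a b
        by (simp add: algebra_simps)
      then have *: "(c * a - s * b) * (c * a - s * b) + (c * b + s * a) * (c * b + s * a)
          = a * a + b * b" for a b
        by (simp add: sc)
      show ?thesis
        using exhaust_3[of i] *[of "x $ 2" "x $ 3"] *[of "x $ 3" "x $ 1"] *[of "x $ 1" "x $ 2"]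
        by (auto simp: rot_def rot_gen_def inner_vec_def sum_3 axis_def
            s_def[symmetric] c_def[symmetric])
    qed
    then show ?thesis by (simp add: norm_eq_sqrt_inner)
  qed
  ultimately show ?thesis by (simp add: orthogonal_transformation)
qed

lemma rot_0: "rot i 0 x = x"
  by (simp add: rot_def)

lemma rot_deriv: "((\<lambda>t. rot i t x) has_vector_derivative rot_gen i (rot i t x)) (at t)"
proof -
  have "((\<lambda>t. rot i t x) has_vector_derivative
      - sin t *\<^sub>R (x - (x $ i) *\<^sub>R axis i 1) + cos t *\<^sub>R rot_gen i x) (at t)"
    unfolding rot_def by (auto intro!: derivative_eq_intros)
  also have "- sin t *\<^sub>R (x - (x $ i) *\<^sub>R axis i 1) + cos t *\<^sub>R rot_gen i x = rot_gen i (rot i t x)"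
    using exhaust_3[of i] by (auto simp: rot_def rot_gen_def vec_eq_iff forall_3 axis_def)
  finally show ?thesis .
qed

text \<open>By the chain rule the derivative is (e_i \<times> y) . \<nabla> h at the rotated point
  y, and this triple product equals e_i . (y \<times> \<nabla> h).\<close>

lemma cpoly_rot_deriv:
  assumes "cpoly h"
  shows "((\<lambda>t. h (rot i t x)) has_vector_derivative Lop i h (rot i t x)) (at t)"
proof -
  let ?y = "rot i t x"
  obtain D where D: "(h has_derivative D) (at ?y)"
    using cpoly_differentiable[OF assms] by (auto simp: differentiable_def)
  have lin: "linear D" using D has_derivative_linear by blast
  have "((\<lambda>t. h (rot i t x)) has_derivative (\<lambda>s. D (s *\<^sub>R rot_gen i ?y))) (at t)"
    using has_derivative_compose[OF rot_deriv[unfolded has_vector_derivative_def] D] .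
  moreover have "D v = (\<Sum>j\<in>UNIV. (v $ j) *\<^sub>R partial j h ?y)" for v
  proof -
    have "D v = D (\<Sum>j\<in>UNIV. (v $ j) *\<^sub>R axis j 1)"
      using basis_expansion[of v] by (simp add: scalar_mult_eq_scaleR)
    also have "\<dots> = (\<Sum>j\<in>UNIV. (v $ j) *\<^sub>R partial j h ?y)"
      by (simp only: linear_sum[OF lin] linear_cmul[OF lin] partial_eqI[OF D])
    finally show ?thesis .
  qed
  then have "D (rot_gen i ?y) = Lop i h ?y"
    by (cases i rule: Lop_cases) (simp_all add: sum_3 rot_gen_def scaleR_conv_of_real)
  ultimately show ?thesis
    by (simp add: has_vector_derivative_def linear_cmul[OF lin])
qed

text \<open>
  Rotation invariance makes \<open>\<integral> h (rot i t x) dx\<close> constant in \<open>t\<close>; its derivative at \<open>0\<close> is the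
  integral of \<open>Lop i h\<close>.
\<close>

lemma integral_Lop:
  assumes h: "cpoly h"
  shows "(\<integral>x. Lop i h x \<partial>S2) = 0"
proof -
  define f where "f = (\<lambda>n x. (h (rot i (1 / real (Suc n)) x) - h x) /\<^sub>R (1 / real (Suc n)))"
  obtain B where B: "0 \<le> B" "\<And>x. x \<in> sphere 0 1 \<Longrightarrow> norm (Lop i h x) \<le> B"
    using cpoly_bounded_sphere[OF cpoly_Lop[OF h]] by blast
  have rot_meas: "(\<lambda>x. h (rot i t x)) \<in> borel_measurable S2" for t
    using measurable_compose[OF measurable_S2_orthogonal[OF rot_orthogonal] cpoly_measurable_S2[OF h]] .
  have rot_int: "integrable S2 (\<lambda>x. h (rot i t x))" for t
  proof -
    obtain B where "\<And>x. x \<in> sphere 0 1 \<Longrightarrow> norm (h x) \<le> B"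
      using cpoly_bounded_sphere[OF h] by blast
    then show ?thesis
      by (intro integrable_S2_bounded[OF rot_meas, of _ B])
         (simp add: orthogonal_transformation_norm[OF rot_orthogonal])
  qed
  have "(\<lambda>n. integral\<^sup>L S2 (f n)) \<longlonglongrightarrow> integral\<^sup>L S2 (Lop i h)"
  proof (rule integral_dominated_convergence[where w="\<lambda>_. B"])
    show "Lop i h \<in> borel_measurable S2" by (intro cpoly_measurable_S2 cpoly_Lop h)
    show "f n \<in> borel_measurable S2" for n
      unfolding f_def using rot_meas cpoly_measurable_S2[OF h] by measurable
    show "integrable S2 (\<lambda>_. B)"
      using finite_measure_S2 by (simp add: finite_measure.integrable_const)
    show "AE x in S2. (\<lambda>n. f n x) \<longlonglongrightarrow> Lop i h x"
    proof (rule AE_I2)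
      fix x
      let ?p = "\<lambda>t. (h (rot i t x) - h (rot i 0 x) - (t - 0) *\<^sub>R Lop i h (rot i 0 x)) /\<^sub>R norm (t - 0)"
      let ?q = "\<lambda>t. (h (rot i t x) - h (rot i 0 x)) /\<^sub>R t - Lop i h (rot i 0 x)"
      have "((\<lambda>t. norm (?p t))
          \<longlongrightarrow> 0) (at 0)"
        using cpoly_rot_deriv[OF h, of i x 0]
        by (intro tendsto_norm_zero) (simp add: has_vector_derivative_def has_derivative_at_within)
      then have "((\<lambda>t. norm (?q t)) \<longlongrightarrow> 0) (at 0)"
      proof (rule Lim_transform_eventually)
        have "norm (?p t)
            = norm (?q t)" if "t \<noteq> 0" for t
        proof -
          have "h (rot i t x) - h (rot i 0 x) - (t - 0) *\<^sub>R Lop i h (rot i 0 x) = t *\<^sub>R ?q t"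
            using that by (simp add: scaleR_diff_right)
          then show ?thesis using that by (simp only: norm_scaleR) simp
        qed
        then show "eventually (\<lambda>t. norm (?p t) = norm (?q t)) (at 0)"
          by (auto simp: eventually_at_filter)
      qed
      then have "((\<lambda>t. (h (rot i t x) - h (rot i 0 x)) /\<^sub>R t) \<longlongrightarrow> Lop i h (rot i 0 x)) (at 0)"
        by (simp only: tendsto_norm_zero_iff LIM_zero_iff)
      then have lim: "((\<lambda>t. (h (rot i t x) - h x) /\<^sub>R t) \<longlongrightarrow> Lop i h x) (at 0)"
        by (simp add: rot_0)
      have "filterlim (\<lambda>n. 1 / real (Suc n)) (at 0) sequentially"
        using LIMSEQ_inverse_real_of_nat by (simp add: filterlim_at inverse_eq_divide)
      from filterlim_compose[OF lim this] show "(\<lambda>n. f n x) \<longlonglongrightarrow> Lop i h x"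
        by (simp add: f_def)
    qed
    \<comment> \<open>Rotated points stay on the sphere, where \<open>Lop i h\<close> is bounded by
      \<open>B\<close>; the mean value inequality in the angle then bounds every difference quotient
      by the same constant.\<close>
    show "AE x in S2. norm (f n x) \<le> B" for n
    proof (rule AE_I2)
      fix x assume "x \<in> space S2"
      then have x: "norm x = 1" by (simp add: space_S2)
      have "norm (h (rot i (1 / real (Suc n)) x) - h (rot i 0 x)) \<le> B * norm (1 / real (Suc n) - 0)"
      proof (rule differentiable_bound[of UNIV])
        show "((\<lambda>t. h (rot i t x)) has_derivative (\<lambda>s. s *\<^sub>R Lop i h (rot i t x))) (at t within UNIV)" for t
          using cpoly_rot_deriv[OF h] by (simp add: has_vector_derivative_def)
        have "norm (Lop i h (rot i t x)) \<le> B" for t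
          by (rule B(2)) (simp add: orthogonal_transformation_norm[OF rot_orthogonal] x)
        then show "onorm (\<lambda>s. s *\<^sub>R Lop i h (rot i t x)) \<le> B" for t
          by (intro onorm_le) (simp add: mult.commute[of "\<bar>_\<bar>"] mult_right_mono)
      qed auto
      then show "norm (f n x) \<le> B"
        by (simp add: f_def rot_0 divide_simps mult.commute)
    qed
  qed
  moreover have "integral\<^sup>L S2 (f n) = 0" for n
    using rot_int[of "1 / real (Suc n)"] cpoly_integrable[OF h]
      integral_S2_orthogonal[OF rot_orthogonal cpoly_measurable_S2[OF h], of i "1 / real (Suc n)"]
    by (simp add: f_def)
  ultimately show ?thesis
    using LIMSEQ_unique[of "\<lambda>_. 0 :: complex" 0] by simp
qed

lemma integral_Lop_by_parts:
  assumes f: "cpoly f" and g: "cpoly g"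
  shows "(\<integral>x. Lop i f x * g x \<partial>S2) = - (\<integral>x. f x * Lop i g x \<partial>S2)"
proof -
  have "(\<integral>x. f x * Lop i g x + Lop i f x * g x \<partial>S2) = 0"
    using integral_Lop[OF cpoly.mult[OF f g], of i] by (simp add: Lop_mult[OF f g])
  moreover have "(\<integral>x. f x * Lop i g x + Lop i f x * g x \<partial>S2) =
      (\<integral>x. f x * Lop i g x \<partial>S2) + (\<integral>x. Lop i f x * g x \<partial>S2)"
    by (intro Bochner_Integration.integral_add cpoly_integrable cpoly_intros cpoly_Lop f g)
  ultimately show ?thesis by (simp add: add_eq_0_iff2 add.commute)
qed

section \<open>Solid harmonics and the eigenvalue of the squared rotation operators\<close>

definition solid_harmonic :: "nat \<Rightarrow> (real^3 \<Rightarrow> complex) \<Rightarrow> bool" where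
  "solid_harmonic l H \<longleftrightarrow> cpoly H \<and> (\<forall>c x. H (c *\<^sub>R x) = c ^ l *\<^sub>R H x) \<and> (\<forall>x. laplacian H x = 0)"

lemma solid_harmonicD:
  assumes "solid_harmonic l H"
  shows "cpoly H" "H (c *\<^sub>R x) = c ^ l *\<^sub>R H x" "laplacian H x = 0"
  using assms by (auto simp: solid_harmonic_def)

lemma solid_harmonic_cnj:
  assumes "solid_harmonic l H"
  shows "solid_harmonic l (\<lambda>x. cnj (H x))"
proof -
  have 1: "partial j (\<lambda>x. cnj (H x)) = (\<lambda>x. cnj (partial j H x))" for j
    using partial_cnj[OF solid_harmonicD(1)[OF assms]] by blast
  have "laplacian (\<lambda>x. cnj (H x)) x = cnj (laplacian H x)" for x
    unfolding laplacian_def 1 using partial_cnj[OF cpoly_partial[OF solid_harmonicD(1)[OF assms]]] by simp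
  then show ?thesis
    using assms by (auto simp: solid_harmonic_def cpoly_cnj scaleR_conv_of_real)
qed

lemma solid_euler:
  assumes "solid_harmonic l H"
  shows "(\<Sum>j\<in>UNIV. crd x j * partial j H x) = of_nat l * H x"
  using euler_homogeneous[of H l x] assms
  by (simp add: solid_harmonic_def cpoly_iff_polynomial scaleR_conv_of_real)

text \<open>Differentiate Euler's identity for \<open>H\<close>. The factor
  \<open>of_nat l - 1\<close> is a complex number, so nothing is truncated for
  \<open>l = 0\<close>.\<close>

lemma solid_euler_partial:
  assumes H: "solid_harmonic l H"
  shows "(\<Sum>j\<in>UNIV. crd x j * partial i (partial j H) x) = (of_nat l - 1) * partial i H x"
proof -
  note c = solid_harmonicD(1)[OF H]
  have "partial i (\<lambda>x. \<Sum>j\<in>UNIV. crd x j * partial j H x) x = partial i (\<lambda>x. of_nat l * H x) x"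
    using solid_euler[OF H] by presburger
  also have "partial i (\<lambda>x. of_nat l * H x) x = of_nat l * partial i H x"
    by (rule partial_cmult[OF c])
  also have "partial i (\<lambda>x. \<Sum>j\<in>UNIV. crd x j * partial j H x) x =
      (\<Sum>j\<in>UNIV. crd x j * partial i (partial j H) x + (if j = i then 1 else 0) * partial j H x)"
    by (simp add: partial_sum partial_mult partial_coord cpoly_intros cpoly_partial c)
  also have "\<dots> = (\<Sum>j\<in>UNIV. crd x j * partial i (partial j H) x) + partial i H x"
    by (simp add: sum.distrib if_distrib[of "\<lambda>a. a * _"] cong: if_cong)
  finally show ?thesis by (simp add: algebra_simps)
qed

text \<open>The sum of squares of x \<times> \<nabla> is the squared radius times the Laplacian,
  minus the second-order radial part, minus twice x . \<nabla>. The first vanishes by harmonicity,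
  and the two Euler identities turn the rest into \<open>- (l * (l - 1) + 2 * l)\<close>, which is
  \<open>- lam l\<close>.\<close>

lemma Lop_Lop_solid:
  assumes H: "solid_harmonic l H"
  shows "(\<Sum>i\<in>UNIV. Lop i (Lop i H) x) = - complex_of_real (lam l) * H x"
proof -
  note c = solid_harmonicD(1)[OF H]
  define X where "X = (\<lambda>i. crd x i)"
  define p where "p = (\<lambda>i. partial i H x)"
  define h where "h = (\<lambda>i j. partial i (partial j H) x)"
  have sym: "h 2 1 = h 1 2" "h 3 1 = h 1 3" "h 3 2 = h 2 3"
    using partial_commute[OF c] by (simp_all add: h_def)
  have e1: "X 1 * p 1 + X 2 * p 2 + X 3 * p 3 = of_nat l * H x"
    using solid_euler[OF H, of x] by (simp add: sum_3 X_def p_def)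
  have e2: "X 1 * h i 1 + X 2 * h i 2 + X 3 * h i 3 = (of_nat l - 1) * p i" for i
    using solid_euler_partial[OF H, of x i] by (simp add: sum_3 X_def p_def h_def)
  have tr: "h 1 1 + h 2 2 + h 3 3 = 0"
    using solid_harmonicD(3)[OF H, of x] by (simp add: laplacian_def sum_3 h_def)
  have "(\<Sum>i\<in>UNIV. Lop i (Lop i H) x) =
      (X 1 * X 1 + X 2 * X 2 + X 3 * X 3) * (h 1 1 + h 2 2 + h 3 3)
      - (X 1 * (X 1 * h 1 1 + X 2 * h 1 2 + X 3 * h 1 3) + X 2 * (X 1 * h 2 1 + X 2 * h 2 2 + X 3 * h 2 3)
         + X 3 * (X 1 * h 3 1 + X 2 * h 3 2 + X 3 * h 3 3))
      - 2 * (X 1 * p 1 + X 2 * p 2 + X 3 * p 3)"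
    unfolding sum_3 Lop_simps Lop_fun
    by (simp add: partial_diff partial_mult partial_coord cpoly_intros cpoly_partial c
        X_def p_def h_def sym[unfolded h_def] algebra_simps)
  also have "\<dots> = - ((of_nat l - 1) * (X 1 * p 1 + X 2 * p 2 + X 3 * p 3)) - 2 * (X 1 * p 1 + X 2 * p 2 + X 3 * p 3)"
    unfolding tr e2 by (simp add: algebra_simps)
  also have "\<dots> = - complex_of_real (lam l) * H x"
    unfolding e1 by (simp add: lam_def algebra_simps)
  finally show ?thesis .
qed

text \<open>(x \<times> \<nabla>) . \<nabla> equals x . (\<nabla> \<times> \<nabla>), which is 0 by
  symmetry of second derivatives. This is the source of the orthogonality between curls and
  gradients.\<close>

lemma sum_Lop_partial: "cpoly g \<Longrightarrow> (\<Sum>k\<in>UNIV. Lop k (partial k g) x) = 0"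
  using partial_commute[of g 1 2 x] partial_commute[of g 1 3 x] partial_commute[of g 2 3 x]
  by (simp add: sum_3 Lop_simps algebra_simps)

section \<open>Vector fields of solid harmonics\<close>

definition solid_curl :: "(real^3 \<Rightarrow> complex) \<Rightarrow> real^3 \<Rightarrow> complex^3" where
  "solid_curl H x = Q_mat x *v grad H x"

text \<open>On the unit sphere the normal derivative of a homogeneous function of degree
  \<open>l\<close> is \<open>l * H\<close>, so for such \<open>H\<close> the subtracted vector is
  the normal part of the gradient.\<close>

definition solid_grad :: "nat \<Rightarrow> (real^3 \<Rightarrow> complex) \<Rightarrow> real^3 \<Rightarrow> complex^3" where
  "solid_grad l H x = grad H x - (of_nat l * H x) *s cvec x"

lemma solid_curl_nth: "solid_curl H x $ k = Lop k H x"
  by (simp add: solid_curl_def Lop_def)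

lemma solid_grad_nth: "solid_grad l H x $ k = partial k H x - of_nat l * H x * crd x k"
  by (simp add: solid_grad_def grad_def cvec_def)

lemma cdot_3: "a \<bullet>\<^sub>C b = a $ 1 * cnj (b $ 1) + a $ 2 * cnj (b $ 2) + a $ 3 * cnj (b $ 3)"
  by (simp add: cdot_def sum_3)

lemma sphere_sum_squares:
  assumes "x \<in> sphere (0::real^3) 1"
  shows "crd x 1 * crd x 1 + crd x 2 * crd x 2
    + crd x 3 * crd x 3 = 1"
proof -
  have "x \<bullet> x = 1" using assms by (simp add: norm_eq_1)
  then have "x $ 1 * x $ 1 + x $ 2 * x $ 2 + x $ 3 * x $ 3 = 1" by (simp add: inner_vec_def sum_3)
  from arg_cong[OF this, of complex_of_real] show ?thesis by simp
qed

text \<open>At a unit vector \<open>x\<close> the derivative of \<open>y /\<^sub>R norm y\<close> is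
  the projection to the tangent plane. It removes from the derivative of \<open>H\<close> its value
  in direction \<open>x\<close>, which Euler's identity gives as \<open>l * H x\<close>.\<close>

lemma grad_radial_ext:
  assumes H: "solid_harmonic l H" and f: "\<And>x. x \<in> sphere 0 1 \<Longrightarrow> f x = H x" and x: "x \<in> sphere 0 1"
  shows "grad (radial_ext f) x = solid_grad l H x"
proof -
  have nx: "norm x = 1" "x \<noteq> 0" using x by auto
  obtain D where D: "(H has_derivative D) (at x)"
    using cpoly_differentiable[OF solid_harmonicD(1)[OF H]] by (auto simp: differentiable_def)
  have lin: "linear D" using D has_derivative_linear by blast
  have "((\<lambda>y::real^3. y /\<^sub>R norm y) has_derivative (\<lambda>h. h - (x \<bullet> h) *\<^sub>R x)) (at x)"
  proof -
    have "(norm has_derivative (\<lambda>h. x \<bullet> h)) (at x)"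
      using has_derivative_norm[OF nx(2)] nx(1) by (simp add: sgn_div_norm inner_commute)
    from has_derivative_scaleR[OF Deriv.has_derivative_inverse[OF _ this] has_derivative_ident] show ?thesis
      using nx by (simp add: algebra_simps)
  qed
  moreover have "(H has_derivative D) (at (x /\<^sub>R norm x))" using D nx by simp
  ultimately have "((\<lambda>y. H (y /\<^sub>R norm y)) has_derivative (\<lambda>h. D (h - (x \<bullet> h) *\<^sub>R x))) (at x)"
    by (rule has_derivative_compose)
  then have "(radial_ext f has_derivative (\<lambda>h. D (h - (x \<bullet> h) *\<^sub>R x))) (at x)"
    by (rule has_derivative_transform_within_open[where s="- {0}"])
       (use nx f in \<open>auto simp: radial_ext_def\<close>)
  then have "partial j (radial_ext f) x = D (axis j 1 - (x \<bullet> axis j 1) *\<^sub>R x)" for j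
    by (rule partial_eqI)
  moreover have "D x = of_nat l * H x"
  proof -
    have "D x = D (\<Sum>j\<in>UNIV. (x $ j) *\<^sub>R axis j 1)"
      using basis_expansion[of x] by (simp add: scalar_mult_eq_scaleR)
    also have "\<dots> = (\<Sum>j\<in>UNIV. (x $ j) *\<^sub>R partial j H x)"
      by (simp only: linear_sum[OF lin] linear_cmul[OF lin] partial_eqI[OF D])
    also have "\<dots> = of_nat l * H x" using solid_euler[OF H, of x] by (simp add: scaleR_conv_of_real)
    finally show ?thesis .
  qed
  ultimately show ?thesis
    unfolding vec_eq_iff grad_def solid_grad_nth linear_diff[OF lin] linear_cmul[OF lin]
    by (simp add: partial_eqI[OF D] inner_axis scaleR_conv_of_real[of _ "of_nat l * H x"])
qed

text \<open>The normal part of the gradient disappears because x \<times> x = 0.\<close>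

lemma surf_curl_solid:
  assumes "solid_harmonic l H" "\<And>x. x \<in> sphere 0 1 \<Longrightarrow> f x = H x" "x \<in> sphere 0 1"
  shows "surf_curl f x = solid_curl H x"
proof -
  have "grad (radial_ext f) x = solid_grad l H x" by (rule grad_radial_ext[OF assms])
  then show ?thesis
    by (simp only: surf_curl_def) (simp add: vec_eq_iff forall_3 solid_curl_nth Lop_simps Q_mat_def matrix_vector_mult_def sum_3
        solid_grad_nth Let_def algebra_simps)
qed

lemma cvec_solid_grad:
  assumes H: "solid_harmonic l H" and x: "x \<in> sphere 0 1"
  shows "(\<Sum>k\<in>UNIV. crd x k * solid_grad l H x $ k) = 0"
  using solid_euler[OF H, of x] sphere_sum_squares[OF x]
  unfolding sum_3 solid_grad_nth by algebra

lemma surf_grad_solid: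
  assumes "solid_harmonic l H" "\<And>x. x \<in> sphere 0 1 \<Longrightarrow> f x = H x" "x \<in> sphere 0 1"
  shows "surf_grad f x = solid_grad l H x"
proof -
  have "(outer x *v solid_grad l H x) $ i
      = crd x i * (\<Sum>k\<in>UNIV. crd x k * solid_grad l H x $ k)" for i
    by (simp add: matrix_vector_mult_def outer_def sum_distrib_left mult.assoc)
  then have "outer x *v solid_grad l H x = 0"
    using cvec_solid_grad[OF assms(1,3)] by (simp add: vec_eq_iff)
  moreover have "grad (radial_ext f) x = solid_grad l H x" by (rule grad_radial_ext[OF assms])
  ultimately show ?thesis
    by (simp add: surf_grad_def matrix_vector_mult_diff_rdistrib)
qed

lemma solid_curl_cdot:
  assumes "cpoly G"
  shows "solid_curl H x \<bullet>\<^sub>C solid_curl G x = (\<Sum>k\<in>UNIV. Lop k H x * Lop k (\<lambda>x. cnj (G x)) x)"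
  by (simp add: cdot_def solid_curl_nth Lop_cnj[OF assms])

text \<open>On the tangent plane at a unit vector \<open>x\<close>, the map \<open>Q_mat x\<close>
  is a rotation by a right angle and preserves inner products. In coordinates this is Lagrange's
  identity together with Euler's.\<close>

lemma solid_grad_cdot:
  assumes H: "solid_harmonic l H" and G: "solid_harmonic l' G" and x: "x \<in> sphere 0 1"
  shows "solid_grad l H x \<bullet>\<^sub>C solid_grad l' G x = solid_curl H x \<bullet>\<^sub>C solid_curl G x"
proof -
  define X where "X = (\<lambda>i. crd x i)"
  define p where "p = (\<lambda>i. partial i H x)"
  define q where "q = (\<lambda>i. cnj (partial i G x))"
  have 1: "X 1 * X 1 + X 2 * X 2 + X 3 * X 3 = 1"
    using sphere_sum_squares[OF x] by (simp add: X_def)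
  have 2: "X 1 * p 1 + X 2 * p 2 + X 3 * p 3 = of_nat l * H x"
    using solid_euler[OF H, of x] by (simp add: sum_3 X_def p_def)
  have 3: "X 1 * q 1 + X 2 * q 2 + X 3 * q 3 = of_nat l' * cnj (G x)"
    using arg_cong[OF solid_euler[OF G, of x], of cnj] by (simp add: sum_3 X_def q_def)
  have "solid_grad l H x \<bullet>\<^sub>C solid_grad l' G x =
      (p 1 - of_nat l * H x * X 1) * (q 1 - of_nat l' * cnj (G x) * X 1)
      + (p 2 - of_nat l * H x * X 2) * (q 2 - of_nat l' * cnj (G x) * X 2)
      + (p 3 - of_nat l * H x * X 3) * (q 3 - of_nat l' * cnj (G x) * X 3)"
    by (simp add: cdot_3 solid_grad_nth X_def p_def q_def)
  moreover have "solid_curl H x \<bullet>\<^sub>C solid_curl G x =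
      (X 2 * p 3 - X 3 * p 2) * (X 2 * q 3 - X 3 * q 2)
      + (X 3 * p 1 - X 1 * p 3) * (X 3 * q 1 - X 1 * q 3)
      + (X 1 * p 2 - X 2 * p 1) * (X 1 * q 2 - X 2 * q 1)"
    by (simp add: cdot_3 solid_curl_nth Lop_simps X_def p_def q_def)
  ultimately show ?thesis using 1 2 3 by algebra
qed

text \<open>The normal part of \<open>solid_grad\<close> contributes nothing because x \<times>
  \<nabla> H is tangent, so the full gradient may stand on the right.\<close>

lemma solid_curl_grad_cdot:
  assumes "cpoly G"
  shows "solid_curl H x \<bullet>\<^sub>C solid_grad l' G x = (\<Sum>k\<in>UNIV. Lop k H x * partial k (\<lambda>x. cnj (G x)) x)"
  by (simp add: cdot_3 sum_3 solid_curl_nth solid_grad_nth Lop_simps partial_cnj[OF assms] algebra_simps)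

lemma cdot_commute: "cnj (a \<bullet>\<^sub>C b) = b \<bullet>\<^sub>C a"
  by (simp add: cdot_def mult.commute)

lemma field_inner_commute: "field_inner f g = cnj (field_inner g f)"
  unfolding field_inner_def by (subst Bochner_Integration.integral_cnj[symmetric]) (simp add: cdot_commute)

lemma field_inner_cong:
  "(\<And>x. x \<in> sphere 0 1 \<Longrightarrow> f x \<bullet>\<^sub>C g x = f' x \<bullet>\<^sub>C g' x) \<Longrightarrow> field_inner f g = field_inner f' g'"
  unfolding field_inner_def by (rule Bochner_Integration.integral_cong) (auto simp: space_S2)

text \<open>One integration by parts per component moves the rotation operators onto the conjugate
  of \<open>G\<close>, where \<open>Lop_Lop_solid\<close> supplies the eigenvalue.\<close>

lemma solid_curl_inner:
  assumes H: "solid_harmonic l H" and G: "solid_harmonic l' G"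
  shows "field_inner (solid_curl H) (solid_curl G) = complex_of_real (lam l') * scalar_inner H G"
proof -
  define G' where "G' = (\<lambda>x. cnj (G x))"
  have G': "solid_harmonic l' G'" unfolding G'_def by (rule solid_harmonic_cnj[OF G])
  note cp = solid_harmonicD(1)[OF H] solid_harmonicD(1)[OF G']
  have "field_inner (solid_curl H) (solid_curl G) = (\<integral>x. (\<Sum>k\<in>UNIV. Lop k H x * Lop k G' x) \<partial>S2)"
    by (simp add: field_inner_def solid_curl_cdot[OF solid_harmonicD(1)[OF G]] G'_def)
  also have "\<dots> = (\<Sum>k\<in>UNIV. \<integral>x. Lop k H x * Lop k G' x \<partial>S2)"
    by (intro Bochner_Integration.integral_sum cpoly_integrable cpoly_intros cpoly_Lop cp)
  also have "\<dots> = (\<Sum>k\<in>UNIV. - (\<integral>x. H x * Lop k (Lop k G') x \<partial>S2))"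
    by (simp add: integral_Lop_by_parts cp cpoly_Lop)
  also have "\<dots> = - (\<Sum>k\<in>UNIV. \<integral>x. H x * Lop k (Lop k G') x \<partial>S2)"
    by (simp add: sum_negf)
  also have "(\<Sum>k\<in>UNIV. \<integral>x. H x * Lop k (Lop k G') x \<partial>S2) = (\<integral>x. (\<Sum>k\<in>UNIV. H x * Lop k (Lop k G') x) \<partial>S2)"
    by (intro Bochner_Integration.integral_sum[symmetric] cpoly_integrable cpoly_intros cpoly_Lop cp)
  also have "\<dots> = (\<integral>x. - complex_of_real (lam l') * (H x * G' x) \<partial>S2)"
    by (simp add: sum_distrib_left[symmetric] Lop_Lop_solid[OF G'] mult_ac)
  also have "\<dots> = - complex_of_real (lam l') * scalar_inner H G"
    by (simp only: integral_mult_right_zero scalar_inner_def G'_def)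
  finally show ?thesis by simp
qed

lemma solid_grad_inner:
  assumes "solid_harmonic l H" "solid_harmonic l' G"
  shows "field_inner (solid_grad l H) (solid_grad l' G) = complex_of_real (lam l') * scalar_inner H G"
  using solid_curl_inner[OF assms] field_inner_cong[OF solid_grad_cdot[OF assms]] by simp

text \<open>Integration by parts leaves \<open>H\<close> times the sum in
  \<open>sum_Lop_partial\<close>.\<close>

lemma solid_curl_grad_inner:
  assumes H: "solid_harmonic l H" and G: "solid_harmonic l' G"
  shows "field_inner (solid_curl H) (solid_grad l' G) = 0"
proof -
  define G' where "G' = (\<lambda>x. cnj (G x))"
  have G': "cpoly G'" unfolding G'_def by (intro cpoly_cnj solid_harmonicD(1)[OF G])
  note cp = solid_harmonicD(1)[OF H] G'
  have "field_inner (solid_curl H) (solid_grad l' G) = (\<integral>x. (\<Sum>k\<in>UNIV. Lop k H x * partial k G' x) \<partial>S2)"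
    by (simp add: field_inner_def solid_curl_grad_cdot[OF solid_harmonicD(1)[OF G]] G'_def)
  also have eq: "\<dots> = (\<Sum>k\<in>UNIV. \<integral>x. Lop k H x * partial k G' x \<partial>S2)"
    by (intro Bochner_Integration.integral_sum cpoly_integrable cpoly_intros cpoly_Lop cpoly_partial cp)
  also have "\<dots> = (\<Sum>k\<in>UNIV. - (\<integral>x. H x * Lop k (partial k G') x \<partial>S2))"
    by (simp add: integral_Lop_by_parts cp cpoly_partial)
  also have "\<dots> = - (\<Sum>k\<in>UNIV. \<integral>x. H x * Lop k (partial k G') x \<partial>S2)"
    by (simp add: sum_negf)
  also have "(\<Sum>k\<in>UNIV. \<integral>x. H x * Lop k (partial k G') x \<partial>S2) = (\<integral>x. (\<Sum>k\<in>UNIV. H x * Lop k (partial k G') x) \<partial>S2)"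
    by (intro Bochner_Integration.integral_sum[symmetric] cpoly_integrable cpoly_intros cpoly_Lop cpoly_partial cp)
  also have "\<dots> = 0"
    by (simp add: sum_distrib_left[symmetric] sum_Lop_partial[OF G'])
  finally show ?thesis by simp
qed

lemma lam_inj: "lam l = lam l' \<Longrightarrow> l = l'"
proof -
  assume "lam l = lam l'"
  then have "l * (l + 1) = l' * (l' + 1)"
    unfolding lam_def by (metis of_nat_1 of_nat_add of_nat_eq_iff of_nat_mult)
  then show "l = l'"
    using mult_strict_mono[of l l' "l + 1" "l' + 1"] mult_strict_mono[of l' l "l' + 1" "l + 1"]
    by (cases l l' rule: linorder_cases) auto
qed

text \<open>\<open>solid_curl_inner\<close> puts the eigenvalue on the second argument. Exchanging
  the arguments gives the other eigenvalue, and both can hold only if the inner product is 0 or the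
  degrees agree.\<close>

lemma solid_orthogonal:
  assumes H: "solid_harmonic l H" and G: "solid_harmonic l' G" and "l \<noteq> l'"
  shows "scalar_inner H G = 0"
proof -
  have "scalar_inner G H = cnj (scalar_inner H G)"
    unfolding scalar_inner_def by (subst Bochner_Integration.integral_cnj[symmetric]) (simp add: mult.commute)
  then have "scalar_inner H G = 0 \<or> lam l = lam l'"
    using solid_curl_inner[OF H G] solid_curl_inner[OF G H] field_inner_commute[of "solid_curl H" "solid_curl G"]
    by auto
  then show ?thesis using lam_inj[of l l'] assms(3) by auto
qed

section \<open>Helmholtz decomposition of rotation fields\<close>

lemma laplacian_diff:
  "cpoly f \<Longrightarrow> cpoly g \<Longrightarrow> laplacian (\<lambda>x. f x - g x) x = laplacian f x - laplacian g x"
  by (simp add: laplacian_def partial_diff_fun partial_diff cpoly_partial sum_subtractf)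

lemma laplacian_cmult: "cpoly f \<Longrightarrow> laplacian (\<lambda>x. c * f x) x = c * laplacian f x"
  by (simp add: laplacian_def partial_mult_fun partial_const_fun partial_mult cpoly_partial
      cpoly_intros partial_const sum_distrib_left)

lemma laplacian_add:
  "cpoly f \<Longrightarrow> cpoly g \<Longrightarrow> laplacian (\<lambda>x. f x + g x) x = laplacian f x + laplacian g x"
  by (simp add: laplacian_def partial_add_fun partial_add cpoly_partial sum.distrib)

lemma laplacian_coord_mult:
  assumes "cpoly q"
  shows "laplacian (\<lambda>x. crd x a * q x) x = 2 * partial a q x + crd x a * laplacian q x"
proof -
  have 1: "partial j (\<lambda>x. crd x a * q x) = (\<lambda>x. crd x a * partial j q x + (if a = j then 1 else 0) * q x)" for j
    by (simp add: fun_eq_iff partial_mult partial_coord assms cpoly_intros)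
  have 2: "partial j (partial j (\<lambda>x. crd x a * q x)) x =
      crd x a * partial j (partial j q) x + 2 * (if a = j then 1 else 0) * partial j q x" for j
    unfolding 1 by (simp add: partial_add partial_mult partial_coord partial_const assms cpoly_intros cpoly_partial)
  show ?thesis
    unfolding laplacian_def 2
    by (simp add: sum.distrib sum_distrib_left if_distrib[of "\<lambda>a. a * _"] if_distrib[of "\<lambda>a. _ * a"] cong: if_cong)
qed

lemma scaleR_complex: "r *\<^sub>R (z::complex) = complex_of_real r * z"
  by (rule scaleR_conv_of_real)

lemma solid_harmonicI:
  "cpoly H \<Longrightarrow> (\<And>c x. H (c *\<^sub>R x) = c ^ l *\<^sub>R H x) \<Longrightarrow> (\<And>x. laplacian H x = 0) \<Longrightarrow> solid_harmonic l H"
  by (simp add: solid_harmonic_def)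

lemma solid_harmonic_diff:
  "solid_harmonic l f \<Longrightarrow> solid_harmonic l g \<Longrightarrow> solid_harmonic l (\<lambda>x. f x - g x)"
  by (simp add: solid_harmonic_def laplacian_diff cpoly_diff scaleR_diff_right)

lemma solid_harmonic_add:
  "solid_harmonic l f \<Longrightarrow> solid_harmonic l g \<Longrightarrow> solid_harmonic l (\<lambda>x. f x + g x)"
  by (simp add: solid_harmonic_def laplacian_add cpoly.add scaleR_add_right)

lemma solid_harmonic_cmult: "solid_harmonic l f \<Longrightarrow> solid_harmonic l (\<lambda>x. c * f x)"
  by (simp add: solid_harmonic_def laplacian_cmult cpoly_intros)

lemma solid_harmonic_sum:
  "(\<And>i. i \<in> I \<Longrightarrow> solid_harmonic l (f i)) \<Longrightarrow> solid_harmonic l (\<lambda>x. \<Sum>i\<in>I. f i x)"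
proof (induction I rule: infinite_finite_induct)
  case (insert i I)
  then show ?case by (simp add: solid_harmonic_add)
qed (simp_all add: solid_harmonic_def laplacian_def partial_const_fun partial_const cpoly_intros)

lemma solid_harmonic_coord: "solid_harmonic 1 (\<lambda>x. crd x i)"
proof -
  have "laplacian (\<lambda>x. crd x i) x = 0" for x
    by (simp add: laplacian_def partial_coord_fun partial_const)
  then show ?thesis by (simp add: solid_harmonic_def cpoly_intros scaleR_complex)
qed

lemma solid_harmonic_0:
  assumes "solid_harmonic 0 H"
  shows "H = (\<lambda>x. H 0)"
proof
  fix x show "H x = H 0" using solid_harmonicD(2)[OF assms, of 0 x] by simp
qed

lemma solid_harmonic_partial:
  assumes H: "solid_harmonic (Suc l) H"
  shows "solid_harmonic l (partial i H)"
proof (rule solid_harmonicI)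
  note c = solid_harmonicD(1)[OF H]
  show "cpoly (partial i H)" by (rule cpoly_partial[OF c])
  show "laplacian (partial i H) x = 0" for x
  proof -
    have sw: "partial j (partial i H) = partial i (partial j H)" for j
      using partial_commute[OF c] by blast
    have "laplacian (partial i H) x = (\<Sum>j\<in>UNIV. partial j (partial i (partial j H)) x)"
      unfolding laplacian_def sw ..
    also have "\<dots> = (\<Sum>j\<in>UNIV. partial i (partial j (partial j H)) x)"
      by (intro sum.cong refl partial_commute cpoly_partial c)
    also have "\<dots> = partial i (laplacian H) x"
      unfolding laplacian_def by (subst partial_sum) (simp_all add: cpoly_partial c)
    also have "laplacian H = (\<lambda>x. 0)" using solid_harmonicD(3)[OF H] by blast
    finally show ?thesis by (simp add: partial_const)
  qed
  fix a x
  have nz: "partial i H (a *\<^sub>R x) = a ^ l *\<^sub>R partial i H x" if "a \<noteq> 0" for a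
  proof -
    obtain D where D: "(H has_derivative D) (at (a *\<^sub>R x))"
      using cpoly_differentiable[OF c] by (auto simp: differentiable_def)
    obtain E where E: "(H has_derivative E) (at x)"
      using cpoly_differentiable[OF c] by (auto simp: differentiable_def)
    have lin: "linear D" using D has_derivative_linear by blast
    have "((\<lambda>y. H (a *\<^sub>R y)) has_derivative (\<lambda>h. D (a *\<^sub>R h))) (at x)"
      by (rule has_derivative_compose[where f="\<lambda>y. a *\<^sub>R y" and g=H, OF _ D])
         (auto intro!: derivative_eq_intros)
    moreover have "((\<lambda>y. a ^ Suc l *\<^sub>R H y) has_derivative (\<lambda>h. a ^ Suc l *\<^sub>R E h)) (at x)"
      by (intro has_derivative_scaleR_right E)
    ultimately have "(\<lambda>h. D (a *\<^sub>R h)) = (\<lambda>h. a ^ Suc l *\<^sub>R E h)"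
      unfolding solid_harmonicD(2)[OF H] by (rule has_derivative_unique)
    from fun_cong[OF this, of "axis i 1"]
    have "a *\<^sub>R partial i H (a *\<^sub>R x) = a *\<^sub>R (a ^ l *\<^sub>R partial i H x)"
      by (simp add: linear_cmul[OF lin] partial_eqI[OF D] partial_eqI[OF E])
    then show ?thesis using that by (simp only: scaleR_cancel_left) simp
  qed
  show "partial i H (a *\<^sub>R x) = a ^ l *\<^sub>R partial i H x"
  proof (cases "a = 0")
    \<comment> \<open>Here the factor \<open>a\<close> cannot be cancelled. Both sides are
      continuous in \<open>a\<close>, so the identity extends from nonzero values; for
      \<open>l = 0\<close> this also covers \<open>0 ^ 0 = 1\<close>.\<close>
    case True
    have cont: "isCont (partial i H) y" for y
      using cpoly_continuous[OF cpoly_partial[OF c], of UNIV] by (simp add: continuous_on_eq_continuous_at)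
    have "isCont (\<lambda>a. partial i H (a *\<^sub>R x)) 0"
      by (rule isCont_o2[OF _ cont]) (intro continuous_intros)
    then have "((\<lambda>a. partial i H (a *\<^sub>R x)) \<longlongrightarrow> partial i H (0 *\<^sub>R x)) (at 0)"
      by (simp add: isCont_def)
    moreover have "((\<lambda>a. partial i H (a *\<^sub>R x)) \<longlongrightarrow> 0 ^ l *\<^sub>R partial i H x) (at 0)"
    proof (rule Lim_transform_eventually)
      show "((\<lambda>a. a ^ l *\<^sub>R partial i H x) \<longlongrightarrow> 0 ^ l *\<^sub>R partial i H x) (at 0)"
        by (intro tendsto_intros)
      show "eventually (\<lambda>a. a ^ l *\<^sub>R partial i H x = partial i H (a *\<^sub>R x)) (at 0)"
        using nz by (auto simp: eventually_at_filter)
    qed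
    ultimately have "partial i H (0 *\<^sub>R x) = 0 ^ l *\<^sub>R partial i H x"
      by (rule tendsto_unique[rotated]) simp
    then show ?thesis using True by simp
  qed (rule nz)
qed

text \<open>The Laplacian of a coordinate times a harmonic function is twice a partial derivative,
  and for \<open>Lop\<close> the two resulting mixed derivatives cancel.\<close>

lemma solid_harmonic_Lop:
  assumes H: "solid_harmonic (Suc l) H"
  shows "solid_harmonic (Suc l) (Lop i H)"
proof (rule solid_harmonicI)
  note c = solid_harmonicD(1)[OF H]
  show "cpoly (Lop i H)" by (rule cpoly_Lop[OF c])
  note hom = solid_harmonicD(2)[OF solid_harmonic_partial[OF H]]
  show "Lop i H (a *\<^sub>R x) = a ^ Suc l *\<^sub>R Lop i H x" for a x
    by (cases i rule: Lop_cases) (simp_all add: hom scaleR_complex algebra_simps)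
  note har = solid_harmonicD(3)[OF solid_harmonic_partial[OF H]]
  show "laplacian (Lop i H) x = 0" for x
    by (cases i rule: Lop_cases)
      (use partial_commute[OF c] in \<open>simp_all add: laplacian_diff laplacian_coord_mult cpoly_partial cpoly_intros c har\<close>)
qed

lemma laplacian_norm_sq_mult:
  assumes q: "cpoly q"
  shows "laplacian (\<lambda>x. (\<Sum>a\<in>UNIV. crd x a * crd x a) * q x) x =
    6 * q x + 4 * (\<Sum>a\<in>UNIV. crd x a * partial a q x)
    + (\<Sum>a\<in>UNIV. crd x a * crd x a) * laplacian q x"
proof -
  have eq: "(\<lambda>x. (\<Sum>a\<in>UNIV. crd x a * crd x a) * q x) =
    (\<lambda>x. crd x 1 * (crd x 1 * q x)
       + crd x 2 * (crd x 2 * q x)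
       + crd x 3 * (crd x 3 * q x))"
    by (simp add: sum_3 algebra_simps)
  have one: "laplacian (\<lambda>x. crd x a * (crd x a * q x)) x =
      2 * q x + 4 * (crd x a * partial a q x)
      + crd x a * crd x a * laplacian q x" for a
    by (subst laplacian_coord_mult, intro cpoly_intros q,
        subst partial_mult[OF cpoly.coord q], subst laplacian_coord_mult[OF q])
       (simp add: partial_coord algebra_simps)
  have c: "cpoly (\<lambda>x. crd x a * (crd x a * q x))" for a
    by (intro cpoly_intros q)
  show ?thesis
    unfolding eq unfolding laplacian_add[OF cpoly.add[OF c c] c] laplacian_add[OF c c] one
    by (simp add: sum_3 algebra_simps)
qed

text \<open>
  The component of degree \<open>l + 1\<close> of \<open>x\<^sub>i p\<close>; the other component is \<open>|x|\<^sup>2 \<partial>\<^sub>i p / (2 l + 1)\<close>.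
\<close>

definition raise_harmonic :: "nat \<Rightarrow> 3 \<Rightarrow> (real^3 \<Rightarrow> complex) \<Rightarrow> real^3 \<Rightarrow> complex" where
  "raise_harmonic l i p x = crd x i * p x
     - (\<Sum>a\<in>UNIV. crd x a * crd x a) * (1 / of_nat (2 * l + 1) * partial i p x)"

text \<open>The Laplacian of \<open>crd x i * p x\<close> is \<open>2 * partial i p x\<close>, and
  that of the squared radius times a harmonic \<open>q\<close> of degree \<open>l\<close> is
  \<open>(6 + 4 * l) * q\<close>. With \<open>p\<close> of degree \<open>Suc l\<close>, the number
  \<open>6 + 4 * l\<close> is twice \<open>2 * Suc l + 1\<close>, which fixes the constant in
  \<open>raise_harmonic\<close>.\<close>

lemma solid_harmonic_raise:
  assumes p: "solid_harmonic (Suc l) p"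
  shows "solid_harmonic (Suc (Suc l)) (raise_harmonic (Suc l) i p)"
proof (rule solid_harmonicI)
  let ?q = "\<lambda>x. 1 / of_nat (2 * Suc l + 1) * partial i p x"
  note c = solid_harmonicD(1)[OF p]
  have q: "solid_harmonic l ?q"
    by (intro solid_harmonic_cmult solid_harmonic_partial p)
  have raise: "raise_harmonic (Suc l) i p = (\<lambda>x. crd x i * p x
     - (\<Sum>a\<in>UNIV. crd x a * crd x a) * ?q x)"
    by (simp add: raise_harmonic_def fun_eq_iff)
  show "cpoly (raise_harmonic (Suc l) i p)"
    unfolding raise by (intro cpoly_intros cpoly_partial c)
  show "raise_harmonic (Suc l) i p (a *\<^sub>R x) = a ^ Suc (Suc l) *\<^sub>R raise_harmonic (Suc l) i p x" for a x
    unfolding raise using solid_harmonicD(2)[OF p, of a x] solid_harmonicD(2)[OF solid_harmonic_partial[OF p], of i a x]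
    by (simp add: scaleR_complex sum_3 algebra_simps)
  show "laplacian (raise_harmonic (Suc l) i p) x = 0" for x
  proof -
    have "cpoly (\<lambda>x. crd x i * p x)"
      "cpoly (\<lambda>x. (\<Sum>a\<in>UNIV. crd x a * crd x a) * ?q x)"
      by (intro cpoly_intros cpoly_partial c)+
    from laplacian_diff[OF this, of x] have "laplacian (raise_harmonic (Suc l) i p) x =
        (2 * partial i p x + crd x i * laplacian p x)
        - (6 * ?q x + 4 * (\<Sum>a\<in>UNIV. crd x a * partial a ?q x)
           + (\<Sum>a\<in>UNIV. crd x a * crd x a) * laplacian ?q x)"
      unfolding raise laplacian_coord_mult[OF c] laplacian_norm_sq_mult[OF solid_harmonicD(1)[OF q]] .
    also have "\<dots> = 2 * partial i p x - (6 + 4 * of_nat l) * ?q x"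
      by (simp only: solid_harmonicD(3)[OF p] solid_harmonicD(3)[OF q] solid_euler[OF q])
         (simp only: mult_zero_right add_0_right ring_distribs mult.assoc)
    also have "(6 + 4 * of_nat l) * ?q x = 2 * partial i p x"
    proof -
      define N where "N = (of_nat (2 * Suc l + 1) :: complex)"
      have "N \<noteq> 0" unfolding N_def by (simp only: of_nat_eq_0_iff)
      moreover have "(6 + 4 * of_nat l :: complex) = 2 * N" by (simp add: N_def)
      ultimately show ?thesis by (simp only: N_def[symmetric]) simp
    qed
    finally show ?thesis by simp
  qed
qed

lemma Lop_diff: "cpoly f \<Longrightarrow> cpoly g \<Longrightarrow> Lop k (\<lambda>x. f x - g x) x = Lop k f x - Lop k g x"
  by (cases k rule: Lop_cases) (simp_all add: partial_diff algebra_simps)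

lemma Lop_add: "cpoly f \<Longrightarrow> cpoly g \<Longrightarrow> Lop k (\<lambda>x. f x + g x) x = Lop k f x + Lop k g x"
  by (cases k rule: Lop_cases) (simp_all add: partial_add algebra_simps)

lemma Lop_const: "Lop k (\<lambda>x. c) x = 0"
  by (cases k rule: Lop_cases) (simp_all add: partial_const)

lemma Lop_cmult: "cpoly f \<Longrightarrow> Lop k (\<lambda>x. c * f x) x = c * Lop k f x"
  by (simp add: Lop_mult Lop_const cpoly_intros)

lemma Lop_sum:
  "(\<And>i. i \<in> I \<Longrightarrow> cpoly (f i)) \<Longrightarrow> Lop k (\<lambda>x. \<Sum>i\<in>I. f i x) x = (\<Sum>i\<in>I. Lop k (f i) x)"
  by (induction I rule: infinite_finite_induct) (auto simp: Lop_const Lop_add cpoly_intros)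

lemma Lop_norm_sq: "Lop k (\<lambda>x. \<Sum>a\<in>UNIV. crd x a * crd x a) x = 0"
  by (cases k rule: Lop_cases)
    (simp_all add: sum_3 partial_add partial_mult partial_coord cpoly_intros)

text \<open>Rotation operators annihilate the squared radius, and on the sphere that radius is 1, so
  it disappears from the harmonic splitting of \<open>crd x i * p x\<close>.\<close>

lemma solid_curl_coord_mult:
  assumes p: "cpoly p" and x: "x \<in> sphere 0 1"
  shows "solid_curl (\<lambda>x. crd x i * p x) x =
    solid_curl (raise_harmonic l i p) x + (1 / of_nat (2 * l + 1)) *s solid_curl (partial i p) x"
proof -
  let ?n = "\<lambda>x::real^3. \<Sum>a\<in>UNIV. crd x a * crd x a"
  let ?q = "\<lambda>x. 1 / of_nat (2 * l + 1) * partial i p x"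
  have n: "cpoly ?n" "cpoly ?q" by (intro cpoly_intros cpoly_partial p)+
  have "?n x = 1" using sphere_sum_squares[OF x] by (simp add: sum_3)
  then have "Lop k (raise_harmonic l i p) x = Lop k (\<lambda>x. crd x i * p x) x
      - 1 / of_nat (2 * l + 1) * Lop k (partial i p) x" for k
    unfolding raise_harmonic_def[abs_def]
    by (subst Lop_diff, intro cpoly_intros p, intro cpoly_intros cpoly_partial p)
       (simp only: Lop_mult[OF n] Lop_norm_sq Lop_cmult[OF cpoly_partial[OF p]], simp)
  then show ?thesis by (simp add: vec_eq_iff solid_curl_nth)
qed

text \<open>
  The Helmholtz decomposition of the field \<open>p (x \<times> e\<^sub>i)\<close>: its two potentials are, up to factors,
  \<open>(x \<times> \<nabla> p)\<^sub>i\<close> and a combination of the two harmonic components of \<open>x\<^sub>i p\<close>.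
\<close>

lemma rot_field_decomposition:
  assumes p: "solid_harmonic (Suc l) p" and x: "x \<in> sphere 0 1"
  shows "(of_nat (Suc l * Suc (Suc l)) * p x) *s (Q_mat x *v axis i 1) =
    solid_grad (Suc l) (Lop i p) x + of_nat (Suc l) *s solid_curl (\<lambda>x. crd x i * p x) x
    - solid_curl (partial i p) x"
proof -
  note c = solid_harmonicD(1)[OF p]
  define X where "X = (\<lambda>i. crd x i)"
  define P where "P = (\<lambda>i. partial i p x)"
  define h where "h = (\<lambda>i j. partial i (partial j p) x)"
  define L where "L = (of_nat (Suc l) :: complex)"
  have sym: "h 2 1 = h 1 2" "h 3 1 = h 1 3" "h 3 2 = h 2 3"
    using partial_commute[OF c] by (simp_all add: h_def)
  have e1: "X 1 * P 1 + X 2 * P 2 + X 3 * P 3 = L * p x"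
    using solid_euler[OF p, of x] by (simp only: sum_3 X_def P_def L_def)
  have e2: "X 1 * h 1 1 + X 2 * h 1 2 + X 3 * h 1 3 = (L - 1) * P 1"
    "X 1 * h 1 2 + X 2 * h 2 2 + X 3 * h 2 3 = (L - 1) * P 2"
    "X 1 * h 1 3 + X 2 * h 2 3 + X 3 * h 3 3 = (L - 1) * P 3"
    using solid_euler_partial[OF p, of x 1] solid_euler_partial[OF p, of x 2]
      solid_euler_partial[OF p, of x 3] sym
    by (simp_all only: sum_3 X_def P_def h_def L_def)
  have tr: "h 1 1 + h 2 2 + h 3 3 = 0"
    using solid_harmonicD(3)[OF p, of x] by (simp add: laplacian_def sum_3 h_def)
  have n: "X 1 * X 1 + X 2 * X 2 + X 3 * X 3 = 1"
    using sphere_sum_squares[OF x] by (simp add: X_def)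
  have A: "(of_nat (Suc l * Suc (Suc l)) :: complex) = L * (L + 1)"
    by (simp add: L_def algebra_simps)
  define M where "M = (\<lambda>i k. L * (L + 1) * p x * (Q_mat x *v axis i 1) $ k)"
  define T where "T = (\<lambda>i k. partial k (Lop i p) x - L * Lop i p x * X k
      + L * Lop k (\<lambda>x. crd x i * p x) x - Lop k (partial i p) x)"
  have M: "M 1 1 = 0" "M 2 2 = 0" "M 3 3 = 0"
    "M 1 2 = L * (L + 1) * p x * X 3" "M 1 3 = - (L * (L + 1) * p x * X 2)"
    "M 2 1 = - (L * (L + 1) * p x * X 3)" "M 2 3 = L * (L + 1) * p x * X 1"
    "M 3 1 = L * (L + 1) * p x * X 2" "M 3 2 = - (L * (L + 1) * p x * X 1)"
    by (simp_all add: M_def X_def Q_mat_def matrix_vector_mult_def sum_3 axis_def Let_def)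
  have T: "T i k = partial k (Lop i p) x - L * Lop i p x * X k
      + L * Lop k (\<lambda>x. crd x i * p x) x - Lop k (partial i p) x" for i k
    by (simp add: T_def)
  note expand = T Lop_fun Lop_simps
  have "T 1 1 = (X 2 * h 1 3 - X 3 * h 1 2) - L * (X 2 * P 3 - X 3 * P 2) * X 1
      + L * (X 2 * (X 1 * P 3) - X 3 * (X 1 * P 2)) - (X 2 * h 1 3 - X 3 * h 1 2)"
    "T 2 2 = (X 3 * h 1 2 - X 1 * h 2 3) - L * (X 3 * P 1 - X 1 * P 3) * X 2
      + L * (X 3 * (X 2 * P 1) - X 1 * (X 2 * P 3)) - (X 3 * h 1 2 - X 1 * h 2 3)"
    "T 3 3 = (X 1 * h 2 3 - X 2 * h 1 3) - L * (X 1 * P 2 - X 2 * P 1) * X 3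
      + L * (X 1 * (X 3 * P 2) - X 2 * (X 3 * P 1)) - (X 1 * h 2 3 - X 2 * h 1 3)"
    "T 1 2 = (P 3 + X 2 * h 2 3 - X 3 * h 2 2) - L * (X 2 * P 3 - X 3 * P 2) * X 2
      + L * (X 3 * (p x + X 1 * P 1) - X 1 * (X 1 * P 3)) - (X 3 * h 1 1 - X 1 * h 1 3)"
    "T 1 3 = (X 2 * h 3 3 - P 2 - X 3 * h 2 3) - L * (X 2 * P 3 - X 3 * P 2) * X 3
      + L * (X 1 * (X 1 * P 2) - X 2 * (p x + X 1 * P 1)) - (X 1 * h 1 2 - X 2 * h 1 1)"
    "T 2 1 = (X 3 * h 1 1 - P 3 - X 1 * h 1 3) - L * (X 3 * P 1 - X 1 * P 3) * X 1
      + L * (X 2 * (X 2 * P 3) - X 3 * (p x + X 2 * P 2)) - (X 2 * h 2 3 - X 3 * h 2 2)"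
    "T 2 3 = (P 1 + X 3 * h 1 3 - X 1 * h 3 3) - L * (X 3 * P 1 - X 1 * P 3) * X 3
      + L * (X 1 * (p x + X 2 * P 2) - X 2 * (X 2 * P 1)) - (X 1 * h 2 2 - X 2 * h 1 2)"
    "T 3 1 = (P 2 + X 1 * h 1 2 - X 2 * h 1 1) - L * (X 1 * P 2 - X 2 * P 1) * X 1
      + L * (X 2 * (p x + X 3 * P 3) - X 3 * (X 3 * P 2)) - (X 2 * h 3 3 - X 3 * h 2 3)"
    "T 3 2 = (X 1 * h 2 2 - P 1 - X 2 * h 1 2) - L * (X 1 * P 2 - X 2 * P 1) * X 2
      + L * (X 3 * (X 3 * P 1) - X 1 * (p x + X 3 * P 3)) - (X 3 * h 1 3 - X 1 * h 3 3)"
    unfolding expand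
    by (simp_all add: partial_diff partial_mult partial_coord cpoly_intros cpoly_partial c
        X_def P_def h_def sym[unfolded h_def])
  note T = this
  \<comment> \<open>The diagonal entries cancel identically; the off-diagonal ones require Euler's
    identities for \<open>p\<close> and its gradient, harmonicity, and the equation of the
    sphere.\<close>
  have "M 1 1 = T 1 1" "M 2 2 = T 2 2" "M 3 3 = T 3 3"
    unfolding M T by (simp_all add: algebra_simps)
  moreover have "M 1 2 = T 1 2" unfolding M T using e1 e2 tr n by algebra
  moreover have "M 1 3 = T 1 3" unfolding M T using e1 e2 tr n by algebra
  moreover have "M 2 1 = T 2 1" unfolding M T using e1 e2 tr n by algebra
  moreover have "M 2 3 = T 2 3" unfolding M T using e1 e2 tr n by algebra
  moreover have "M 3 1 = T 3 1" unfolding M T using e1 e2 tr n by algebra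
  moreover have "M 3 2 = T 3 2" unfolding M T using e1 e2 tr n by algebra
  ultimately have "M i k = T i k" for k
    using exhaust_3[of i] exhaust_3[of k] by auto
  then show ?thesis
    unfolding A unfolding L_def[symmetric]
    by (simp add: vec_eq_iff solid_curl_nth solid_grad_nth M_def T_def X_def) (simp add: L_def)
qed

section \<open>Square-integrable fields\<close>

lemma norm_cdot_le: "norm (a \<bullet>\<^sub>C b) \<le> norm a * norm b"
proof -
  have "norm (a \<bullet>\<^sub>C b) \<le> (\<Sum>i\<in>UNIV. \<bar>norm (a $ i)\<bar> * \<bar>norm (b $ i)\<bar>)"
    unfolding cdot_def by (rule order_trans[OF norm_sum]) (simp add: norm_mult)
  also have "\<dots> \<le> norm a * norm b"
    unfolding norm_vec_def by (rule L2_set_mult_ineq)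
  finally show ?thesis .
qed

lemma cdot_add_left: "(a + b) \<bullet>\<^sub>C c = a \<bullet>\<^sub>C c + b \<bullet>\<^sub>C c"
  and cdot_add_right: "c \<bullet>\<^sub>C (a + b) = c \<bullet>\<^sub>C a + c \<bullet>\<^sub>C b"
  and cdot_diff_left: "(a - b) \<bullet>\<^sub>C c = a \<bullet>\<^sub>C c - b \<bullet>\<^sub>C c"
  and cdot_diff_right: "c \<bullet>\<^sub>C (a - b) = c \<bullet>\<^sub>C a - c \<bullet>\<^sub>C b"
  and cdot_mult_left: "(k *s a) \<bullet>\<^sub>C c = k * (a \<bullet>\<^sub>C c)"
  and cdot_mult_right: "c \<bullet>\<^sub>C (k *s a) = cnj k * (c \<bullet>\<^sub>C a)"
  and cdot_zero_left: "0 \<bullet>\<^sub>C c = 0"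
  and cdot_zero_right: "c \<bullet>\<^sub>C 0 = 0"
  by (simp_all add: cdot_3 algebra_simps)

lemma measurable_vec_nth_complex:
  fixes f :: "'a \<Rightarrow> complex^3"
  assumes "f \<in> borel_measurable M"
  shows "(\<lambda>x. f x $ i) \<in> borel_measurable M"
  by (rule measurable_compose[OF assms borel_measurable_continuous_onI]) (intro continuous_intros)

lemma measurable_vec_lambda_complex:
  fixes f :: "'a \<Rightarrow> complex^3"
  assumes "\<And>i. (\<lambda>x. f x $ i) \<in> borel_measurable M"
  shows "f \<in> borel_measurable M"
proof -
  have m: "(\<lambda>x. axis i (f x $ i) :: complex^3) \<in> borel_measurable M" for i
  proof (rule measurable_compose[OF assms borel_measurable_continuous_onI])
    show "continuous_on UNIV (\<lambda>c. axis i c :: complex^3)"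
      unfolding axis_def
    proof (rule continuous_on_vec_lambda)
      show "continuous_on UNIV (\<lambda>c::complex. if j = i then c else 0)" for j
        by (cases "j = i") auto
    qed
  qed
  have eq: "f = (\<lambda>x. \<Sum>i\<in>UNIV. axis i (f x $ i))"
    by (auto simp: fun_eq_iff vec_eq_iff sum_3 forall_3 axis_def)
  show ?thesis by (subst eq) (intro borel_measurable_sum m)
qed

lemma measurable_cdot:
  assumes "f \<in> borel_measurable M" "g \<in> borel_measurable M"
  shows "(\<lambda>x. f x \<bullet>\<^sub>C g x) \<in> borel_measurable M"
proof -
  have "(\<lambda>x. cnj (g x $ i)) \<in> borel_measurable M" for i
    by (rule measurable_compose[OF measurable_vec_nth_complex[OF assms(2)] borel_measurable_continuous_onI])
       (intro continuous_intros)
  then show ?thesis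
    unfolding cdot_def
    by (intro borel_measurable_sum borel_measurable_times measurable_vec_nth_complex[OF assms(1)])
qed

lemma measurable_vector_mult:
  fixes f :: "'a \<Rightarrow> complex" and g :: "'a \<Rightarrow> complex^3"
  assumes "f \<in> borel_measurable M" "g \<in> borel_measurable M"
  shows "(\<lambda>x. f x *s g x) \<in> borel_measurable M"
  by (rule measurable_vec_lambda_complex)
     (simp, intro borel_measurable_times assms(1) measurable_vec_nth_complex[OF assms(2)])

lemma norm_vector_mult: "norm (c *s (v::complex^3)) = norm c * norm v"
  by (simp add: norm_vec_def L2_set_def norm_mult power_mult_distrib real_sqrt_mult flip: sum_distrib_left)

definition L2sq :: "(real^3 \<Rightarrow> complex^3) \<Rightarrow> ennreal" where
  "L2sq f = (\<integral>\<^sup>+x. ennreal ((norm (f x))\<^sup>2) \<partial>S2)"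

definition L2_field :: "(real^3 \<Rightarrow> complex^3) \<Rightarrow> bool" where
  "L2_field f \<longleftrightarrow> f \<in> borel_measurable S2 \<and> L2sq f < \<infinity>"

lemma L2_tangent_L2_field: "L2_tangent f \<Longrightarrow> L2_field f"
  by (simp add: L2_tangent_def L2_field_def L2sq_def)

lemma L2_field_iff: "L2_field f \<longleftrightarrow> f \<in> borel_measurable S2 \<and> integrable S2 (\<lambda>x. (norm (f x))\<^sup>2)"
  by (auto simp: L2_field_def L2sq_def integrable_iff_bounded)

lemma L2_field_add:
  assumes "L2_field f" "L2_field g"
  shows "L2_field (\<lambda>x. f x + g x)"
  unfolding L2_field_iff
proof
  have m: "f \<in> borel_measurable S2" "g \<in> borel_measurable S2" using assms by (simp_all add: L2_field_iff)
  then show s: "(\<lambda>x. f x + g x) \<in> borel_measurable S2" by simp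
  have i: "integrable S2 (\<lambda>x. 2 * (norm (f x))\<^sup>2 + 2 * (norm (g x))\<^sup>2)"
    using assms by (simp add: L2_field_iff)
  show "integrable S2 (\<lambda>x. (norm (f x + g x))\<^sup>2)"
  proof (rule Bochner_Integration.integrable_bound[OF i])
    show "(\<lambda>x. (norm (f x + g x))\<^sup>2) \<in> borel_measurable S2" using s by simp
    have "(norm (f x + g x))\<^sup>2 \<le> 2 * (norm (f x))\<^sup>2 + 2 * (norm (g x))\<^sup>2" for x
    proof -
      have "(norm (f x + g x))\<^sup>2 \<le> (norm (f x) + norm (g x))\<^sup>2"
        by (intro power_mono norm_triangle_ineq) simp
      also have "\<dots> \<le> 2 * (norm (f x))\<^sup>2 + 2 * (norm (g x))\<^sup>2"
        using sum_squares_bound[of "norm (f x)" "norm (g x)"] by (simp add: power2_sum)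
      finally show ?thesis .
    qed
    then show "AE x in S2. norm ((norm (f x + g x))\<^sup>2) \<le> norm (2 * (norm (f x))\<^sup>2 + 2 * (norm (g x))\<^sup>2)"
      by simp
  qed
qed

lemma L2_field_mult:
  assumes "L2_field f"
  shows "L2_field (\<lambda>x. c *s f x)"
proof -
  have m: "(\<lambda>x. c *s f x) \<in> borel_measurable S2"
    using assms by (intro measurable_vector_mult) (auto simp: L2_field_def)
  have "integrable S2 (\<lambda>x. (norm c)\<^sup>2 * (norm (f x))\<^sup>2)"
    using assms by (simp add: L2_field_iff)
  with m show ?thesis by (simp add: L2_field_iff norm_vector_mult power_mult_distrib)
qed

lemma L2_field_zero: "L2_field (\<lambda>x. 0)"
  by (simp add: L2_field_def L2sq_def)

lemma L2_field_sum: "(\<And>i. i \<in> I \<Longrightarrow> L2_field (f i)) \<Longrightarrow> L2_field (\<lambda>x. \<Sum>i\<in>I. f i x)"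
  by (induction I rule: infinite_finite_induct) (auto intro: L2_field_zero L2_field_add)

lemma L2_field_diff:
  assumes "L2_field f" "L2_field g"
  shows "L2_field (\<lambda>x. f x - g x)"
proof -
  have "(\<lambda>x. f x - g x) = (\<lambda>x. f x + (- 1) *s g x)" by (auto simp: vec_eq_iff)
  then show ?thesis using L2_field_add[OF assms(1) L2_field_mult[OF assms(2), of "-1"]] by simp
qed

text \<open>The squared norm is again a polynomial and hence integrable over the sphere.\<close>

lemma L2_field_cpoly:
  assumes "\<And>k. cpoly (\<lambda>x. f x $ k)"
  shows "L2_field f"
  unfolding L2_field_iff
proof
  show m: "f \<in> borel_measurable S2"
    by (intro measurable_vec_lambda_complex cpoly_measurable_S2 assms)
  have "norm (f x) ^ 2 = (\<Sum>k\<in>UNIV. (norm (f x $ k))\<^sup>2)" for x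
    by (simp add: norm_vec_def L2_set_def sum_nonneg)
  then have eq: "complex_of_real ((norm (f x))\<^sup>2) = (\<Sum>k\<in>UNIV. f x $ k * cnj (f x $ k))" for x
    by (simp only: of_real_sum complex_norm_square)
  have "integrable S2 (\<lambda>x. complex_of_real ((norm (f x))\<^sup>2))"
    unfolding eq by (intro cpoly_integrable cpoly_intros assms)
  then show "integrable S2 (\<lambda>x. (norm (f x))\<^sup>2)"
    using integrable_Re by fastforce
qed

lemma L2_field_solid_curl: "cpoly H \<Longrightarrow> L2_field (solid_curl H)"
  by (intro L2_field_cpoly) (simp add: solid_curl_nth cpoly_Lop)

lemma L2_field_solid_grad: "cpoly H \<Longrightarrow> L2_field (solid_grad l H)"
  by (intro L2_field_cpoly) (simp add: solid_grad_nth cpoly_intros cpoly_partial)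

lemma L2_field_cong:
  assumes "\<And>x. x \<in> sphere 0 1 \<Longrightarrow> f x = g x"
  shows "L2_field f \<longleftrightarrow> L2_field g"
proof -
  have "f \<in> borel_measurable S2 \<longleftrightarrow> g \<in> borel_measurable S2"
    by (rule measurable_cong) (simp add: space_S2 assms)
  moreover have "L2sq f = L2sq g"
    unfolding L2sq_def by (rule nn_integral_cong) (simp add: space_S2 assms)
  ultimately show ?thesis by (simp add: L2_field_def)
qed

lemma integrable_cdot:
  assumes "L2_field f" "L2_field g"
  shows "integrable S2 (\<lambda>x. f x \<bullet>\<^sub>C g x)"
proof (rule Bochner_Integration.integrable_bound)
  show "integrable S2 (\<lambda>x. (norm (f x))\<^sup>2 + (norm (g x))\<^sup>2)"
    using assms by (simp add: L2_field_iff)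
  show "(\<lambda>x. f x \<bullet>\<^sub>C g x) \<in> borel_measurable S2"
    using assms by (intro measurable_cdot) (auto simp: L2_field_def)
  have "norm (f x \<bullet>\<^sub>C g x) \<le> (norm (f x))\<^sup>2 + (norm (g x))\<^sup>2" for x
    using norm_cdot_le[of "f x" "g x"] sum_squares_bound[of "norm (f x)" "norm (g x)"]
      mult_nonneg_nonneg[OF norm_ge_zero[of "f x"] norm_ge_zero[of "g x"]] by linarith
  then show "AE x in S2. norm (f x \<bullet>\<^sub>C g x) \<le> norm ((norm (f x))\<^sup>2 + (norm (g x))\<^sup>2)"
    by simp
qed

lemma field_inner_add_right:
  "L2_field f \<Longrightarrow> L2_field g \<Longrightarrow> L2_field h \<Longrightarrow>
     field_inner f (\<lambda>x. g x + h x) = field_inner f g + field_inner f h"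
  by (simp add: field_inner_def cdot_add_right integrable_cdot)

lemma field_inner_diff_right:
  "L2_field f \<Longrightarrow> L2_field g \<Longrightarrow> L2_field h \<Longrightarrow>
     field_inner f (\<lambda>x. g x - h x) = field_inner f g - field_inner f h"
  by (simp add: field_inner_def cdot_diff_right integrable_cdot)

lemma field_inner_diff_left:
  "L2_field f \<Longrightarrow> L2_field g \<Longrightarrow> L2_field h \<Longrightarrow>
     field_inner (\<lambda>x. f x - g x) h = field_inner f h - field_inner g h"
  by (simp add: field_inner_def cdot_diff_left integrable_cdot)

lemma field_inner_mult_right: "field_inner f (\<lambda>x. c *s g x) = cnj c * field_inner f g"
  by (simp add: field_inner_def cdot_mult_right)

lemma field_inner_mult_left: "field_inner (\<lambda>x. c *s f x) g = c * field_inner f g"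
  by (simp add: field_inner_def cdot_mult_left)

lemma field_inner_sum_right:
  assumes "L2_field f" "\<And>i. i \<in> I \<Longrightarrow> L2_field (g i)"
  shows "field_inner f (\<lambda>x. \<Sum>i\<in>I. g i x) = (\<Sum>i\<in>I. field_inner f (g i))"
  using assms(2)
proof (induction I rule: infinite_finite_induct)
  case (insert i I)
  then show ?case by (simp add: field_inner_add_right assms(1) L2_field_sum)
qed (simp_all add: field_inner_def cdot_zero_right)

lemma field_inner_sum_left:
  assumes "L2_field f" "\<And>i. i \<in> I \<Longrightarrow> L2_field (g i)"
  shows "field_inner (\<lambda>x. \<Sum>i\<in>I. g i x) f = (\<Sum>i\<in>I. field_inner (g i) f)"
proof -
  have "field_inner (\<lambda>x. \<Sum>i\<in>I. g i x) f = cnj (field_inner f (\<lambda>x. \<Sum>i\<in>I. g i x))"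
    by (rule field_inner_commute)
  also have "\<dots> = (\<Sum>i\<in>I. cnj (field_inner f (g i)))"
    by (simp only: field_inner_sum_right[OF assms] cnj_sum)
  also have "\<dots> = (\<Sum>i\<in>I. field_inner (g i) f)"
    by (intro sum.cong refl field_inner_commute[symmetric])
  finally show ?thesis .
qed

lemma field_inner_diff_sum_right:
  assumes "L2_field f" "L2_field g" and h: "\<And>i. i \<in> I \<Longrightarrow> L2_field (h i)"
  shows "field_inner f (\<lambda>x. g x - (\<Sum>i\<in>I. c i *s h i x)) =
    field_inner f g - (\<Sum>i\<in>I. cnj (c i) * field_inner f (h i))"
proof -
  have h': "L2_field (\<lambda>x. c i *s h i x)" if "i \<in> I" for i
    using h[OF that] by (rule L2_field_mult)
  have "field_inner f (\<lambda>x. \<Sum>i\<in>I. c i *s h i x) = (\<Sum>i\<in>I. field_inner f (\<lambda>x. c i *s h i x))"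
    by (rule field_inner_sum_right[OF assms(1) h'])
  then show ?thesis
    by (simp only: field_inner_diff_right[OF assms(1,2) L2_field_sum[OF h']] field_inner_mult_right)
qed

lemma field_inner_self: "field_inner f f = complex_of_real (\<integral>x. (norm (f x))\<^sup>2 \<partial>S2)"
  unfolding field_inner_def cdot_self by (rule integral_complex_of_real)

lemma L2sq_eq: "L2_field f \<Longrightarrow> L2sq f = ennreal (Re (field_inner f f))"
  by (simp add: field_inner_self L2sq_def nn_integral_eq_integral L2_field_iff)

lemma field_inner_self_eq_0:
  assumes "L2_field f" "field_inner f f = 0"
  shows "AE x in S2. f x = 0"
proof -
  have "(\<integral>x. (norm (f x))\<^sup>2 \<partial>S2) = 0" using assms(2) by (simp add: field_inner_self)
  then have "AE x in S2. (norm (f x))\<^sup>2 = 0"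
    using assms(1) by (subst integral_nonneg_eq_0_iff_AE[symmetric]) (auto simp: L2_field_iff)
  then show ?thesis by simp
qed

lemma field_inner_AE_0_right:
  assumes "L2_field f" "L2_field g" "AE x in S2. g x = 0"
  shows "field_inner f g = 0"
  unfolding field_inner_def
proof (rule integral_eq_zero_AE)
  show "AE x in S2. f x \<bullet>\<^sub>C g x = 0" using assms(3) by eventually_elim (simp add: cdot_zero_right)
qed

lemma field_inner_cong_AE:
  assumes "f \<in> borel_measurable S2" "f' \<in> borel_measurable S2" "g \<in> borel_measurable S2"
    "AE x in S2. f x = f' x"
  shows "field_inner f g = field_inner f' g"
  unfolding field_inner_def
  by (rule integral_cong_AE) (use assms measurable_cdot in auto)

section \<open>Orthonormality and completeness of the vector harmonics\<close>

lemma scalar_inner_cong: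
  "(\<And>x. x \<in> sphere 0 1 \<Longrightarrow> f x = f' x) \<Longrightarrow> (\<And>x. x \<in> sphere 0 1 \<Longrightarrow> g x = g' x) \<Longrightarrow>
     scalar_inner f g = scalar_inner f' g'"
  unfolding scalar_inner_def by (rule Bochner_Integration.integral_cong) (auto simp: space_S2)

lemma spherical_harmonic_solid:
  assumes "spherical_harmonic l f"
  obtains H where "solid_harmonic l H" "\<And>x. x \<in> sphere 0 1 \<Longrightarrow> f x = H x"
  using assms by (auto simp: spherical_harmonic_def solid_harmonic_def cpoly_iff_polynomial)

locale harmonic_basis =
  fixes Y :: "nat \<Rightarrow> int \<Rightarrow> real^3 \<Rightarrow> complex"
  assumes basis: "spherical_harmonic_basis Y"
begin

text \<open>\<open>Y l m\<close> is determined on the sphere only; a polynomial agreeing with it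
  there admits differential identities in the whole space.\<close>

definition SH :: "nat \<Rightarrow> int \<Rightarrow> real^3 \<Rightarrow> complex" where
  "SH l m = (SOME H. solid_harmonic l H \<and> (\<forall>x\<in>sphere 0 1. Y l m x = H x))"

lemma SH:
  assumes "m \<in> {-int l..int l}"
  shows "solid_harmonic l (SH l m)" and "\<And>x. x \<in> sphere 0 1 \<Longrightarrow> Y l m x = SH l m x"
proof -
  have "spherical_harmonic l (Y l m)"
    using basis assms by (auto simp: spherical_harmonic_basis_def)
  then have "\<exists>H. solid_harmonic l H \<and> (\<forall>x\<in>sphere 0 1. Y l m x = H x)"
    using spherical_harmonic_solid by metis
  from someI_ex[OF this]
  show "solid_harmonic l (SH l m)" "\<And>x. x \<in> sphere 0 1 \<Longrightarrow> Y l m x = SH l m x"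
    by (auto simp: SH_def)
qed

lemma SH_orthonormal:
  assumes "m \<in> {-int l..int l}" "m' \<in> {-int l'..int l'}"
  shows "scalar_inner (SH l m) (SH l' m') = (if l = l' \<and> m = m' then 1 else 0)"
proof -
  have "scalar_inner (SH l m) (SH l' m') = scalar_inner (Y l m) (Y l' m')"
    by (rule scalar_inner_cong) (simp_all add: SH(2)[OF assms(1)] SH(2)[OF assms(2)])
  then show ?thesis using basis assms by (auto simp: spherical_harmonic_basis_def)
qed

lemma vsh_y_SH:
  assumes "m \<in> {-int l..int l}" "x \<in> sphere 0 1"
  shows "vsh_y Y l m x = complex_of_real (1 / sqrt (lam l)) *s solid_curl (SH l m) x"
proof -
  have "surf_curl (Y l m) x = solid_curl (SH l m) x"
    using SH[OF assms(1)] assms(2) by (intro surf_curl_solid)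
  then show ?thesis by (simp add: vsh_y_def vec_eq_iff scaleR_complex divide_inverse)
qed

lemma vsh_z_SH:
  assumes "m \<in> {-int l..int l}" "x \<in> sphere 0 1"
  shows "vsh_z Y l m x = complex_of_real (1 / sqrt (lam l)) *s solid_grad l (SH l m) x"
proof -
  have "surf_grad (Y l m) x = solid_grad l (SH l m) x"
    using SH[OF assms(1)] assms(2) by (intro surf_grad_solid)
  then show ?thesis by (simp add: vsh_z_def vec_eq_iff scaleR_complex divide_inverse)
qed

lemma L2_field_vsh:
  assumes "m \<in> {-int l..int l}"
  shows "L2_field (vsh_y Y l m)" "L2_field (vsh_z Y l m)"
proof -
  note c = solid_harmonicD(1)[OF SH(1)[OF assms]]
  let ?c = "complex_of_real (1 / sqrt (lam l))"
  have "L2_field (vsh_y Y l m) \<longleftrightarrow> L2_field (\<lambda>x. ?c *s solid_curl (SH l m) x)"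
    by (rule L2_field_cong) (rule vsh_y_SH[OF assms])
  then show "L2_field (vsh_y Y l m)" using L2_field_mult[OF L2_field_solid_curl[OF c]] by blast
  have "L2_field (vsh_z Y l m) \<longleftrightarrow> L2_field (\<lambda>x. ?c *s solid_grad l (SH l m) x)"
    by (rule L2_field_cong) (rule vsh_z_SH[OF assms])
  then show "L2_field (vsh_z Y l m)" using L2_field_mult[OF L2_field_solid_grad[OF c]] by blast
qed

lemma coeff_y_SH:
  "m \<in> {-int l..int l} \<Longrightarrow>
    coeff_y Y l m F = complex_of_real (1 / sqrt (lam l)) * field_inner F (solid_curl (SH l m))"
  unfolding coeff_y_def using field_inner_mult_right[of F "complex_of_real (1 / sqrt (lam l))" "solid_curl (SH l m)"]
  by (subst field_inner_cong[where f'=F and g'="\<lambda>x. complex_of_real (1 / sqrt (lam l)) *s solid_curl (SH l m) x"])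
     (auto simp: vsh_y_SH)

lemma coeff_z_SH:
  "m \<in> {-int l..int l} \<Longrightarrow>
    coeff_z Y l m F = complex_of_real (1 / sqrt (lam l)) * field_inner F (solid_grad l (SH l m))"
  unfolding coeff_z_def using field_inner_mult_right[of F "complex_of_real (1 / sqrt (lam l))" "solid_grad l (SH l m)"]
  by (subst field_inner_cong[where f'=F and g'="\<lambda>x. complex_of_real (1 / sqrt (lam l)) *s solid_grad l (SH l m) x"])
     (auto simp: vsh_z_SH)

lemma lam_pos: "1 \<le> l \<Longrightarrow> 0 < lam l"
  by (simp add: lam_def)

lemma vsh_orthonormal:
  assumes l: "1 \<le> l" "1 \<le> l'" and m: "m \<in> {-int l..int l}" "m' \<in> {-int l'..int l'}"
  shows "field_inner (vsh_y Y l m) (vsh_y Y l' m') = (if l = l' \<and> m = m' then 1 else 0)"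
    and "field_inner (vsh_z Y l m) (vsh_z Y l' m') = (if l = l' \<and> m = m' then 1 else 0)"
    and "field_inner (vsh_y Y l m) (vsh_z Y l' m') = 0"
    and "field_inner (vsh_z Y l m) (vsh_y Y l' m') = 0"
proof -
  let ?c = "\<lambda>l. complex_of_real (1 / sqrt (lam l))"
  have c: "?c l * ?c l * complex_of_real (lam l) = 1" if "1 \<le> l" for l
  proof -
    have "1 / sqrt (lam l) * (1 / sqrt (lam l)) * lam l = 1"
      using lam_pos[OF that] by simp
    from arg_cong[OF this, of complex_of_real] show ?thesis by (simp only: of_real_mult of_real_1)
  qed
  note S = SH(1)[OF m(1)] SH(1)[OF m(2)]
  have "field_inner (vsh_y Y l m) (vsh_y Y l' m') = field_inner (\<lambda>x. ?c l *s solid_curl (SH l m) x) (\<lambda>x. ?c l' *s solid_curl (SH l' m') x)"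
    by (rule field_inner_cong) (simp only: vsh_y_SH[OF m(1)] vsh_y_SH[OF m(2)])
  also have "\<dots> = ?c l * ?c l' * complex_of_real (lam l') * scalar_inner (SH l m) (SH l' m')"
    by (simp only: field_inner_mult_left field_inner_mult_right solid_curl_inner[OF S] complex_cnj_complex_of_real mult.assoc)
  also have "\<dots> = (if l = l' \<and> m = m' then 1 else 0)"
    unfolding SH_orthonormal[OF m] using c[OF l(2)] by auto
  finally show "field_inner (vsh_y Y l m) (vsh_y Y l' m') = (if l = l' \<and> m = m' then 1 else 0)" .
  have "field_inner (vsh_z Y l m) (vsh_z Y l' m') = field_inner (\<lambda>x. ?c l *s solid_grad l (SH l m) x) (\<lambda>x. ?c l' *s solid_grad l' (SH l' m') x)"
    by (rule field_inner_cong) (simp only: vsh_z_SH[OF m(1)] vsh_z_SH[OF m(2)])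
  also have "\<dots> = ?c l * ?c l' * complex_of_real (lam l') * scalar_inner (SH l m) (SH l' m')"
    by (simp only: field_inner_mult_left field_inner_mult_right solid_grad_inner[OF S] complex_cnj_complex_of_real mult.assoc)
  also have "\<dots> = (if l = l' \<and> m = m' then 1 else 0)"
    unfolding SH_orthonormal[OF m] using c[OF l(2)] by auto
  finally show "field_inner (vsh_z Y l m) (vsh_z Y l' m') = (if l = l' \<and> m = m' then 1 else 0)" .
  have "field_inner (vsh_y Y l m) (vsh_z Y l' m') = field_inner (\<lambda>x. ?c l *s solid_curl (SH l m) x) (\<lambda>x. ?c l' *s solid_grad l' (SH l' m') x)"
    by (rule field_inner_cong) (simp only: vsh_y_SH[OF m(1)] vsh_y_SH[OF m(2)] vsh_z_SH[OF m(1)] vsh_z_SH[OF m(2)])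
  then show "field_inner (vsh_y Y l m) (vsh_z Y l' m') = 0"
    by (simp only: field_inner_mult_left field_inner_mult_right solid_curl_grad_inner[OF S] mult_zero_right)
  have "field_inner (vsh_y Y l' m') (vsh_z Y l m) = field_inner (\<lambda>x. ?c l' *s solid_curl (SH l' m') x) (\<lambda>x. ?c l *s solid_grad l (SH l m) x)"
    by (rule field_inner_cong) (simp only: vsh_y_SH[OF m(1)] vsh_y_SH[OF m(2)] vsh_z_SH[OF m(1)] vsh_z_SH[OF m(2)])
  then have "field_inner (vsh_y Y l' m') (vsh_z Y l m) = 0"
    by (simp only: field_inner_mult_left field_inner_mult_right solid_curl_grad_inner[OF S(2,1)] mult_zero_right)
  then show "field_inner (vsh_z Y l m) (vsh_y Y l' m') = 0"
    using field_inner_commute[of "vsh_z Y l m" "vsh_y Y l' m'"] by simp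
qed

text \<open>When all coefficients vanish, the sequence in the completeness clause of the basis is
  constant, so its limit 0 is the squared norm of \<open>g\<close>.\<close>

lemma nn_integral_eq_0_if_orthogonal:
  assumes g: "g \<in> borel_measurable S2" "(\<integral>\<^sup>+x. ennreal ((norm (g x))\<^sup>2) \<partial>S2) < \<infinity>"
    and 0: "\<And>l m. m \<in> {-int l..int l} \<Longrightarrow> scalar_inner g (Y l m) = 0"
  shows "AE x in S2. g x = 0"
proof -
  have "(\<lambda>N. \<integral>\<^sup>+x. ennreal ((norm (g x - (\<Sum>l\<le>N. \<Sum>m=-int l..int l. scalar_inner g (Y l m) * Y l m x)))\<^sup>2) \<partial>S2)
      \<longlonglongrightarrow> 0"
    using basis g by (auto simp: spherical_harmonic_basis_def)
  moreover have "(\<Sum>l\<le>N. \<Sum>m=-int l..int l. scalar_inner g (Y l m) * Y l m x) = 0" for N x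
    using 0 by (intro sum.neutral ballI) simp
  ultimately have "(\<lambda>N::nat. \<integral>\<^sup>+x. ennreal ((norm (g x))\<^sup>2) \<partial>S2) \<longlonglongrightarrow> 0"
    by (simp only: diff_zero)
  then have "(\<integral>\<^sup>+x. ennreal ((norm (g x))\<^sup>2) \<partial>S2) = 0"
    by (simp only: LIMSEQ_const_iff)
  then have "AE x in S2. ennreal ((norm (g x))\<^sup>2) = 0"
    using g(1) by (subst (asm) nn_integral_0_iff_AE) auto
  then show ?thesis by eventually_elim simp
qed

text \<open>
  A solid harmonic of degree \<open>l\<close> agrees on the sphere with a combination of the \<open>Y l m\<close>: the
  difference is orthogonal to the whole basis.
\<close>

lemma solid_harmonic_expansion:
  assumes D: "solid_harmonic l D"
  defines "R \<equiv> \<lambda>x. D x - (\<Sum>m=-int l..int l. scalar_inner D (SH l m) * SH l m x)"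
  shows "solid_harmonic l R" "scalar_inner R R = 0"
proof -
  show R: "solid_harmonic l R"
    unfolding R_def by (intro solid_harmonic_diff D solid_harmonic_sum solid_harmonic_cmult SH)
  have orth: "scalar_inner R (SH l' m') = 0" if m': "m' \<in> {-int l'..int l'}" for l' m'
  proof (cases "l' = l")
    case False
    then show ?thesis using solid_orthogonal[OF R SH(1)[OF m']] by simp
  next
    case True
    note cp = solid_harmonicD(1)[OF D] solid_harmonicD(1)[OF SH(1)]
    have "scalar_inner R (SH l m') = (\<integral>x. D x * cnj (SH l m' x)
        - (\<Sum>m=-int l..int l. scalar_inner D (SH l m) * (SH l m x * cnj (SH l m' x))) \<partial>S2)"
      unfolding scalar_inner_def R_def by (simp add: left_diff_distrib sum_distrib_right mult.assoc)
    also have "\<dots> = (\<integral>x. D x * cnj (SH l m' x) \<partial>S2)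
        - (\<integral>x. (\<Sum>m=-int l..int l. scalar_inner D (SH l m) * (SH l m x * cnj (SH l m' x))) \<partial>S2)"
      using m' True by (intro Bochner_Integration.integral_diff cpoly_integrable cpoly_intros cp) auto
    also have "(\<integral>x. (\<Sum>m=-int l..int l. scalar_inner D (SH l m) * (SH l m x * cnj (SH l m' x))) \<partial>S2)
        = (\<Sum>m=-int l..int l. \<integral>x. scalar_inner D (SH l m) * (SH l m x * cnj (SH l m' x)) \<partial>S2)"
      using m' True by (intro Bochner_Integration.integral_sum cpoly_integrable cpoly_intros cp) auto
    also have "\<dots> = (\<Sum>m=-int l..int l. scalar_inner D (SH l m) * scalar_inner (SH l m) (SH l m'))"
      by (simp add: scalar_inner_def)
    also have "\<dots> = (\<Sum>m=-int l..int l. if m = m' then scalar_inner D (SH l m') else 0)"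
      using m' True by (intro sum.cong refl) (simp add: SH_orthonormal)
    also have "\<dots> = scalar_inner D (SH l m')"
      using m' True by simp
    finally show ?thesis using True by (simp add: scalar_inner_def)
  qed
  obtain B where B: "\<And>x. x \<in> sphere 0 1 \<Longrightarrow> norm (R x) \<le> B"
    using cpoly_bounded_sphere[OF solid_harmonicD(1)[OF R]] by blast
  have "AE x in S2. R x = 0"
  proof (rule nn_integral_eq_0_if_orthogonal)
    show "R \<in> borel_measurable S2" by (rule cpoly_measurable_S2[OF solid_harmonicD(1)[OF R]])
    have "(\<integral>\<^sup>+x. ennreal ((norm (R x))\<^sup>2) \<partial>S2) \<le> (\<integral>\<^sup>+x. ennreal (B\<^sup>2) \<partial>S2)"
      using B by (intro nn_integral_mono ennreal_leI power_mono) (auto simp: space_S2)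
    also have "\<dots> < \<infinity>" by (simp add: emeasure_S2_space ennreal_mult_less_top)
    finally show "(\<integral>\<^sup>+x. ennreal ((norm (R x))\<^sup>2) \<partial>S2) < \<infinity>" .
    show "scalar_inner R (Y l' m') = 0" if "m' \<in> {-int l'..int l'}" for l' m'
      using orth[OF that] scalar_inner_cong[of R R "Y l' m'" "SH l' m'"] SH(2)[OF that] by simp
  qed
  then show "scalar_inner R R = 0"
    unfolding scalar_inner_def by (intro integral_eq_zero_AE) (auto elim: eventually_mono)
qed

section \<open>Fields orthogonal to every vector harmonic\<close>

context
  fixes F :: "real^3 \<Rightarrow> complex^3"
  assumes F: "L2_field F"
    and perp: "\<And>l m. \<lbrakk>1 \<le> l; m \<in> {-int l..int l}\<rbrakk> \<Longrightarrow> coeff_y Y l m F = 0"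
      "\<And>l m. \<lbrakk>1 \<le> l; m \<in> {-int l..int l}\<rbrakk> \<Longrightarrow> coeff_z Y l m F = 0"
begin

text \<open>The remainder \<open>R\<close> of the expansion of \<open>D\<close> in the basis has
  norm 0. By \<open>solid_curl_inner\<close> and \<open>solid_grad_inner\<close> its curl and
  gradient then have norm 0 too, so orthogonality passes from the basis to \<open>D\<close> without
  comparing derivatives of functions known only on the sphere.\<close>

lemma perp_solid:
  assumes D: "solid_harmonic (Suc l) D"
  shows "field_inner F (solid_curl D) = 0" "field_inner F (solid_grad (Suc l) D) = 0"
proof -
  let ?l = "Suc l"
  let ?c = "\<lambda>m. scalar_inner D (SH ?l m)"
  let ?sG = "\<Sum>m=-int ?l..int ?l. cnj (?c m) * field_inner F (solid_grad ?l (SH ?l m))"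
  let ?G = "\<lambda>x. solid_grad ?l D x - (\<Sum>m=-int ?l..int ?l. ?c m *s solid_grad ?l (SH ?l m) x)"
  let ?sC = "\<Sum>m=-int ?l..int ?l. cnj (?c m) * field_inner F (solid_curl (SH ?l m))"
  let ?C = "\<lambda>x. solid_curl D x - (\<Sum>m=-int ?l..int ?l. ?c m *s solid_curl (SH ?l m) x)"
  define R where "R = (\<lambda>x. D x - (\<Sum>m=-int ?l..int ?l. ?c m * SH ?l m x))"
  have R: "solid_harmonic ?l R" "scalar_inner R R = 0"
    unfolding R_def using solid_harmonic_expansion[OF D] by auto
  have cS: "cpoly (SH ?l m)" if "m \<in> {-int ?l..int ?l}" for m
    using solid_harmonicD(1)[OF SH(1)[OF that]] .
  have cs: "cpoly (\<lambda>x. \<Sum>m=-int ?l..int ?l. ?c m * SH ?l m x)"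
    by (intro cpoly_sum cpoly.mult cpoly.const cS)
  note cD = solid_harmonicD(1)[OF D]
  have L: "L2_field (solid_curl R)" "L2_field (solid_grad ?l R)" "L2_field (solid_curl D)" "L2_field (solid_grad ?l D)"
    by (intro L2_field_solid_curl L2_field_solid_grad solid_harmonicD(1)[OF R(1)] cD)+
  have 0: "0 < lam ?l" by (rule lam_pos) simp
  have "field_inner F (solid_curl R) = 0"
    using solid_curl_inner[OF R(1,1)] R(2)
    by (intro field_inner_AE_0_right[OF F L(1) field_inner_self_eq_0[OF L(1)]]) simp
  moreover have "solid_curl R = ?C"
  proof
    fix x
    have "Lop k R x = Lop k D x - (\<Sum>m=-int ?l..int ?l. ?c m * Lop k (SH ?l m) x)" for k
    proof -
      have "Lop k (\<lambda>x. \<Sum>m=-int ?l..int ?l. ?c m * SH ?l m x) x = (\<Sum>m=-int ?l..int ?l. ?c m * Lop k (SH ?l m) x)"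
        by (subst Lop_sum, intro cpoly.mult cpoly.const cS, assumption)
           (intro sum.cong refl Lop_cmult cS)
      then show ?thesis unfolding R_def by (subst Lop_diff[OF cD cs]) simp
    qed
    then show "solid_curl R x = ?C x"
      by (simp add: vec_eq_iff solid_curl_nth)
  qed
  moreover have perp_curl: "field_inner F (solid_curl (SH ?l m)) = 0" if "m \<in> {-int ?l..int ?l}" for m
    using perp(1)[of ?l m] that 0 by (simp add: coeff_y_SH)
  moreover have "field_inner F ?C =
      field_inner F (solid_curl D) - ?sC"
    by (intro field_inner_diff_sum_right F L(3) L2_field_solid_curl cS)
  moreover have "?sC = 0"
    by (intro sum.neutral ballI) (simp only: perp_curl mult_zero_right)
  ultimately show "field_inner F (solid_curl D) = 0"
    by simp
  have "field_inner F (solid_grad ?l R) = 0"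
    using solid_grad_inner[OF R(1,1)] R(2)
    by (intro field_inner_AE_0_right[OF F L(2) field_inner_self_eq_0[OF L(2)]]) simp
  moreover have "solid_grad ?l R = ?G"
  proof
    fix x
    have "partial k R x = partial k D x - (\<Sum>m=-int ?l..int ?l. ?c m * partial k (SH ?l m) x)" for k
    proof -
      have "partial k (\<lambda>x. \<Sum>m=-int ?l..int ?l. ?c m * SH ?l m x) x = (\<Sum>m=-int ?l..int ?l. ?c m * partial k (SH ?l m) x)"
        by (subst partial_sum, intro cpoly.mult cpoly.const cS, assumption)
           (intro sum.cong refl partial_cmult cS)
      then show ?thesis unfolding R_def by (subst partial_diff[OF cD cs]) simp
    qed
    then show "solid_grad ?l R x = ?G x"
      by (simp add: vec_eq_iff solid_grad_nth R_def right_diff_distrib sum_subtractf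
          sum_distrib_left sum_distrib_right algebra_simps del: of_nat_Suc)
  qed
  moreover have perp_grad: "field_inner F (solid_grad ?l (SH ?l m)) = 0" if "m \<in> {-int ?l..int ?l}" for m
    using perp(2)[of ?l m] that 0 by (simp add: coeff_z_SH)
  moreover have "field_inner F ?G =
      field_inner F (solid_grad ?l D) - ?sG"
    by (intro field_inner_diff_sum_right F L(4) L2_field_solid_grad cS)
  moreover have "?sG = 0"
    by (intro sum.neutral ballI) (simp only: perp_grad mult_zero_right)
  ultimately show "field_inner F (solid_grad ?l D) = 0"
    by simp
qed

lemma perp_solid_curl:
  assumes D: "solid_harmonic l D"
  shows "field_inner F (solid_curl D) = 0"
proof (cases l)
  case 0
  then have "D = (\<lambda>x. D 0)" using solid_harmonic_0 D by simp
  then have "Lop k D x = 0" for k x using Lop_const[of k "D 0" x] by metis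
  then have "solid_curl D = (\<lambda>x. 0)" by (simp add: fun_eq_iff vec_eq_iff solid_curl_nth)
  then show ?thesis by (simp add: field_inner_def cdot_zero_right)
qed (use D perp_solid in blast)

text \<open>For positive degree, each term of \<open>rot_field_decomposition\<close> is orthogonal
  to \<open>F\<close>. For degree 0 the factor \<open>l * (l + 1)\<close> in that identity would be
  0, but then the field is a constant multiple of the curl of a coordinate.\<close>

lemma perp_rot_field:
  assumes p: "solid_harmonic l p"
  shows "field_inner F (\<lambda>x. p x *s (Q_mat x *v axis i 1)) = 0"
proof (cases l)
  case 0
  then have p0: "p = (\<lambda>x. p 0)" using solid_harmonic_0 p by simp
  have "p x *s (Q_mat x *v axis i 1) = p 0 *s solid_curl (\<lambda>x. crd x i) x" for x
  proof -
    have "grad (\<lambda>x. crd x i) x = axis i 1"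
      by (simp add: vec_eq_iff grad_def partial_coord axis_def eq_commute)
    then show ?thesis by (subst p0) (simp add: solid_curl_def)
  qed
  then show ?thesis
    using perp_solid_curl[OF solid_harmonic_coord[of i]] by (simp add: field_inner_mult_right)
next
  case (Suc n)
  note p = p[unfolded Suc]
  note c = solid_harmonicD(1)[OF p]
  let ?N = "of_nat (Suc n * Suc (Suc n)) :: complex"
  let ?d = "1 / of_nat (2 * Suc n + 1) :: complex"
  let ?xp = "\<lambda>x. crd x i * p x"
  have L: "L2_field (solid_grad (Suc n) (Lop i p))" "L2_field (solid_curl ?xp)"
    "L2_field (solid_curl (partial i p))" "L2_field (solid_curl (raise_harmonic (Suc n) i p))"
    using solid_harmonicD(1)[OF solid_harmonic_raise[OF p, of i]]
    by (auto intro!: L2_field_solid_curl L2_field_solid_grad cpoly_intros cpoly_Lop cpoly_partial c)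
  have partial: "field_inner F (solid_curl (partial i p)) = 0"
    by (rule perp_solid_curl[OF solid_harmonic_partial[OF p]])
  have "field_inner F (solid_curl ?xp) =
      field_inner F (\<lambda>x. solid_curl (raise_harmonic (Suc n) i p) x + ?d *s solid_curl (partial i p) x)"
    by (rule field_inner_cong) (simp add: solid_curl_coord_mult[OF c, of _ i "Suc n"])
  also have "\<dots> = 0"
    using perp_solid_curl[OF solid_harmonic_raise[OF p, of i]] partial
    by (simp add: field_inner_add_right F L L2_field_mult field_inner_mult_right del: of_nat_Suc)
  finally have xp: "field_inner F (solid_curl ?xp) = 0" .
  have grad: "field_inner F (solid_grad (Suc n) (Lop i p)) = 0"
    by (rule perp_solid(2)[OF solid_harmonic_Lop[OF p]])
  have "cnj ?N * field_inner F (\<lambda>x. p x *s (Q_mat x *v axis i 1)) =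
      field_inner F (\<lambda>x. ?N *s (p x *s (Q_mat x *v axis i 1)))"
    by (rule field_inner_mult_right[symmetric])
  also have "\<dots> = field_inner F (\<lambda>x. solid_grad (Suc n) (Lop i p) x + of_nat (Suc n) *s solid_curl ?xp x
      - solid_curl (partial i p) x)"
    by (rule field_inner_cong) (simp only: rot_field_decomposition[OF p, symmetric] vector_smult_assoc)
  also have "\<dots> = 0"
    using xp grad partial
    by (simp add: field_inner_add_right field_inner_diff_right F L L2_field_mult L2_field_add
        field_inner_mult_right del: of_nat_Suc)
  finally show ?thesis by (simp del: of_nat_Suc of_nat_mult)
qed

text \<open>The scalar coefficients of this function at the harmonics are inner products of
  \<open>F\<close> with the fields of \<open>perp_rot_field\<close>; scalar completeness finishes.
  The bound 3 on the rotation field only serves square-integrability.\<close>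

lemma rot_field_cdot_AE_0: "AE x in S2. F x \<bullet>\<^sub>C (Q_mat x *v axis i 1) = 0"
proof (rule nn_integral_eq_0_if_orthogonal)
  let ?A = "\<lambda>x. Q_mat x *v axis i 1"
  let ?g = "\<lambda>x. F x \<bullet>\<^sub>C ?A x"
  have "solid_curl (\<lambda>x. crd x i) = ?A"
    by (auto simp: fun_eq_iff solid_curl_def grad_def partial_coord axis_def vec_eq_iff matrix_vector_mult_def eq_commute)
  then have "cpoly (\<lambda>x. ?A x $ k)" for k
    using cpoly_Lop[OF cpoly.coord, of k i] solid_curl_nth[of "\<lambda>x. crd x i"] by (metis (no_types, lifting) ext)
  then have A: "L2_field ?A" by (rule L2_field_cpoly)
  show m: "?g \<in> borel_measurable S2"
    using F A by (intro measurable_cdot) (auto simp: L2_field_def)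
  have nA: "norm (?A x) \<le> 3" if "x \<in> sphere 0 1" for x
  proof -
    have "norm (?A x) \<le> (\<Sum>k\<in>UNIV. norm (?A x $ k))" unfolding norm_vec_def by (rule L2_set_le_sum) simp
    moreover have le: "norm (?A x $ k) \<le> 1" for k
    proof -
      have "\<bar>x $ j\<bar> \<le> 1" for j using component_le_norm_cart[of x j] that by simp
      then show ?thesis
        using exhaust_3[of i] exhaust_3[of k]
        by (auto simp: Q_mat_def matrix_vector_mult_def sum_3 axis_def Let_def)
    qed
    have "(\<Sum>k\<in>UNIV. norm (?A x $ k)) \<le> 3"
      using le[of 1] le[of 2] le[of 3] by (simp only: sum_3)
    ultimately show ?thesis by simp
  qed
  have "(\<integral>\<^sup>+x. ennreal ((norm (?g x))\<^sup>2) \<partial>S2) \<le> (\<integral>\<^sup>+x. 9 * ennreal ((norm (F x))\<^sup>2) \<partial>S2)"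
  proof (rule nn_integral_mono)
    fix x assume "x \<in> space S2"
    then have "norm (?g x) \<le> norm (F x) * 3"
      using order_trans[OF norm_cdot_le mult_left_mono[OF nA]] by (simp add: space_S2)
    then have "(norm (?g x))\<^sup>2 \<le> (norm (F x) * 3)\<^sup>2" by (intro power_mono) auto
    then have "ennreal ((norm (?g x))\<^sup>2) \<le> ennreal (9 * (norm (F x))\<^sup>2)"
      by (intro ennreal_leI) (simp add: power_mult_distrib mult.commute)
    then show "ennreal ((norm (?g x))\<^sup>2) \<le> 9 * ennreal ((norm (F x))\<^sup>2)"
      by (simp add: ennreal_mult)
  qed
  also have "\<dots> = 9 * (\<integral>\<^sup>+x. ennreal ((norm (F x))\<^sup>2) \<partial>S2)"
    using F by (intro nn_integral_cmult) (auto simp: L2_field_def)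
  also have "\<dots> < \<infinity>" using F by (simp add: L2_field_def L2sq_def ennreal_mult_less_top)
  finally show "(\<integral>\<^sup>+x. ennreal ((norm (?g x))\<^sup>2) \<partial>S2) < \<infinity>" .
  fix l m assume m: "m \<in> {-int l..int l}"
  have "scalar_inner ?g (Y l m) = scalar_inner ?g (SH l m)"
    by (rule scalar_inner_cong) (simp_all add: SH(2)[OF m])
  also have "\<dots> = field_inner F (\<lambda>x. SH l m x *s ?A x)"
    by (simp add: scalar_inner_def field_inner_def cdot_mult_right mult.commute)
  also have "\<dots> = 0" by (rule perp_rot_field[OF SH(1)[OF m]])
  finally show "scalar_inner ?g (Y l m) = 0" .
qed

end

text \<open>Orthogonality to x \<times> e_i for all three axes says that the vector product of
  \<open>F x\<close> and \<open>x\<close> is 0, so \<open>F x\<close> is normal to the sphere; being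
  tangent as well, it vanishes.\<close>

lemma vsh_complete:
  assumes F: "L2_tangent F"
    and "\<And>l m. \<lbrakk>1 \<le> l; m \<in> {-int l..int l}\<rbrakk> \<Longrightarrow> coeff_y Y l m F = 0"
    and "\<And>l m. \<lbrakk>1 \<le> l; m \<in> {-int l..int l}\<rbrakk> \<Longrightarrow> coeff_z Y l m F = 0"
  shows "AE x in S2. F x = 0"
proof -
  have "AE x in S2. F x \<bullet>\<^sub>C (Q_mat x *v axis i 1) = 0" for i
    by (rule rot_field_cdot_AE_0[OF L2_tangent_L2_field[OF F] assms(2,3)])
  then have "AE x in S2. \<forall>i. F x \<bullet>\<^sub>C (Q_mat x *v axis i 1) = 0"
    by (simp add: AE_all_countable)
  moreover have "AE x in S2. F x \<bullet>\<^sub>C cvec x = 0" using F by (simp add: L2_tangent_def)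
  moreover have "AE x in S2. x \<in> sphere 0 1" by (rule AE_I2) (simp add: space_S2)
  ultimately show ?thesis
  proof eventually_elim
    case (elim x)
    define X where "X = (\<lambda>i. crd x i)"
    define f where "f = (\<lambda>i. F x $ i)"
    have 1: "X 1 * X 1 + X 2 * X 2 + X 3 * X 3 = 1" using sphere_sum_squares[OF elim(3)] by (simp add: X_def)
    have 2: "f 1 * X 1 + f 2 * X 2 + f 3 * X 3 = 0" using elim(2) by (simp add: cdot_3 cvec_def X_def f_def)
    have 3: "f 2 * X 3 = f 3 * X 2" "f 3 * X 1 = f 1 * X 3" "f 1 * X 2 = f 2 * X 1"
      using spec[OF elim(1), of 1] spec[OF elim(1), of 2] spec[OF elim(1), of 3]
      by (simp_all add: cdot_3 Q_mat_def matrix_vector_mult_def sum_3 axis_def Let_def X_def f_def)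
    have "f 1 = 0" using 1 2 3 by algebra
    moreover have "f 2 = 0" using 1 2 3 by algebra
    moreover have "f 3 = 0" using 1 2 3 by algebra
    ultimately show "F x = 0" by (simp add: vec_eq_iff forall_3 f_def)
  qed
qed

end

section \<open>Partial sums and tails\<close>

text \<open>A nonnegative d satisfies \<open>d \<le> (1 / 2) ^ k + 2 ^ k * d\<^sup>2\<close>: either
  the first term dominates, or \<open>1 \<le> 2 ^ k * d\<close>. Thus summable weighted squares make
  the increments absolutely summable.\<close>

lemma AE_convergent_fast:
  fixes s :: "nat \<Rightarrow> real^3 \<Rightarrow> complex^3"
  assumes s: "\<And>k. s k \<in> borel_measurable S2"
    and fin: "(\<Sum>k. 2 ^ k * L2sq (\<lambda>x. s (Suc k) x - s k x)) < \<infinity>"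
  shows "AE x in S2. convergent (\<lambda>k. s k x)"
proof -
  let ?d = "\<lambda>k x. norm (s (Suc k) x - s k x)"
  have m: "(\<lambda>x. ennreal (2 ^ k * (?d k x)\<^sup>2)) \<in> borel_measurable S2" for k
    using s by measurable
  have "(\<integral>\<^sup>+x. (\<Sum>k. ennreal (2 ^ k * (?d k x)\<^sup>2)) \<partial>S2) = (\<Sum>k. \<integral>\<^sup>+x. ennreal (2 ^ k * (?d k x)\<^sup>2) \<partial>S2)"
    by (rule nn_integral_suminf[OF m])
  also have "\<dots> = (\<Sum>k. 2 ^ k * L2sq (\<lambda>x. s (Suc k) x - s k x))"
  proof (rule suminf_cong)
    fix k
    have "(\<integral>\<^sup>+x. ennreal (2 ^ k * (?d k x)\<^sup>2) \<partial>S2) = (\<integral>\<^sup>+x. ennreal (2 ^ k) * ennreal ((?d k x)\<^sup>2) \<partial>S2)"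
      by (simp add: ennreal_mult)
    also have "\<dots> = ennreal (2 ^ k) * L2sq (\<lambda>x. s (Suc k) x - s k x)"
      unfolding L2sq_def using s by (intro nn_integral_cmult) measurable
    also have "ennreal (2 ^ k) = 2 ^ k" by (simp add: ennreal_power[symmetric])
    finally show "(\<integral>\<^sup>+x. ennreal (2 ^ k * (?d k x)\<^sup>2) \<partial>S2) = 2 ^ k * L2sq (\<lambda>x. s (Suc k) x - s k x)" .
  qed
  finally have "(\<integral>\<^sup>+x. (\<Sum>k. ennreal (2 ^ k * (?d k x)\<^sup>2)) \<partial>S2) \<noteq> \<infinity>"
    using fin by simp
  then have "AE x in S2. (\<Sum>k. ennreal (2 ^ k * (?d k x)\<^sup>2)) \<noteq> \<infinity>"
    by (intro nn_integral_PInf_AE) (use m in measurable)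
  then show ?thesis
  proof eventually_elim
    case (elim x)
    have "summable (\<lambda>k. 2 ^ k * (?d k x)\<^sup>2)"
      by (rule summable_suminf_not_top) (use elim in auto)
    then have "summable (\<lambda>k. (1 / 2) ^ k + 2 ^ k * (?d k x)\<^sup>2)"
      by (intro summable_add summable_geometric) auto
    moreover have "norm (s (Suc k) x - s k x) \<le> (1 / 2) ^ k + 2 ^ k * (?d k x)\<^sup>2" for k
    proof (cases "?d k x \<le> (1 / 2) ^ k")
      case False
      then have "1 \<le> 2 ^ k * ?d k x" by (simp add: power_one_over field_simps)
      from mult_right_mono[OF this, of "?d k x"] have "?d k x \<le> 2 ^ k * (?d k x)\<^sup>2"
        by (simp add: power2_eq_square mult.assoc)
      then show ?thesis by (rule order_trans) simp
    qed (simp add: add_increasing2)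
    ultimately have "summable (\<lambda>k. s (Suc k) x - s k x)"
      by (rule summable_comparison_test'[where N=0])
    then have "convergent (\<lambda>n. \<Sum>k<n. s (Suc k) x - s k x)"
      by (simp add: summable_iff_convergent)
    then have "convergent (\<lambda>n. s n x - s 0 x)"
      by (simp only: sum_lessThan_telescope[of "\<lambda>k. s k x"])
    from convergent_add[OF this convergent_const[of "s 0 x"]] show ?case by simp
  qed
qed

text \<open>Fatou's lemma, applied to the squared distances from \<open>g\<close>.\<close>

lemma L2sq_limit_le:
  fixes s :: "nat \<Rightarrow> real^3 \<Rightarrow> complex^3"
  assumes s: "\<And>k. s k \<in> borel_measurable S2" and g: "g \<in> borel_measurable S2"
    and lim: "AE x in S2. (\<lambda>k. s k x) \<longlonglongrightarrow> u x"
    and le: "eventually (\<lambda>k. L2sq (\<lambda>x. s k x - g x) \<le> B) sequentially"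
  shows "L2sq (\<lambda>x. u x - g x) \<le> B"
proof -
  have "L2sq (\<lambda>x. u x - g x) = (\<integral>\<^sup>+x. liminf (\<lambda>k. ennreal ((norm (s k x - g x))\<^sup>2)) \<partial>S2)"
    unfolding L2sq_def
  proof (rule nn_integral_cong_AE, use lim in eventually_elim)
    case (elim x)
    then have "(\<lambda>k. ennreal ((norm (s k x - g x))\<^sup>2)) \<longlonglongrightarrow> ennreal ((norm (u x - g x))\<^sup>2)"
      by (intro tendsto_intros)
    from lim_imp_Liminf[OF _ this] show ?case by simp
  qed
  also have "\<dots> \<le> liminf (\<lambda>k. L2sq (\<lambda>x. s k x - g x))"
    unfolding L2sq_def by (rule nn_integral_liminf) (use s g in measurable)
  also have "\<dots> \<le> liminf (\<lambda>k::nat. B)" by (rule Liminf_mono[OF le])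
  also have "\<dots> = B" by (simp add: Liminf_const)
  finally show ?thesis .
qed

lemma ennreal_tail_tendsto_0:
  fixes f :: "nat \<Rightarrow> ennreal"
  assumes "(\<Sum>k. f k) < \<infinity>"
  shows "(\<lambda>n. \<Sum>k. f (k + n)) \<longlonglongrightarrow> 0"
proof -
  define g where "g = (\<lambda>k. enn2real (f k))"
  have "f k < \<infinity>" for k
    using sum_le_suminf[of f "{k}"] assms by (simp add: summableI order.strict_trans1)
  then have f: "f = (\<lambda>k. ennreal (g k))" by (simp add: g_def fun_eq_iff)
  have g0: "0 \<le> g k" for k by (simp add: g_def)
  have sg: "summable g"
    by (rule summable_suminf_not_top[OF g0]) (use assms in \<open>simp add: f[symmetric]\<close>)
  have "(\<Sum>k. f (k + n)) = ennreal (\<Sum>k. g (k + n))" for n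
    unfolding f by (intro suminf_ennreal2 g0 summable_ignore_initial_segment sg)
  moreover have "(\<lambda>n. ennreal (\<Sum>k. g (k + n))) \<longlonglongrightarrow> ennreal 0"
    by (intro tendsto_ennrealI suminf_exist_split2 sg)
  ultimately show ?thesis by simp
qed

section \<open>Bessel's inequality and tails for the combined system\<close>

context harmonic_basis
begin

text \<open>Both families share one index set, \<open>True\<close> selecting y and
  \<open>False\<close> selecting z, so that sums, inequalities and limits are treated once.\<close>

definition vsh :: "bool \<times> nat \<times> int \<Rightarrow> real^3 \<Rightarrow> complex^3" where
  "vsh i = (if fst i then vsh_y Y (fst (snd i)) (snd (snd i)) else vsh_z Y (fst (snd i)) (snd (snd i)))"

definition coef :: "bool \<times> nat \<times> int \<Rightarrow> (real^3 \<Rightarrow> complex^3) \<Rightarrow> complex" where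
  "coef i F = field_inner F (vsh i)"

definition idx :: "nat set \<Rightarrow> (bool \<times> nat \<times> int) set" where
  "idx A = UNIV \<times> (SIGMA l:A. {-int l..int l})"

lemma coef_y: "coef (True, l, m) F = coeff_y Y l m F"
  and coef_z: "coef (False, l, m) F = coeff_z Y l m F"
  by (simp_all add: coef_def vsh_def coeff_y_def coeff_z_def)

lemma finite_idx: "finite A \<Longrightarrow> finite (idx A)"
  by (simp add: idx_def finite_SigmaI)

lemma idx_mono: "A \<subseteq> B \<Longrightarrow> idx A \<subseteq> idx B"
  by (auto simp: idx_def)

lemma L2_field_vsh_idx: "i \<in> idx A \<Longrightarrow> L2_field (vsh i)"
  by (auto simp: idx_def vsh_def intro: L2_field_vsh)

lemma vsh_idx_orthonormal:
  assumes "i \<in> idx {1..}" "j \<in> idx {1..}"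
  shows "field_inner (vsh i) (vsh j) = (if i = j then 1 else 0)"
  using assms by (auto simp: idx_def vsh_def vsh_orthonormal split: if_splits)

lemma vsh_tangent:
  assumes "i \<in> idx A" "x \<in> sphere 0 1"
  shows "vsh i x \<bullet>\<^sub>C cvec x = 0"
proof -
  obtain b l m where i: "i = (b, l, m)" by (cases i)
  with assms have m: "m \<in> {-int l..int l}" by (simp add: idx_def)
  have "solid_curl (SH l m) x \<bullet>\<^sub>C cvec x = 0"
    by (simp add: cdot_3 solid_curl_nth Lop_simps cvec_def algebra_simps)
  moreover have "solid_grad l (SH l m) x \<bullet>\<^sub>C cvec x = 0"
    using cvec_solid_grad[OF SH(1)[OF m] assms(2)] by (simp add: cdot_3 sum_3 cvec_def mult.commute)
  ultimately show ?thesis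
    unfolding i vsh_def
    by (cases b) (simp_all only: fst_conv snd_conv if_True if_False vsh_y_SH[OF m assms(2)] vsh_z_SH[OF m assms(2)]
        cdot_mult_left mult_zero_right)
qed

lemma field_inner_vsh_sums:
  assumes I: "finite I" "I \<subseteq> idx {1..}"
  shows "field_inner (\<lambda>x. \<Sum>i\<in>I. c i *s vsh i x) (\<lambda>x. \<Sum>i\<in>I. d i *s vsh i x) = (\<Sum>i\<in>I. c i * cnj (d i))"
proof -
  let ?c = "\<lambda>x. \<Sum>i\<in>I. c i *s vsh i x" and ?d = "\<lambda>x. \<Sum>i\<in>I. d i *s vsh i x"
  have L: "L2_field (\<lambda>x. c *s vsh i x)" if "i \<in> I" for i c
    using that I by (intro L2_field_mult L2_field_vsh_idx[of i "{1..}"]) auto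
  have "field_inner ?c ?d =
      (\<Sum>i\<in>I. c i * (\<Sum>j\<in>I. cnj (d j) * field_inner (vsh i) (vsh j)))"
  proof -
    have "field_inner (vsh i) ?d = (\<Sum>j\<in>I. cnj (d j) * field_inner (vsh i) (vsh j))"
      if "i \<in> I" for i
    proof -
      have "field_inner (vsh i) ?d = (\<Sum>j\<in>I. field_inner (vsh i) (\<lambda>x. d j *s vsh j x))"
        using that I by (intro field_inner_sum_right L L2_field_vsh_idx[of i "{1..}"]) auto
      then show ?thesis by (simp only: field_inner_mult_right)
    qed
    moreover have "field_inner ?c ?d =
        (\<Sum>i\<in>I. field_inner (\<lambda>x. c i *s vsh i x) ?d)"
      by (intro field_inner_sum_left L L2_field_sum)
    ultimately show ?thesis by (simp add: field_inner_mult_left)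
  qed
  also have "\<dots> = (\<Sum>i\<in>I. c i * cnj (d i))"
  proof (rule sum.cong[OF refl])
    fix i assume i: "i \<in> I"
    have "(\<Sum>j\<in>I. cnj (d j) * field_inner (vsh i) (vsh j)) = (\<Sum>j\<in>I. if j = i then cnj (d j) else 0)"
    proof (rule sum.cong[OF refl])
      fix j assume j: "j \<in> I"
      have "i \<in> idx {1..}" "j \<in> idx {1..}" using i j I by blast+
      from vsh_idx_orthonormal[OF this]
      show "cnj (d j) * field_inner (vsh i) (vsh j) = (if j = i then cnj (d j) else 0)" by auto
    qed
    then show "c i * (\<Sum>j\<in>I. cnj (d j) * field_inner (vsh i) (vsh j)) = c i * cnj (d i)"
      using i I by simp
  qed
  finally show ?thesis .
qed

lemma coef_vsh_sum:
  assumes I: "finite I" "I \<subseteq> idx {1..}" and j: "j \<in> I"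
  shows "coef j (\<lambda>x. \<Sum>i\<in>I. c i *s vsh i x) = c j"
proof -
  have "(\<lambda>x. \<Sum>i\<in>I. (if i = j then 1 else 0) *s vsh i x) = vsh j"
    using I j by (auto simp: fun_eq_iff if_distrib[of "\<lambda>a. a *s _"] cong: if_cong)
  then have "coef j (\<lambda>x. \<Sum>i\<in>I. c i *s vsh i x) = (\<Sum>i\<in>I. c i * cnj (if i = j then 1 else 0))"
    unfolding coef_def using field_inner_vsh_sums[OF I, of c "\<lambda>i. if i = j then 1 else 0"] by simp
  also have "\<dots> = c j" using I j by (simp add: if_distrib cong: if_cong)
  finally show ?thesis .
qed

lemma L2sq_vsh_sum:
  assumes I: "finite I" "I \<subseteq> idx {1..}"
  shows "L2sq (\<lambda>x. \<Sum>i\<in>I. c i *s vsh i x) = ennreal (\<Sum>i\<in>I. (norm (c i))\<^sup>2)"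
proof -
  have L: "L2_field (\<lambda>x. \<Sum>i\<in>I. c i *s vsh i x)"
    using I by (intro L2_field_sum L2_field_mult L2_field_vsh_idx[of _ "{1..}"]) auto
  have "(\<Sum>i\<in>I. c i * cnj (c i)) = complex_of_real (\<Sum>i\<in>I. (norm (c i))\<^sup>2)"
    by (simp only: of_real_sum complex_norm_square)
  then show ?thesis by (simp only: L2sq_eq[OF L] field_inner_vsh_sums[OF I] Re_complex_of_real)
qed

lemma bessel:
  assumes F: "L2_field F" and I: "finite I" "I \<subseteq> idx {1..}"
  shows "ennreal (\<Sum>i\<in>I. (norm (coef i F))\<^sup>2) \<le> L2sq F"
proof -
  let ?G = "\<lambda>x. \<Sum>i\<in>I. coef i F *s vsh i x"
  let ?S = "complex_of_real (\<Sum>i\<in>I. (norm (coef i F))\<^sup>2)"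
  have L: "L2_field (\<lambda>x. c *s vsh i x)" if "i \<in> I" for i c
    using that I by (intro L2_field_mult L2_field_vsh_idx[of i "{1..}"]) auto
  have G: "L2_field ?G" by (intro L2_field_sum L)
  have S: "?S = (\<Sum>i\<in>I. coef i F * cnj (coef i F))"
    by (simp only: of_real_sum complex_norm_square)
  have FG: "field_inner F ?G = ?S"
    unfolding S by (simp add: field_inner_sum_right F L field_inner_mult_right mult.commute coef_def)
  then have GF: "field_inner ?G F = ?S"
    using field_inner_commute[of ?G F] by (simp only: complex_cnj_complex_of_real)
  have GG: "field_inner ?G ?G = ?S" unfolding S by (rule field_inner_vsh_sums[OF I])
  have "field_inner (\<lambda>x. F x - ?G x) (\<lambda>x. F x - ?G x) = field_inner F F - ?S"
    by (simp only: field_inner_diff_left[OF F G L2_field_diff[OF F G]] field_inner_diff_right[OF F F G]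
        field_inner_diff_right[OF G F G] FG GF GG) simp
  moreover have "0 \<le> Re (field_inner (\<lambda>x. F x - ?G x) (\<lambda>x. F x - ?G x))"
    unfolding field_inner_self by simp
  ultimately have "0 \<le> Re (field_inner F F - ?S)" by (simp only:)
  then show ?thesis unfolding L2sq_eq[OF F] by (intro ennreal_leI) simp
qed

lemma idx_Suc_0: "idx {0<..N} \<subseteq> idx {1..}"
  by (intro idx_mono) auto

text \<open>Indexed from 0 while degrees start at 1: \<open>energy k\<close> belongs to degree
  \<open>Suc k\<close>, so \<open>tail N\<close> collects the degrees above \<open>N\<close>,
  exactly those missing from a partial sum up to \<open>N\<close>.\<close>

definition energy :: "nat \<Rightarrow> (real^3 \<Rightarrow> complex^3) \<Rightarrow> ennreal" where
  "energy k F = ennreal (\<Sum>i\<in>idx {Suc k}. (norm (coef i F))\<^sup>2)"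

definition tail :: "nat \<Rightarrow> (real^3 \<Rightarrow> complex^3) \<Rightarrow> ennreal" where
  "tail N F = (\<Sum>k. energy (k + N) F)"

lemma sum_energy: "(\<Sum>k=m..<n. energy k F) = ennreal (\<Sum>i\<in>idx {m<..n}. (norm (coef i F))\<^sup>2)"
proof -
  have "idx {m<..n} = (\<Union>k\<in>{m..<n}. idx {Suc k})"
  proof (intro set_eqI iffI)
    fix i assume "i \<in> idx {m<..n}"
    \<comment> \<open>The degree exceeds \<open>m\<close>, hence is positive, and the subtraction of
      1 is not truncated.\<close>
    then have "fst (snd i) - 1 \<in> {m..<n}" "i \<in> idx {Suc (fst (snd i) - 1)}"
      by (auto simp: idx_def)
    then show "i \<in> (\<Union>k\<in>{m..<n}. idx {Suc k})" by (rule UN_I)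
  qed (auto simp: idx_def)
  then have "(\<Sum>i\<in>idx {m<..n}. (norm (coef i F))\<^sup>2) = (\<Sum>k=m..<n. \<Sum>i\<in>idx {Suc k}. (norm (coef i F))\<^sup>2)"
    by (simp only:) (rule sum.UNION_disjoint; auto simp: finite_idx idx_def)
  then show ?thesis by (simp add: energy_def sum_ennreal sum_nonneg)
qed

lemma sum_energy_le_tail:
  "ennreal (\<Sum>i\<in>idx {m<..n}. (norm (coef i F))\<^sup>2) \<le> tail m F"
proof -
  have "(\<Sum>k=m..<n. energy k F) = (\<Sum>k<n - m. energy (k + m) F)"
    using sum.shift_bounds_nat_ivl[of "\<lambda>k. energy k F" 0 m "n - m"]
    by (cases "m \<le> n") (simp_all add: lessThan_atLeast0)
  also have "\<dots> \<le> tail m F" unfolding tail_def by (rule sum_le_suminf) (auto simp: summableI)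
  finally show ?thesis by (simp add: sum_energy)
qed

lemma tail_0_le:
  assumes "L2_field F"
  shows "tail 0 F \<le> L2sq F"
  unfolding tail_def
proof (rule suminf_le_const[OF summableI])
  fix n
  show "(\<Sum>k<n. energy (k + 0) F) \<le> L2sq F"
    using bessel[OF assms finite_idx[of "{0<..n}"] idx_Suc_0] sum_energy[where m=0 and n=n and F=F]
    by (simp add: lessThan_atLeast0)
qed

text \<open>The weights stay abstract. Estimates use only that they have modulus at most 1, so the
  same tail serves the Mittag-Leffler weights of every time.\<close>

definition wsum :: "(bool \<times> nat \<times> int \<Rightarrow> complex) \<Rightarrow> nat \<Rightarrow> (real^3 \<Rightarrow> complex^3) \<Rightarrow> real^3 \<Rightarrow> complex^3" where
  "wsum w N F x = (\<Sum>i\<in>idx {0<..N}. (w i * coef i F) *s vsh i x)"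

lemma L2_field_wsum: "L2_field (wsum w N F)"
  unfolding wsum_def[abs_def] by (intro L2_field_sum L2_field_mult L2_field_vsh_idx)

lemma L2sq_wsum_diff:
  assumes w: "\<And>i. norm (w i) \<le> 1" and N: "N \<le> N'"
  shows "L2sq (\<lambda>x. wsum w N' F x - wsum w N F x) \<le> tail N F"
proof -
  have sub: "idx {0<..N} \<subseteq> idx {0<..N'}" using N by (intro idx_mono) auto
  have "idx {0<..N'} - idx {0<..N} = idx {N<..N'}" by (auto simp: idx_def)
  then have "wsum w N' F x - wsum w N F x = (\<Sum>i\<in>idx {N<..N'}. (w i * coef i F) *s vsh i x)" for x
    unfolding wsum_def using sum_diff[OF finite_idx sub, of "\<lambda>i. (w i * coef i F) *s vsh i x"] by simp
  then have "L2sq (\<lambda>x. wsum w N' F x - wsum w N F x) = ennreal (\<Sum>i\<in>idx {N<..N'}. (norm (w i * coef i F))\<^sup>2)"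
    by (simp only:) (rule L2sq_vsh_sum; auto simp: finite_idx idx_def)
  also have "\<dots> \<le> ennreal (\<Sum>i\<in>idx {N<..N'}. (norm (coef i F))\<^sup>2)"
    using w by (intro ennreal_leI sum_mono power_mono) (auto simp: norm_mult mult_left_le_one_le)
  also have "\<dots> \<le> tail N F" by (rule sum_energy_le_tail)
  finally show ?thesis .
qed

end

text \<open>Coefficients of the constructed solution are known for nonnegative times only. This
  suffices: derivatives are taken at positive times and are local, and the Abel integrals see only
  \<open>{0..r}\<close>.\<close>

lemma solves_coeff_cong:
  assumes "\<And>t. 0 \<le> t \<Longrightarrow> c t = c' t" and c: "solves_coeff \<beta> \<psi> l c"
  shows "solves_coeff \<beta> \<psi> l c'"
  unfolding solves_coeff_def
proof (intro conjI allI impI)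
  show "continuous_on {0..} c'"
    using c continuous_on_cong[of "{0..}" "{0..}" c c'] assms(1) by (simp add: solves_coeff_def)
  fix t :: real assume t: "0 < t"
  have d: "has_frac_deriv \<beta> c (- psi_laplace_coeff \<psi> l (c' t)) t"
    using c t assms(1) by (simp add: solves_coeff_def)
  show "has_frac_deriv \<beta> c' (- psi_laplace_coeff \<psi> l (c' t)) t"
  proof (cases "\<beta> = 1")
    case True
    then have "(c has_vector_derivative - psi_laplace_coeff \<psi> l (c' t)) (at t)"
      using d by (simp add: has_frac_deriv_def)
    then have "(c' has_vector_derivative - psi_laplace_coeff \<psi> l (c' t)) (at t)"
      by (rule has_vector_derivative_transform_within_open[where S="{0<..}"]) (use t assms(1) in auto)
    then show ?thesis using True by (simp add: has_frac_deriv_def)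
  next
    case False
    then obtain D where D: "((\<lambda>r. LINT s:{0..r}|lborel. (r - s) powr (-\<beta>) *\<^sub>R c s) has_vector_derivative D) (at t)"
      "- psi_laplace_coeff \<psi> l (c' t) = (D - t powr (-\<beta>) *\<^sub>R c 0) /\<^sub>R Gamma (1 - \<beta>)"
      using d by (auto simp: has_frac_deriv_def)
    have "(LINT s:{0..r}|lborel. (r - s) powr (-\<beta>) *\<^sub>R c s) = (LINT s:{0..r}|lborel. (r - s) powr (-\<beta>) *\<^sub>R c' s)" for r
      unfolding set_lebesgue_integral_def
      by (intro Bochner_Integration.integral_cong refl) (auto simp: indicator_def assms(1))
    then show ?thesis
      using False D assms(1)[of 0] unfolding has_frac_deriv_def by auto
  qed
qed

section \<open>Sections of random fields\<close>

lemma nn_integral_section_measurable: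
  assumes "(\<lambda>(\<omega>, x). g \<omega> x) \<in> borel_measurable (M \<Otimes>\<^sub>M S2)"
  shows "(\<lambda>\<omega>. L2sq (g \<omega>)) \<in> borel_measurable M"
proof -
  have "(\<lambda>(\<omega>, x). ennreal ((norm (g \<omega> x))\<^sup>2)) \<in> borel_measurable (M \<Otimes>\<^sub>M S2)"
    using measurable_compose[OF assms, of "\<lambda>v. ennreal ((norm v)\<^sup>2)" borel] by (simp add: split_beta)
  then show ?thesis
    unfolding L2sq_def by (rule sigma_finite_measure.borel_measurable_nn_integral[OF sigma_finite_S2])
qed

lemma field_section_measurable:
  assumes "(\<lambda>(\<omega>, x). g \<omega> x) \<in> borel_measurable (M \<Otimes>\<^sub>M S2)" "\<omega> \<in> space M"
  shows "g \<omega> \<in> borel_measurable S2"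
  using measurable_compose[OF measurable_Pair1'[OF assms(2)] assms(1)] by simp

lemma L2_norm_sq_L2sq: "L2_norm_sq M g = (\<integral>\<^sup>+\<omega>. L2sq (g \<omega>) \<partial>M)"
  by (simp add: L2_norm_sq_def L2sq_def)

lemma L2_tangent_iff: "L2_tangent F \<longleftrightarrow> F \<in> borel_measurable S2 \<and> L2sq F < \<infinity> \<and> (AE x in S2. F x \<bullet>\<^sub>C cvec x = 0)"
  by (simp add: L2_tangent_def L2sq_def)

lemma L2_tangent_diff:
  assumes "L2_tangent F" "L2_tangent G"
  shows "L2_tangent (\<lambda>x. F x - G x)"
proof -
  have "L2_field (\<lambda>x. F x - G x)" by (intro L2_field_diff L2_tangent_L2_field assms)
  moreover have "AE x in S2. F x \<bullet>\<^sub>C cvec x = 0" "AE x in S2. G x \<bullet>\<^sub>C cvec x = 0"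
    using assms by (simp_all add: L2_tangent_def)
  then have "AE x in S2. (F x - G x) \<bullet>\<^sub>C cvec x = 0" by eventually_elim (simp add: cdot_diff_left)
  ultimately show ?thesis by (simp add: L2_tangent_def L2_field_def L2sq_def)
qed

context harmonic_basis
begin

lemma eq_AE_if_coef_eq:
  assumes F: "L2_tangent F" and G: "L2_tangent G"
    and eq: "\<And>i. i \<in> idx {1..} \<Longrightarrow> coef i F = coef i G"
  shows "AE x in S2. F x = G x"
proof -
  have 0: "coef i (\<lambda>x. F x - G x) = 0" if "i \<in> idx {1..}" for i
    using eq[OF that] field_inner_diff_left[OF F[THEN L2_tangent_L2_field] G[THEN L2_tangent_L2_field] L2_field_vsh_idx[OF that]]
    by (simp add: coef_def)
  have "AE x in S2. F x - G x = 0"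
  proof (rule vsh_complete[OF L2_tangent_diff[OF F G]])
    fix l m assume "1 \<le> l" "m \<in> {-int l..int l}"
    then have "(b, l, m) \<in> idx {1..}" for b by (auto simp: idx_def)
    from 0[OF this[of True]] 0[OF this[of False]]
    show "coeff_y Y l m (\<lambda>x. F x - G x) = 0" "coeff_z Y l m (\<lambda>x. F x - G x) = 0"
      by (simp_all only: coef_y coef_z)
  qed
  then show ?thesis by eventually_elim simp
qed

lemma tail_tendsto_0:
  assumes "tail 0 F < \<infinity>"
  shows "(\<lambda>N. tail N F) \<longlonglongrightarrow> 0"
  unfolding tail_def using assms by (intro ennreal_tail_tendsto_0) (simp add: tail_def)

text \<open>A pointwise limit of measurable functions stays measurable, even jointly once
  \<open>F\<close> depends measurably on a random parameter; \<open>lim\<close> is total, so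
  divergence on a null set does no harm.\<close>

definition wlim :: "(bool \<times> nat \<times> int \<Rightarrow> complex) \<Rightarrow> (nat \<Rightarrow> nat) \<Rightarrow> (real^3 \<Rightarrow> complex^3) \<Rightarrow> real^3 \<Rightarrow> complex^3" where
  "wlim w n F x = lim (\<lambda>k. wsum w (n k) F x)"

section \<open>Limits of weighted partial sums\<close>

context
  fixes w :: "bool \<times> nat \<times> int \<Rightarrow> complex" and n :: "nat \<Rightarrow> nat" and F
  assumes F: "L2_field F" and n: "strict_mono n" and w: "\<And>i. norm (w i) \<le> 1"
    and fast: "(\<Sum>k. 2 ^ k * tail (n k) F) < \<infinity>"
begin

lemma wsum_measurable: "wsum w N F \<in> borel_measurable S2"
  using L2_field_wsum by (simp add: L2_field_def)

lemma wlim_measurable: "wlim w n F \<in> borel_measurable S2"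
  unfolding wlim_def[abs_def] by (intro borel_measurable_lim_metric wsum_measurable)

lemma wsum_tendsto_wlim: "AE x in S2. (\<lambda>k. wsum w (n k) F x) \<longlonglongrightarrow> wlim w n F x"
proof -
  have "(\<Sum>k. 2 ^ k * L2sq (\<lambda>x. wsum w (n (Suc k)) F x - wsum w (n k) F x)) \<le> (\<Sum>k. 2 ^ k * tail (n k) F)"
    using n by (intro suminf_le summableI mult_left_mono L2sq_wsum_diff w) (auto simp: strict_mono_less_eq)
  then have "AE x in S2. convergent (\<lambda>k. wsum w (n k) F x)"
    using fast by (intro AE_convergent_fast wsum_measurable) (rule order.strict_trans1)
  then show ?thesis by eventually_elim (simp add: convergent_LIMSEQ_iff wlim_def)
qed

text \<open>Fatou along the subsequence, with \<open>N\<close> arbitrary rather than a value of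
  \<open>n\<close>; this gives convergence of the full sequence of partial sums.\<close>

lemma L2sq_wlim_diff: "L2sq (\<lambda>x. wlim w n F x - wsum w N F x) \<le> tail N F"
proof (rule L2sq_limit_le[OF wsum_measurable wsum_measurable wsum_tendsto_wlim])
  have "eventually (\<lambda>k. N \<le> n k) sequentially"
    using filterlim_subseq[OF n] by (simp add: filterlim_at_top)
  then show "eventually (\<lambda>k. L2sq (\<lambda>x. wsum w (n k) F x - wsum w N F x) \<le> tail N F) sequentially"
    by eventually_elim (rule L2sq_wsum_diff[OF w])
qed

lemma L2sq_wlim_le: "L2sq (wlim w n F) \<le> L2sq F"
proof -
  have "wsum w 0 F x = 0" for x by (simp add: wsum_def idx_def)
  then show ?thesis using L2sq_wlim_diff[of 0] tail_0_le[OF F] by (simp add: order_trans)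
qed

lemma L2_tangent_wlim: "L2_tangent (wlim w n F)"
  unfolding L2_tangent_iff
proof (intro conjI wlim_measurable)
  show "L2sq (wlim w n F) < \<infinity>"
    using L2sq_wlim_le F by (auto simp: L2_field_def L2sq_def intro: order.strict_trans1)
  have "AE x in S2. x \<in> sphere 0 1" by (rule AE_I2) (simp add: space_S2)
  with wsum_tendsto_wlim show "AE x in S2. wlim w n F x \<bullet>\<^sub>C cvec x = 0"
  proof eventually_elim
    case (elim x)
    have sum_left: "(\<Sum>i\<in>I. f i) \<bullet>\<^sub>C v = (\<Sum>i\<in>I. f i \<bullet>\<^sub>C v)" for I f v
      by (induction I rule: infinite_finite_induct) (simp_all add: cdot_zero_left cdot_add_left)
    have "wsum w N F x \<bullet>\<^sub>C cvec x = 0" for N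
      unfolding wsum_def sum_left by (intro sum.neutral ballI) (simp only: cdot_mult_left vsh_tangent[OF _ elim(2)] mult_zero_right)
    moreover have "(\<lambda>k. wsum w (n k) F x \<bullet>\<^sub>C cvec x) \<longlonglongrightarrow> wlim w n F x \<bullet>\<^sub>C cvec x"
      unfolding cdot_def by (intro tendsto_intros elim(1))
    ultimately show ?case using LIMSEQ_unique[OF _ tendsto_const] by simp
  qed
qed

text \<open>Once \<open>N\<close> reaches the degree of \<open>i\<close>, the partial sum has the
  desired coefficient exactly. Bessel's inequality for the single index \<open>i\<close> bounds the
  remaining discrepancy by \<open>tail N F\<close>, which tends to 0.\<close>

lemma coef_wlim:
  assumes i: "i \<in> idx {1..}"
  shows "coef i (wlim w n F) = w i * coef i F"
proof -
  let ?c = "coef i (wlim w n F) - w i * coef i F"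
  have le: "ennreal ((norm ?c)\<^sup>2) \<le> tail N F" if N: "fst (snd i) \<le> N" for N
  proof -
    have iN: "i \<in> idx {0<..N}" using i N by (auto simp: idx_def)
    have L: "L2_field (wlim w n F)" using L2_tangent_wlim by (rule L2_tangent_L2_field)
    have "coef i (wsum w N F) = w i * coef i F"
      unfolding wsum_def[abs_def] by (rule coef_vsh_sum[OF finite_idx idx_Suc_0 iN]) simp
    then have "coef i (\<lambda>x. wlim w n F x - wsum w N F x) = ?c"
      using field_inner_diff_left[OF L L2_field_wsum L2_field_vsh_idx[OF i]] by (simp add: coef_def)
    then have "ennreal ((norm ?c)\<^sup>2) \<le> L2sq (\<lambda>x. wlim w n F x - wsum w N F x)"
      using bessel[OF L2_field_diff[OF L L2_field_wsum[of w N F]], of "{i}"] i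
      by (simp only: sum.empty sum.insert finite.emptyI finite.insertI empty_iff not_False_eq_True add_0_right
          insert_subset empty_subsetI simp_thms)
    also have "\<dots> \<le> tail N F" by (rule L2sq_wlim_diff)
    finally show ?thesis .
  qed
  have "tail 0 F < \<infinity>"
    using tail_0_le[OF F] F by (auto simp: L2_field_def L2sq_def intro: order.strict_trans1)
  from tail_tendsto_0[OF this] have "ennreal ((norm ?c)\<^sup>2) \<le> 0"
    by (rule tendsto_lowerbound) (use le in \<open>auto simp: eventually_sequentially\<close>)
  then show ?thesis by simp
qed

end

end

section \<open>The Cauchy problem\<close>

lemma psi_nonneg: "0 \<le> psi \<alpha> \<gamma> s"
  by (simp add: psi_def)

lemma coeff_measurable:
  assumes f: "(\<lambda>(\<omega>, x). f \<omega> x) \<in> borel_measurable (M \<Otimes>\<^sub>M S2)" and g: "g \<in> borel_measurable S2"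
  shows "(\<lambda>\<omega>. field_inner (f \<omega>) g) \<in> borel_measurable M"
proof -
  have "(\<lambda>p. (case p of (\<omega>, x) \<Rightarrow> f \<omega> x) \<bullet>\<^sub>C g (snd p)) \<in> borel_measurable (M \<Otimes>\<^sub>M S2)"
    by (intro measurable_cdot f measurable_compose[OF measurable_snd g])
  then have "(\<lambda>(\<omega>, x). f \<omega> x \<bullet>\<^sub>C g x) \<in> borel_measurable (M \<Otimes>\<^sub>M S2)"
    by (simp add: split_beta)
  then show ?thesis
    unfolding field_inner_def
    by (rule sigma_finite_measure.borel_measurable_lebesgue_integral[OF sigma_finite_S2])
qed

theorem theorem4p5:
  fixes M :: "'o measure"
    and Y :: "nat \<Rightarrow> int \<Rightarrow> real^3 \<Rightarrow> complex"
    and \<alpha> \<beta> \<gamma> :: real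
    and f0 :: "'o \<Rightarrow> real^3 \<Rightarrow> complex^3"
    and \<sigma>y \<sigma>z :: "nat \<Rightarrow> real"
  assumes "prob_space M"
    and "spherical_harmonic_basis Y"
    and "0 < \<alpha>" "\<alpha> \<le> 2"
    and "0 \<le> \<alpha> + \<gamma>" "\<alpha> + \<gamma> \<le> 2"
    and "0 < \<beta>" "\<beta> \<le> 1"
    and "L2_random_tangent M f0"
    and "AE x in S2. (\<integral>\<omega>. f0 \<omega> x \<partial>M) = 0"
    and "\<And>l l' m m'. \<lbrakk>1 \<le> l; 1 \<le> l'; m \<in> {-int l..int l}; m' \<in> {-int l'..int l'}\<rbrakk> \<Longrightarrow>
           (\<integral>\<omega>. coeff_y Y l m (f0 \<omega>) * cnj (coeff_z Y l' m' (f0 \<omega>)) \<partial>M) = 0"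
    and "\<And>l l' m m'. \<lbrakk>1 \<le> l; 1 \<le> l'; m \<in> {-int l..int l}; m' \<in> {-int l'..int l'}\<rbrakk> \<Longrightarrow>
           (\<integral>\<omega>. coeff_y Y l m (f0 \<omega>) * cnj (coeff_y Y l' m' (f0 \<omega>)) \<partial>M) =
             (if l = l' \<and> m = m' then complex_of_real ((\<sigma>y l)\<^sup>2) else 0)"
    and "\<And>l l' m m'. \<lbrakk>1 \<le> l; 1 \<le> l'; m \<in> {-int l..int l}; m' \<in> {-int l'..int l'}\<rbrakk> \<Longrightarrow>
           (\<integral>\<omega>. coeff_z Y l m (f0 \<omega>) * cnj (coeff_z Y l' m' (f0 \<omega>)) \<partial>M) =
             (if l = l' \<and> m = m' then complex_of_real ((\<sigma>z l)\<^sup>2) else 0)"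
    and "summable (\<lambda>n. (2 * real (Suc n) + 1) * (\<sigma>y (Suc n))\<^sup>2)"
    and "summable (\<lambda>n. (2 * real (Suc n) + 1) * (\<sigma>z (Suc n))\<^sup>2)"
  shows "\<exists>u. cauchy_solution M Y \<beta> (psi \<alpha> \<gamma>) f0 u \<and>
             (\<forall>t\<ge>0. (\<lambda>N. L2_norm_sq M
                (\<lambda>\<omega> x. u t \<omega> x - series_part Y \<beta> (psi \<alpha> \<gamma>) f0 t N \<omega> x)) \<longlonglongrightarrow> 0) \<and>
             (\<forall>v. cauchy_solution M Y \<beta> (psi \<alpha> \<gamma>) f0 v \<longrightarrow>
                (\<forall>t\<ge>0. AE \<omega> in M. AE x in S2. v t \<omega> x = u t \<omega> x))"
proof -
  interpret prob_space M by fact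
  interpret harmonic_basis Y by unfold_locales fact
  note \<beta> = \<open>0 < \<beta>\<close> \<open>\<beta> \<le> 1\<close>
  define \<psi> where "\<psi> = psi \<alpha> \<gamma>"
  define E where "E = (\<lambda>l t. ml_path \<beta> 1 (\<psi> (lam l)) t)"
  \<comment> \<open>\<open>fst (snd i)\<close> is the degree, so the weight is the same for both
    families and all orders.\<close>
  define w where "w = (\<lambda>t (i :: bool \<times> nat \<times> int). complex_of_real (E (fst (snd i)) t))"
  have \<psi>0: "0 \<le> \<psi> s" for s by (simp add: \<psi>_def psi_nonneg)
  have w1: "norm (w t i) \<le> 1" if "0 \<le> t" for t i
    using mittag_leffler_path_le_1[OF \<beta> \<psi>0 that] by (simp add: w_def E_def)
  have f0_meas: "(\<lambda>(\<omega>, x). f0 \<omega> x) \<in> borel_measurable (M \<Otimes>\<^sub>M S2)"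
    and f0_fin: "L2_norm_sq M f0 < \<infinity>"
    and f0_tan: "AE \<omega> in M. AE x in S2. f0 \<omega> x \<bullet>\<^sub>C cvec x = 0"
    using \<open>L2_random_tangent M f0\<close> by (auto simp: L2_random_tangent_def)

  have "AE \<omega> in M. L2sq (f0 \<omega>) \<noteq> \<infinity>"
    using f0_fin nn_integral_section_measurable[OF f0_meas]
    by (intro nn_integral_PInf_AE) (auto simp: L2_norm_sq_L2sq)
  with f0_tan AE_space have f0_L2: "AE \<omega> in M. L2_tangent (f0 \<omega>)"
    by eventually_elim (auto simp: L2_tangent_iff field_section_measurable[OF f0_meas] top.not_eq_extremum)

  have coef_meas: "(\<lambda>\<omega>. coef i (f0 \<omega>)) \<in> borel_measurable M" if "i \<in> idx A" for i A
    unfolding coef_def using L2_field_vsh_idx[OF that]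
    by (intro coeff_measurable[OF f0_meas]) (simp add: L2_field_def)
  have energy_meas: "(\<lambda>\<omega>. energy k (f0 \<omega>)) \<in> borel_measurable M" for k
  proof -
    have "(\<lambda>\<omega>. \<Sum>i\<in>idx {Suc k}. (norm (coef i (f0 \<omega>)))\<^sup>2) \<in> borel_measurable M"
      by (intro borel_measurable_sum borel_measurable_power borel_measurable_norm
          measurable_compose[OF coef_meas borel_measurable_norm])
    then show ?thesis unfolding energy_def by measurable
  qed
  have tail_meas: "(\<lambda>\<omega>. tail N (f0 \<omega>)) \<in> borel_measurable M" for N
    unfolding tail_def using energy_meas by measurable

  define R where "R = (\<lambda>N. \<integral>\<^sup>+\<omega>. tail N (f0 \<omega>) \<partial>M)"
  have R_eq: "R N = (\<Sum>k. \<integral>\<^sup>+\<omega>. energy (k + N) (f0 \<omega>) \<partial>M)" for N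
    unfolding R_def tail_def by (rule nn_integral_suminf[OF energy_meas])
  have "R 0 \<le> L2_norm_sq M f0"
    unfolding R_def L2_norm_sq_L2sq
    by (rule nn_integral_mono_AE, use f0_L2 in eventually_elim) (intro tail_0_le L2_tangent_L2_field)
  then have "R 0 < \<infinity>" using f0_fin by (rule order.strict_trans1)
  then have R0: "R \<longlonglongrightarrow> 0"
    unfolding R_eq[abs_def] by (intro ennreal_tail_tendsto_0) (simp add: R_eq)

  \<comment> \<open>The degrees are selected from the expected tails, which involve neither a time
    nor a sample point, so one sequence serves all of them.\<close>
  have "\<exists>n. \<forall>k. R (n k) \<le> ennreal ((1 / 4) ^ k) \<and> n k < n (Suc k)"
  proof (rule dependent_nat_choice)
    have small: "\<exists>N>m. R N \<le> ennreal ((1 / 4) ^ k)" for m k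
    proof -
      have "eventually (\<lambda>N. R N < ennreal ((1 / 4) ^ k)) sequentially"
        using R0 by (rule order_tendstoD) simp
      then obtain N where "\<And>N'. N \<le> N' \<Longrightarrow> R N' < ennreal ((1 / 4) ^ k)"
        by (auto simp: eventually_sequentially)
      then show ?thesis by (intro exI[of _ "max N (Suc m)"]) (auto intro: less_imp_le)
    qed
    show "\<exists>N. R N \<le> ennreal ((1 / 4) ^ 0)" using small[of 0 0] by blast
    show "\<exists>N'. R N' \<le> ennreal ((1 / 4) ^ Suc k) \<and> N < N'" for N k
      using small[of N "Suc k"] by blast
  qed
  then obtain n where n: "\<And>k. R (n k) \<le> ennreal ((1 / 4) ^ k)" "strict_mono n"
    by (auto simp: strict_mono_Suc_iff)

  have "(\<integral>\<^sup>+\<omega>. (\<Sum>k. 2 ^ k * tail (n k) (f0 \<omega>)) \<partial>M) = (\<Sum>k. \<integral>\<^sup>+\<omega>. 2 ^ k * tail (n k) (f0 \<omega>) \<partial>M)"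
    by (rule nn_integral_suminf) (intro borel_measurable_times_ennreal borel_measurable_const tail_meas)
  also have "\<dots> = (\<Sum>k. 2 ^ k * R (n k))"
    unfolding R_def by (intro suminf_cong nn_integral_cmult tail_meas)
  also have "\<dots> \<le> (\<Sum>k. ennreal ((1 / 2) ^ k))"
  proof (rule suminf_le)
    fix k
    have "2 ^ k * R (n k) \<le> ennreal (2 ^ k) * ennreal ((1 / 4) ^ k)"
      using n(1)[of k] by (intro mult_mono) (simp_all add: ennreal_power[symmetric])
    also have "\<dots> = ennreal ((1 / 2) ^ k)"
      by (simp add: ennreal_mult[symmetric] power_mult_distrib[symmetric])
    finally show "2 ^ k * R (n k) \<le> ennreal ((1 / 2) ^ k)" .
  qed (auto simp: summableI)
  also have "\<dots> = ennreal (\<Sum>k. (1 / 2) ^ k)"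
    by (intro suminf_ennreal2 summable_geometric) auto
  finally have "(\<integral>\<^sup>+\<omega>. (\<Sum>k. 2 ^ k * tail (n k) (f0 \<omega>)) \<partial>M) \<noteq> \<infinity>"
    by (auto simp: top_unique)
  then have "AE \<omega> in M. (\<Sum>k. 2 ^ k * tail (n k) (f0 \<omega>)) \<noteq> \<infinity>"
    by (rule nn_integral_PInf_AE[rotated])
      (intro borel_measurable_suminf_order borel_measurable_times_ennreal borel_measurable_const tail_meas)
  then have fast: "AE \<omega> in M. (\<Sum>k. 2 ^ k * tail (n k) (f0 \<omega>)) < \<infinity>"
    by eventually_elim (simp add: top.not_eq_extremum)

  define u where "u = (\<lambda>t \<omega>. wlim (w t) n (f0 \<omega>))"
  \<comment> \<open>\<open>f0_L2\<close> and \<open>fast\<close> do not mention \<open>t\<close>, so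
    the quantifier over times stands inside the almost-everywhere statement.\<close>
  have u_tan: "AE \<omega> in M. \<forall>t\<ge>0. L2_tangent (u t \<omega>) \<and> L2sq (u t \<omega>) \<le> L2sq (f0 \<omega>)
      \<and> (\<forall>N. L2sq (\<lambda>x. u t \<omega> x - wsum (w t) N (f0 \<omega>) x) \<le> tail N (f0 \<omega>))
      \<and> (\<forall>i\<in>idx {1..}. coef i (u t \<omega>) = w t i * coef i (f0 \<omega>))"
    using f0_L2 fast unfolding u_def
    by eventually_elim
      (intro allI impI conjI ballI L2_tangent_wlim L2sq_wlim_le L2sq_wlim_diff coef_wlim L2_tangent_L2_field n(2) w1; assumption)

  have wsum_meas: "(\<lambda>(\<omega>, x). wsum (w t) N (f0 \<omega>) x) \<in> borel_measurable (M \<Otimes>\<^sub>M S2)" for t N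
    unfolding wsum_def split_beta
  proof (intro borel_measurable_sum measurable_vector_mult borel_measurable_times borel_measurable_const)
    fix i assume i: "i \<in> idx {0<..N}"
    show "(\<lambda>p. coef i (f0 (fst p))) \<in> borel_measurable (M \<Otimes>\<^sub>M S2)"
      by (rule measurable_compose[OF measurable_fst coef_meas[OF i]])
    show "(\<lambda>p. vsh i (snd p)) \<in> borel_measurable (M \<Otimes>\<^sub>M S2)"
      using L2_field_vsh_idx[OF i] by (intro measurable_compose[OF measurable_snd]) (simp add: L2_field_def)
  qed
  have u_meas: "(\<lambda>(\<omega>, x). u t \<omega> x) \<in> borel_measurable (M \<Otimes>\<^sub>M S2)" for t
    unfolding u_def wlim_def split_beta
    by (intro borel_measurable_lim_metric wsum_meas[unfolded split_beta])

  have series: "series_part Y \<beta> \<psi> f0 t N \<omega> x = wsum (w t) N (f0 \<omega>) x" for t N \<omega> x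
  proof -
    have "wsum (w t) N (f0 \<omega>) x = (\<Sum>b\<in>UNIV. \<Sum>q\<in>(SIGMA l:{0<..N}. {-int l..int l}).
        (w t (b, q) * coef (b, q) (f0 \<omega>)) *s vsh (b, q) x)"
      unfolding wsum_def idx_def by (subst sum.cartesian_product) (simp add: split_beta)
    also have "\<dots> = (\<Sum>b\<in>UNIV. \<Sum>l\<in>{0<..N}. \<Sum>m=-int l..int l.
        (w t (b, l, m) * coef (b, l, m) (f0 \<omega>)) *s vsh (b, l, m) x)"
      by (subst sum.Sigma) (auto simp: split_beta)
    also have "\<dots> = (\<Sum>l\<in>{0<..N}. \<Sum>m=-int l..int l.
        (w t (True, l, m) * coef (True, l, m) (f0 \<omega>)) *s vsh (True, l, m) x
        + (w t (False, l, m) * coef (False, l, m) (f0 \<omega>)) *s vsh (False, l, m) x)"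
      by (simp add: UNIV_bool sum.distrib add.commute)
    also have "{0<..N} = {1..N}" by auto
    finally show ?thesis
      by (simp add: series_part_def w_def E_def coef_y coef_z vsh_def vec_eq_iff scaleR_complex algebra_simps)
  qed

  let ?sol = "\<lambda>v \<omega>. (\<forall>t\<ge>0. L2_tangent (v t \<omega>)) \<and> (\<forall>l\<ge>1. \<forall>m\<in>{-int l..int l}.
        solves_coeff \<beta> \<psi> l (\<lambda>t. coeff_y Y l m (v t \<omega>)) \<and> solves_coeff \<beta> \<psi> l (\<lambda>t. coeff_z Y l m (v t \<omega>)))"
  have sol_u: "cauchy_solution M Y \<beta> \<psi> f0 u"
    unfolding cauchy_solution_def
  proof (intro conjI allI impI)
    fix t :: real assume t: "0 \<le> t"
    have "L2_norm_sq M (u t) \<le> L2_norm_sq M f0"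
      unfolding L2_norm_sq_L2sq by (rule nn_integral_mono_AE, use u_tan in eventually_elim) (use t in blast)
    moreover have "AE \<omega> in M. AE x in S2. u t \<omega> x \<bullet>\<^sub>C cvec x = 0"
      using u_tan by eventually_elim (use t in \<open>auto simp: L2_tangent_def\<close>)
    ultimately show "L2_random_tangent M (u t)"
      using f0_fin u_meas by (simp add: L2_random_tangent_def order.strict_trans1)
  next
    have w0: "w 0 i = 1" for i by (simp add: w_def E_def mittag_leffler_0)
    \<comment> \<open>At time 0 all weights are 1, so both fields have the same coefficients, and
      completeness identifies them almost everywhere.\<close>
    show "AE \<omega> in M. AE x in S2. u 0 \<omega> x = f0 \<omega> x"
      using u_tan f0_L2 by eventually_elim (rule eq_AE_if_coef_eq; simp add: w0)
  next
    show "AE \<omega> in M. ?sol u \<omega>"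
      using u_tan
    proof eventually_elim
      case (elim \<omega>)
      have "solves_coeff \<beta> \<psi> l (\<lambda>t. coef (b, l, m) (u t \<omega>))" if "1 \<le> l" "m \<in> {-int l..int l}" for b l m
      proof (rule solves_coeff_cong[OF _ solves_coeff_mittag_leffler[OF \<beta>, of \<psi> l "coef (b, l, m) (f0 \<omega>)"]])
        fix t :: real assume "0 \<le> t"
        moreover have "(b, l, m) \<in> idx {1..}" using that by (auto simp: idx_def)
        ultimately show "ml_path \<beta> 1 (\<psi> (lam l)) t *\<^sub>R coef (b, l, m) (f0 \<omega>)
            = coef (b, l, m) (u t \<omega>)"
          using elim by (simp add: w_def E_def scaleR_complex)
      qed
      from this[of _ _ True] this[of _ _ False] elim show ?case by (simp only: coef_y coef_z) blast
    qed
  qed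

  have conv: "(\<lambda>N. L2_norm_sq M (\<lambda>\<omega> x. u t \<omega> x - series_part Y \<beta> \<psi> f0 t N \<omega> x)) \<longlonglongrightarrow> 0" if t: "0 \<le> t" for t
  \<comment> \<open>The pathwise tail bound integrates over the sample space to \<open>R N\<close>,
    which is free of \<open>t\<close>.\<close>
  proof (rule tendsto_sandwich[OF _ _ tendsto_const R0])
    have "L2_norm_sq M (\<lambda>\<omega> x. u t \<omega> x - series_part Y \<beta> \<psi> f0 t N \<omega> x) \<le> R N" for N
      unfolding L2_norm_sq_L2sq R_def series
      by (rule nn_integral_mono_AE, use u_tan in eventually_elim) (use t in blast)
    then show "eventually (\<lambda>N. L2_norm_sq M (\<lambda>\<omega> x. u t \<omega> x - series_part Y \<beta> \<psi> f0 t N \<omega> x) \<le> R N) sequentially"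
      by simp
  qed simp

  have uniq: "AE \<omega> in M. AE x in S2. v t \<omega> x = u t \<omega> x"
    if v: "cauchy_solution M Y \<beta> \<psi> f0 v" and t: "0 \<le> t" for v t
  proof -
    have "AE \<omega> in M. AE x in S2. v 0 \<omega> x = f0 \<omega> x"
      and "AE \<omega> in M. ?sol v \<omega>"
      using v by (auto simp: cauchy_solution_def)
    with u_tan f0_L2 show ?thesis
    proof eventually_elim
      case (elim \<omega>)
      show ?case
      proof (rule eq_AE_if_coef_eq)
        show "L2_tangent (v t \<omega>)" "L2_tangent (u t \<omega>)" using elim t by blast+
        fix i assume i: "i \<in> idx {1..}"
        obtain b l m where i_eq: "i = (b, l, m)" by (cases i)
        with i have lm: "1 \<le> l" "m \<in> {-int l..int l}" by (auto simp: idx_def)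
        have "solves_coeff \<beta> \<psi> l (\<lambda>t. coef i (v t \<omega>))"
          using elim(4) lm unfolding i_eq by (cases b) (auto simp only: coef_y coef_z)
        from solves_coeff_unique[OF \<beta> \<psi>0 this t]
        have "coef i (v t \<omega>) = E l t *\<^sub>R coef i (v 0 \<omega>)" by (simp only: E_def)
        \<comment> \<open>The initial condition is an almost-everywhere identity on the sphere,
          which is enough to determine the coefficients at time 0.\<close>
        also have "coef i (v 0 \<omega>) = coef i (f0 \<omega>)"
          unfolding coef_def
          using elim(2-4) L2_field_vsh_idx[OF i]
          by (intro field_inner_cong_AE) (auto simp: L2_tangent_def L2_field_def)
        also have "E l t *\<^sub>R coef i (f0 \<omega>) = coef i (u t \<omega>)"
          using elim(1) t i by (simp add: w_def i_eq scaleR_complex)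
        finally show "coef i (v t \<omega>) = coef i (u t \<omega>)" .
      qed
    qed
  qed

  show ?thesis
    using sol_u conv uniq unfolding \<psi>_def by blast
qed

end
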